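(* Let $\Omega\subset\mathbb{Q}_p$ be a $p$-homogeneous compact open set with $\mathfrak{m}(\Omega)>0$, and let $I_\Omega$ be its set of admissible $p$-orders. (a) A set $\Lambda\subset\mathbb{Q}_p$ is a spectrum of $\Omega$ if and only if $\Lambda$ is a $p$-homogeneous discrete set with $I_\Lambda=\{-i-1:i\in I_\Omega\}$. (b) A set $T\subset\mathbb{Q}_p$ is a tiling complement of $\Omega$ if and only if $T$ is a $p$-homogeneous discrete set with $I_T=\mathbb{Z}\setminus I_\Omega$.
   Context: $p\ge2$ is a prime. $\mathbb{Q}_p$ and $\mathbb{Z}_p$ are the $p$-adic numbers and $p$-adic integers, with valuation $v_p$ and $|x|_p=p^{-v_p(x)}$. $\mathfrak{m}$ is the Haar measure with $\mathfrak{m}(\mathbb{Z}_p)=1$. Balls are $B(a,p^n)=a+p^{-n}\mathbb{Z}_p$. Characters: $\chi(x)=e^{2\pi i\{x\}}$ (with $\{x\}$ the $p$-adic fractional part) and $\chi_y(x)=\chi(yx)$. Spectrum: $\Lambda$ is a spectrum of $\Omega$ if $\{\chi_\lambda|_\Omega\}_{\lambda\in\Lambda}$ is an orthonormal basis of $L^2(\mathfrak{m}|_\Omega/\mathfrak{m}(\Omega))$. Tiling complement: $T$ is a tiling complement of $\Omega$ if $\sum_{t\in T}1_\Omega(x-t)=1$ for a.e. $x$. Admissible $p$-orders: for $E\subset\mathbb{Q}_p$, $I_E=\{v_p(x-y):x,y\in E,\ x\ne y\}$, and $I_E^{\ge n}=\{i\in I_E:i\ge n\}$. $p$-homogeneous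 discrete set: a set $E\subset\mathbb{Q}_p$ with $I_E$ bounded above is $p$-homogeneous if for every $n\in\mathbb{Z}$ and every $a\in\mathbb{Q}_p$, $\sharp(E\cap B(a,p^{-n}))\in\{0,\ p^{\sharp I_E^{\ge n}}\}$. $p$-homogeneous compact open set: let $\mathcal{N}_n(\Omega)$ be the set of balls of radius $p^{-n}$ meeting $\Omega$. $\Omega$ is $p$-homogeneous if for every $n\in\mathbb{Z}$, either every ball of $\mathcal{N}_n(\Omega)$ contains exactly one ball of $\mathcal{N}_{n+1}(\Omega)$, or every ball of $\mathcal{N}_n(\Omega)$ contains exactly $p$ balls of $\mathcal{N}_{n+1}(\Omega)$. *)

theory Defs
  imports "HOL-Analysis.Analysis" "HOL-Computational_Algebra.Primes"
begin

text \<open>An element of Q_p is represented by its p-adic digit sequence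
  x = sum_k d_k p^k (k ranging over the integers), digits in {0..p-1},
  with d_k = 0 for all sufficiently negative k.  The prime p is the
  cardinality of the finite type parameter 'p.\<close>

typedef ('p::finite) qp =
  "{d :: int \<Rightarrow> nat. (\<forall>k. d k < CARD('p)) \<and> (\<exists>N. \<forall>k<N. d k = 0)}"
  by (rule exI[of _ "\<lambda>_. 0"]) auto

text \<open>Truncation: the representative in Z[1/p] \<inter> [0,p^n) of x mod p^n Z_p,
  i.e. sum_{k<n} d_k p^k.\<close>
definition qp_trunc :: "'p::finite qp \<Rightarrow> int \<Rightarrow> real" where
  "qp_trunc x n =
     (\<Sum>k | k < n \<and> Rep_qp x k \<noteq> 0. real (Rep_qp x k) * real CARD('p) powi k)"

definition digit_of :: "nat \<Rightarrow> real \<Rightarrow> int \<Rightarrow> nat" where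
  "digit_of p t k = nat (\<lfloor>t / real p powi k\<rfloor> mod int p)"

definition qp_zero :: "'p::finite qp" where
  "qp_zero = Abs_qp (\<lambda>_. 0)"

definition qp_add :: "'p::finite qp \<Rightarrow> 'p qp \<Rightarrow> 'p qp" where
  "qp_add x y = Abs_qp (\<lambda>k. digit_of CARD('p) (qp_trunc x (k+1) + qp_trunc y (k+1)) k)"

definition qp_sub :: "'p::finite qp \<Rightarrow> 'p qp \<Rightarrow> 'p qp" where
  "qp_sub x y = Abs_qp (\<lambda>k. digit_of CARD('p) (qp_trunc x (k+1) - qp_trunc y (k+1)) k)"

definition qp_lo :: "'p::finite qp \<Rightarrow> int" where
  "qp_lo x = (SOME N. \<forall>k<N. Rep_qp x k = 0)"

text \<open>Digit k of x*y is determined by x mod p^m and y mod p^m once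
  m + min (lo x) (lo y) \<ge> k+1.\<close>
definition qp_mult :: "'p::finite qp \<Rightarrow> 'p qp \<Rightarrow> 'p qp" where
  "qp_mult x y = Abs_qp (\<lambda>k.
     (let m = k + 1 - min (qp_lo x) (qp_lo y)
      in digit_of CARD('p) (qp_trunc x m * qp_trunc y m) k))"

instantiation qp :: (finite) "{zero, plus, minus, uminus, times}"
begin
definition zero_qp_def: "0 = qp_zero"
definition plus_qp_def: "x + y = qp_add x y"
definition minus_qp_def: "x - y = qp_sub x y"
definition uminus_qp_def: "- x = qp_sub 0 x"
definition times_qp_def: "x * y = qp_mult x y"
instance ..
end

definition qp_val :: "'p::finite qp \<Rightarrow> int" where
  "qp_val x = (THE k. Rep_qp x k \<noteq> 0 \<and> (\<forall>j<k. Rep_qp x j = 0))"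

definition qp_frac :: "'p::finite qp \<Rightarrow> real" where
  "qp_frac x = qp_trunc x 0"

text \<open>Ball B(a,p^n) = a + p^(-n) Z_p = {x. x - a has no non-zero digit below -n}.\<close>
definition qp_ball :: "'p::finite qp \<Rightarrow> int \<Rightarrow> 'p qp set" where
  "qp_ball a n = {x. \<forall>k < -n. Rep_qp (x - a) k = 0}"

definition qp_open :: "'p::finite qp set \<Rightarrow> bool" where
  "qp_open S \<longleftrightarrow> (\<forall>x\<in>S. \<exists>n. qp_ball x n \<subseteq> S)"

definition qp_top :: "'p::finite qp topology" where
  "qp_top = topology qp_open"

definition qp_M :: "'p::finite qp measure" where
  "qp_M = sigma UNIV (range (\<lambda>(a, n). qp_ball a n))"

text \<open>Inverse Monna map [0,\<infinity>) \<rightarrow> Q_p: t = sum_k d_k p^(-k-1) \<mapsto> sum_k d_k p^k.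
  It maps Lebesgue measure to Haar measure (balls a + p^(-n) Z_p correspond
  to intervals of length p^n).\<close>
definition qp_monna_inv :: "real \<Rightarrow> 'p::finite qp" where
  "qp_monna_inv t = Abs_qp (\<lambda>k. if t \<ge> 0
       then nat (\<lfloor>t * real CARD('p) powi (k+1)\<rfloor> mod int CARD('p)) else 0)"

text \<open>Haar measure m with m(Z_p) = 1.\<close>
definition qp_haar :: "'p::finite qp measure" where
  "qp_haar = distr (restrict_space lborel {0::real..}) qp_M qp_monna_inv"

definition qp_chi :: "'p::finite qp \<Rightarrow> complex" where
  "qp_chi x = cis (2 * pi * qp_frac x)"

definition qp_chi_y :: "'p::finite qp \<Rightarrow> 'p qp \<Rightarrow> complex" where
  "qp_chi_y y x = qp_chi (y * x)"

definition adm_orders :: "'p::finite qp set \<Rightarrow> int set" where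
  "adm_orders E = {qp_val (x - y) | x y. x \<in> E \<and> y \<in> E \<and> x \<noteq> y}"

definition p_hom_discrete :: "'p::finite qp set \<Rightarrow> bool" where
  "p_hom_discrete E \<longleftrightarrow> bdd_above (adm_orders E) \<and>
     (\<forall>n::int. \<forall>a. finite (E \<inter> qp_ball a (-n)) \<and>
        card (E \<inter> qp_ball a (-n)) \<in> {0, CARD('p) ^ card {i \<in> adm_orders E. i \<ge> n}})"

definition nbhd_balls :: "'p::finite qp set \<Rightarrow> int \<Rightarrow> 'p qp set set" where
  "nbhd_balls \<Omega> n = {qp_ball a (-n) | a. qp_ball a (-n) \<inter> \<Omega> \<noteq> {}}"

definition p_hom_compact_open :: "'p::finite qp set \<Rightarrow> bool" where
  "p_hom_compact_open \<Omega> \<longleftrightarrow> (\<forall>n::int.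
     (\<forall>B \<in> nbhd_balls \<Omega> n. card {B' \<in> nbhd_balls \<Omega> (n+1). B' \<subseteq> B} = 1) \<or>
     (\<forall>B \<in> nbhd_balls \<Omega> n. card {B' \<in> nbhd_balls \<Omega> (n+1). B' \<subseteq> B} = CARD('p)))"

text \<open>Lambda is a spectrum of Omega: {chi_l restricted to Omega}, l \<in> Lambda, is an
  orthonormal basis of L^2(m|Omega / m(Omega)) (orthonormal, and complete: only the
  zero element of L^2 is orthogonal to all of them).\<close>
definition qp_spectrum :: "'p::finite qp set \<Rightarrow> 'p qp set \<Rightarrow> bool" where
  "qp_spectrum \<Omega> \<Lambda> \<longleftrightarrow>
     (\<forall>l\<in>\<Lambda>. \<forall>l'\<in>\<Lambda>.
        (LINT x:\<Omega>|qp_haar. qp_chi_y l x * cnj (qp_chi_y l' x)) / complex_of_real (measure qp_haar \<Omega>)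
          = (if l = l' then 1 else 0)) \<and>
     (\<forall>f :: 'p qp \<Rightarrow> complex.
        f \<in> borel_measurable qp_haar \<and> set_integrable qp_haar \<Omega> (\<lambda>x. (cmod (f x))^2) \<and>
        (\<forall>l\<in>\<Lambda>. (LINT x:\<Omega>|qp_haar. f x * cnj (qp_chi_y l x)) = 0)
        \<longrightarrow> (AE x in qp_haar. x \<in> \<Omega> \<longrightarrow> f x = 0))"

definition tiling_complement :: "'p::finite qp set \<Rightarrow> 'p qp set \<Rightarrow> bool" where
  "tiling_complement \<Omega> T \<longleftrightarrow> (AE x in qp_haar. card {t \<in> T. x - t \<in> \<Omega>} = 1)"

end

theory Submission
  imports Defs "HOL-Computational_Algebra.Polynomial_Factorial"
begin

text \<open>Call a set full at level \<open>i\<close> if every ball of radius \<open>p\<^sup>-\<^sup>i\<close> meeting it has all its \<open>p\<close> children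
  meeting it. Homogeneity of \<open>E\<close> (discrete or compact open) means that \<open>E\<close> is full at every level in
  \<open>I\<^sub>E\<close>. A sum of \<open>\<chi>(ey)\<close> over a finite homogeneous \<open>E\<close> vanishes if \<open>v(y) = -i-1\<close> with \<open>i \<in> I\<^sub>E\<close>.
  Conversely, if such a sum vanishes for an arbitrary finite \<open>E\<close>, then \<open>E\<close> is full at level \<open>i\<close>, because
  a vanishing sum of \<open>p\<^sup>k\<close>-th roots of unity is a combination of cosets of the \<open>p\<close>-th roots of unity
  (irreducibility of the cyclotomic polynomial).

  Tilings: the Fourier transforms of \<open>\<Omega>\<close> and of \<open>T\<close> multiply to that of a ball, so \<open>T\<close> is full at
  every level outside \<open>I\<^sub>\<Omega>\<close>; since then each level is full for \<open>T\<close> or for \<open>\<Omega>\<close>, any point can be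
  written as \<open>t + w\<close> by correcting one digit at a time, which gives existence of the decomposition for
  the one direction and a violation of its uniqueness, if some \<open>i \<in> I\<^sub>\<Omega>\<close> were in \<open>I\<^sub>T\<close>, for the other.

  Spectra: orthogonality says exactly \<open>I\<^sub>\<Lambda> \<subseteq> -I\<^sub>\<Omega>-1\<close>, and completeness is equivalent to the dual
  orthogonality relations \<open>\<Sum>\<^sub>\<lambda> \<chi>(\<lambda>(x-r)) = 0\<close> over the \<open>\<lambda>\<close> in large balls, for \<open>x, r \<in> \<Omega>\<close> in
  different small balls, that is, to fullness of \<open>\<Lambda>\<close> at the levels in \<open>-I\<^sub>\<Omega>-1\<close>.\<close>

section \<open>Vanishing sums of roots of unity of prime power order\<close>

text \<open>The sets \<open>T\<close> and \<open>\<Lambda>\<close> are arbitrary, possibly infinite,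
  and a priori their points could accumulate, so every Fourier argument has to be made finite.
  Compactness and openness provide \<open>N\<close> and \<open>M\<close> such that \<Omega> is a
  union of balls of radius p^-N inside one ball of radius p^-M. Integrals of characters over
  \<Omega> thus become sums over representatives modulo a power of p, and \<open>T\<close> and
  \<open>\<Lambda>\<close> are only inspected inside a ball that is shown to contain finitely many
  of their points. For \<open>T\<close> this ball is so large that translates of \<Omega> by points
  outside never meet it. For \<open>\<Lambda>\<close> it is dual to a small ball in \<Omega>:
  characters whose frequencies differ by more than its radius are orthogonal on the small ball.
  Nothing about the structure of \<open>T\<close> or \<open>\<Lambda>\<close> has to be known
  beforehand, because the converse vanishing criterion applies to any finite set, and a single zero
  at valuation -i-1 already yields fullness at level i.\<close>

abbreviation ipoly :: "int poly \<Rightarrow> complex \<Rightarrow> complex" where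
  "ipoly f z \<equiv> poly (map_poly of_int f) z"

lemma ipoly_add: "ipoly (f + g) z = ipoly f z + ipoly g z"
proof -
  have "map_poly of_int (f + g) = (map_poly of_int f + map_poly of_int g :: complex poly)"
    by (intro poly_eqI) (simp add: coeff_map_poly)
  thus ?thesis by simp
qed

lemma ipoly_smult: "ipoly (smult c f) z = of_int c * ipoly f z"
  by (simp add: map_poly_smult)

lemma ipoly_mult: "ipoly (f * g) z = ipoly f z * ipoly g z"
  by (induction f) (simp_all add: ipoly_add ipoly_smult map_poly_pCons algebra_simps)

lemma ipoly_sum: "ipoly (\<Sum>i\<in>A. f i) z = (\<Sum>i\<in>A. ipoly (f i) z)"
  by (induction A rule: infinite_finite_induct) (simp_all add: ipoly_add)

lemma ipoly_monom: "ipoly (monom c n) z = of_int c * z ^ n"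
  by (simp add: map_poly_monom poly_monom)

lemma add_power_prime_mod:
  fixes a b :: "'a :: comm_ring_1"
  assumes "prime p"
  shows "\<exists>c. (a + b) ^ p = a ^ p + b ^ p + of_nat p * c"
proof -
  have p: "p \<ge> 2" using assms prime_ge_2_nat by blast
  have "\<exists>d. p choose k = p * d" if "k \<in> {1..<p}" for k
    using that assms dvd_choose_prime[of k p] by (auto elim!: dvdE)
  then obtain d where d: "\<And>k. k \<in> {1..<p} \<Longrightarrow> p choose k = p * d k" by metis
  have "{..p} = insert 0 (insert p {1..<p})" using p by auto
  hence "(a + b) ^ p = a ^ p + b ^ p + (\<Sum>k=1..<p. of_nat (p choose k) * a ^ k * b ^ (p - k))"
    unfolding binomial_ring using p by (simp add: add_ac)
  also have "(\<Sum>k=1..<p. of_nat (p choose k) * a ^ k * b ^ (p - k)) =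
     of_nat p * (\<Sum>k=1..<p. of_nat (d k) * a ^ k * b ^ (p - k))"
    unfolding sum_distrib_left by (intro sum.cong) (simp_all add: d mult_ac)
  finally show ?thesis by blast
qed

text \<open>Iterates the congruence (a + b)^p = a^p + b^p modulo p. It is what turns the cyclotomic
  polynomial at X + 1 into a power of X modulo p.\<close>

lemma linear_poly_prime_power:
  assumes "prime p"
  shows "\<exists>r :: int poly. [:1, 1:] ^ (p ^ n) = monom 1 (p ^ n) + 1 + of_nat p * r"
proof (induction n)
  case 0
  show ?case by (rule exI[of _ 0]) (simp add: monom_Suc one_pCons)
next
  case (Suc n)
  then obtain r :: "int poly" where r: "[:1, 1:] ^ (p ^ n) = monom 1 (p ^ n) + 1 + of_nat p * r"
    by blast
  obtain c where c: "(monom 1 (p ^ n) + 1 + of_nat p * r) ^ p =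
      (monom 1 (p ^ n) + 1) ^ p + (of_nat p * r) ^ p + of_nat p * c"
    using add_power_prime_mod[OF assms] by blast
  obtain c' where c': "(monom 1 (p ^ n) + 1 :: int poly) ^ p = monom 1 (p ^ n) ^ p + 1 ^ p + of_nat p * c'"
    using add_power_prime_mod[OF assms] by blast
  have "(of_nat p * r) ^ p = of_nat p * (of_nat p ^ (p - 1) * r ^ p)"
    using prime_gt_0_nat[OF assms] by (cases p) (simp_all add: power_mult_distrib)
  moreover have "[:1, 1:] ^ (p ^ Suc n) = (([:1, 1:] :: int poly) ^ (p ^ n)) ^ p"
    by (simp only: power_mult[symmetric] power_Suc mult.commute)
  moreover have "monom (1 :: int) (p ^ n) ^ p = monom 1 (p ^ Suc n)"
    by (simp add: monom_power mult.commute)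
  ultimately have "[:1, 1:] ^ (p ^ Suc n) =
      monom 1 (p ^ Suc n) + 1 + of_nat p * (of_nat p ^ (p - 1) * r ^ p + c + c')"
    by (simp only: r c c' distrib_left power_one)
  thus ?case by (rule exI)
qed

text \<open>Let \<open>i\<close> be the least index at which \<open>p\<close> does not divide the
  coefficient of \<open>G\<close>. In coefficient \<open>i\<close> of \<open>G * H\<close> all terms
  but the last are divisible by \<open>p\<close>, so the coefficient is not, and \<open>i\<close>
  cannot be below \<open>d\<close>. Stated for one factor, it can be applied to either side of a
  factorisation.\<close>

lemma eisenstein_degree:
  fixes G H :: "int poly" and p :: int
  assumes p: "prime p" and low: "\<And>i. i < d \<Longrightarrow> p dvd coeff (G * H) i"
    and H0: "\<not> p dvd coeff H 0" and lc: "\<not> p dvd lead_coeff G"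
  shows "d \<le> degree G"
proof (rule ccontr)
  assume *: "\<not> d \<le> degree G"
  define i where "i = (LEAST i. \<not> p dvd coeff G i)"
  have i: "\<not> p dvd coeff G i" unfolding i_def by (rule LeastI[of _ "degree G"]) (use lc in simp)
  have less: "p dvd coeff G j" if "j < i" for j using not_less_Least that unfolding i_def by blast
  have "i \<le> degree G" unfolding i_def by (rule Least_le) (use lc in simp)
  hence "p dvd coeff (G * H) i" using * by (intro low) simp
  also have "coeff (G * H) i = (\<Sum>j<i. coeff G j * coeff H (i - j)) + coeff G i * coeff H 0"
    unfolding coeff_mult by (simp add: lessThan_Suc_atMost[symmetric])
  finally have "p dvd coeff G i * coeff H 0"
    by (subst (asm) dvd_add_right_iff) (auto intro!: dvd_sum less dvd_mult2)
  thus False using p i H0 by (simp add: prime_dvd_mult_iff)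
qed

text \<open>Equals (X^(pq) - 1) / (X^q - 1); for prime p and q = p^(k-1) it is the p^k-th cyclotomic
  polynomial.\<close>

definition cyclo :: "nat \<Rightarrow> nat \<Rightarrow> int poly" where
  "cyclo p q = (\<Sum>j<p. monom 1 (j * q))"

text \<open>Since \<open>h\<close> has degree below \<open>q\<close>, the shifted copies X^(iq) h do
  not overlap: the product lists the coefficients of \<open>h\<close> in \<open>p\<close>
  consecutive blocks of length \<open>q\<close>.\<close>

lemma coeff_cyclo_mult:
  assumes "degree h < q" "c < q" "j < p"
  shows "coeff (cyclo p q * h) (c + j * q) = coeff h c"
proof -
  have "coeff (cyclo p q * h) (c + j * q) =
      (\<Sum>i<p. if c + j * q < i * q then 0 else coeff h (c + j * q - i * q))"
    unfolding cyclo_def sum_distrib_right coeff_sum by (simp add: coeff_monom_mult cong: if_cong)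
  also have "\<dots> = (\<Sum>i<p. if i = j then coeff h c else 0)"
  proof (intro sum.cong refl)
    fix i
    show "(if c + j * q < i * q then 0 else coeff h (c + j * q - i * q)) = (if i = j then coeff h c else 0)"
    proof (cases i j rule: linorder_cases)
      case less
      then obtain m where "j = i + Suc m" by (metis add_Suc_right less_iff_Suc_add)
      thus ?thesis using assms by (auto intro!: coeff_eq_0 simp: algebra_simps)
    next
      case greater
      then obtain m where "i = j + Suc m" by (metis add_Suc_right less_iff_Suc_add)
      thus ?thesis using assms by (auto simp: algebra_simps)
    qed simp
  qed
  also have "\<dots> = coeff h c" using assms by simp
  finally show ?thesis .
qed

lemma cyclo_nonzero: "p > 0 \<Longrightarrow> q > 0 \<Longrightarrow> cyclo p q \<noteq> 0"
  using coeff_cyclo_mult[of 1 q 0 0 p] by auto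

lemma lead_coeff_cyclo:
  assumes "p > 0" "q > 0"
  shows "degree (cyclo p q) = (p - 1) * q" "lead_coeff (cyclo p q) = 1"
proof -
  have "degree (cyclo p q) \<le> (p - 1) * q"
    unfolding cyclo_def by (intro degree_sum_le order.trans[OF degree_monom_le]) auto
  moreover have c: "coeff (cyclo p q) ((p - 1) * q) = 1"
    using coeff_cyclo_mult[of 1 q 0 "p - 1" p] assms by simp
  ultimately show *: "degree (cyclo p q) = (p - 1) * q" by (simp add: le_degree order_antisym)
  show "lead_coeff (cyclo p q) = 1" using c * by simp
qed

text \<open>With Y = X + 1, the identity (Y^q - 1) S = Y^(pq) - 1 reads X^q S = X^(pq) modulo p, so
  S is X^((p-1)q) modulo p.\<close>

lemma dvd_coeff_cyclo_shift:
  assumes p: "prime p" and q: "q = p ^ n" and i: "i < (p - 1) * q"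
  shows "int p dvd coeff (pcompose (cyclo p q) [:1, 1:]) i"
proof -
  define Y where "Y = ([:1, 1:] :: int poly)"
  define S where "S = (\<Sum>j<p. (Y ^ q) ^ j)"
  have p0: "p > 0" using p prime_gt_0_nat by blast
  have "pcompose (monom 1 m) Y = Y ^ m" for m
    by (induction m) (simp_all add: monom_Suc pcompose_pCons pcompose_1)
  hence S: "pcompose (cyclo p q) Y = S"
    by (simp add: cyclo_def S_def pcompose_sum power_mult[symmetric] mult.commute)
  have "(Y ^ q - 1) * S = Y ^ (p * q) - 1"
    unfolding S_def power_diff_1_eq[symmetric] power_mult[symmetric] by (simp add: mult.commute)
  moreover obtain r where "Y ^ q = monom 1 q + 1 + of_nat p * r"
    using linear_poly_prime_power[OF p, of n] unfolding Y_def q by blast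
  moreover obtain r' where "Y ^ (p * q) = monom 1 (p * q) + 1 + of_nat p * r'"
    using linear_poly_prime_power[OF p, of "Suc n"] unfolding Y_def q by auto
  ultimately have "monom 1 q * S = monom 1 (p * q) + of_nat p * (r' - r * S)"
    by (simp add: algebra_simps)
  also have "of_nat p * (r' - r * S) = smult (int p) (r' - r * S)" by (simp add: of_nat_poly)
  finally have "coeff (monom 1 q * S) (q + i) = coeff (monom 1 (p * q) + smult (int p) (r' - r * S)) (q + i)"
    by (rule arg_cong)
  moreover have "q + i \<noteq> p * q" using i p0 by (cases p) auto
  moreover have "coeff (monom 1 q * S) (q + i) = coeff S i" by (simp add: coeff_monom_mult)
  ultimately have "coeff S i = int p * coeff (r' - r * S) (q + i)"
    by (simp only: coeff_add coeff_monom coeff_smult) simp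
  hence "int p dvd coeff S i" by (metis dvd_triv_left)
  thus ?thesis using S unfolding Y_def by (simp only:)
qed

text \<open>Eisenstein's criterion at the shifted variable shows that a primitive factor of minimal
  degree vanishing at the root of unity is the whole cyclotomic polynomial.\<close>

lemma cyclo_dvd_of_root:
  fixes f :: "int poly"
  assumes p: "prime p" and q: "q = p ^ n" and root: "ipoly (cyclo p q) z = 0" and f: "ipoly f z = 0"
  shows "cyclo p q dvd f"
proof -
  have p0: "p > 0" using p prime_gt_0_nat by blast
  have q0: "q > 0" using q p0 by simp
  define P where "P = (\<lambda>g. g \<noteq> 0 \<and> ipoly g z = 0)"
  obtain g0 where g0: "P g0" and min: "\<And>h. P h \<Longrightarrow> degree g0 \<le> degree h"
    using ex_has_least_nat[of P "cyclo p q" degree] root cyclo_nonzero[OF p0 q0] unfolding P_def by blast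
  define g where "g = primitive_part g0"
  have g0g: "g0 = smult (content g0) g" by (simp add: g_def)
  have cg: "content g = 1" using g0 by (simp add: g_def P_def)
  have gz: "ipoly g z = 0" using g0 ipoly_smult[of "content g0" g z] g0g by (auto simp: P_def)
  have gnz: "g \<noteq> 0" using cg by auto
  have dg: "degree g = degree g0" by (simp add: g_def)
  \<comment> \<open>Minimality of the degree kills the pseudo-remainder, so \<open>g\<close> divides
    \<open>h\<close> over the rationals; as \<open>g\<close> is primitive, Gauss's lemma brings the
    division back to the integers.\<close>
  have dvd: "g dvd h" if h: "ipoly h z = 0" for h
  proof -
    obtain a s where as: "a \<noteq> 0" "smult a h = g * s + pseudo_mod h g"
      using pseudo_mod(1)[OF gnz] by blast
    have "ipoly (pseudo_mod h g) z = 0"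
      using arg_cong[OF as(2), of "\<lambda>u. ipoly u z"] by (simp only: ipoly_add ipoly_mult ipoly_smult h gz) simp
    hence "pseudo_mod h g = 0" using pseudo_mod(2)[OF gnz, of h] min[of "pseudo_mod h g"] dg
      unfolding P_def by force
    hence "smult a h = g * s" using as by simp
    hence "fract_poly g dvd fract_poly (smult a h)" by simp
    hence "fract_poly g dvd fract_poly h" using as(1) by (simp add: dvd_smult_iff)
    thus ?thesis using cg by (rule fract_poly_dvdD)
  qed
  obtain h where h: "cyclo p q = g * h" using dvd[OF root] by (elim dvdE)
  define G where "G = pcompose g [:1, 1:]"
  define K where "K = pcompose h [:1, 1:]"
  have GK: "pcompose (cyclo p q) [:1, 1:] = G * K" by (simp add: h pcompose_mult G_def K_def)
  have ip: "prime (int p)" using p by simp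
  have lcs: "lead_coeff G * lead_coeff K = 1"
    using lead_coeff_cyclo(2)[OF p0 q0] by (simp add: G_def K_def lead_coeff_comp h lead_coeff_mult)
  \<comment> \<open>The constant term after the shift is the value of \<open>cyclo p q\<close> at 1,
    a sum of \<open>p\<close> ones. As p^2 does not divide p, the two constant terms cannot both be
    divisible by \<open>p\<close>.\<close>
  have G0: "coeff G 0 * coeff K 0 = int p"
    using arg_cong[OF GK, of "\<lambda>u. coeff u 0"]
    by (simp add: coeff_mult_0 cyclo_def poly_sum poly_monom)
  have nlc: "\<not> int p dvd lead_coeff G" "\<not> int p dvd lead_coeff K"
    using lcs ip dvd_mult2[of "int p" "lead_coeff G" "lead_coeff K"] dvd_mult[of "int p" "lead_coeff K" "lead_coeff G"]
    by (auto simp: not_prime_unit)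
  have dG: "degree G = degree g" "degree K = degree h" by (simp_all add: G_def K_def degree_pcompose)
  have h0: "h \<noteq> 0" using h cyclo_nonzero[OF p0 q0] by auto
  have ddeg: "degree g + degree h = (p - 1) * q"
    using lead_coeff_cyclo(1)[OF p0 q0] gnz h0 by (simp add: h degree_mult_eq)
  have low: "int p dvd coeff (G * K) i" if "i < (p - 1) * q" for i
    using dvd_coeff_cyclo_shift[OF p q that] GK by simp
  have not_both: "\<not> (int p dvd coeff G 0 \<and> int p dvd coeff K 0)"
  proof
    assume "int p dvd coeff G 0 \<and> int p dvd coeff K 0"
    hence "int p * int p dvd int p" using mult_dvd_mono[of "int p" "coeff G 0" "int p" "coeff K 0"] G0 by simp
    hence "int p * int p \<le> int p * 1" using p0 by (intro zdvd_imp_le) auto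
    thus False using p0 prime_gt_1_int[OF ip] by (simp only: mult_le_cancel_left_pos of_nat_0_less_iff)
  qed
  have deg_g: "degree g \<noteq> 0"
  proof
    assume "degree g = 0"
    then obtain c where "g = [:c:]" by (rule degree_eq_zeroE)
    thus False using gz gnz by (simp add: map_poly_pCons)
  qed
  \<comment> \<open>Otherwise Eisenstein's argument with the roles exchanged gives \<open>K\<close>
    the full degree and leaves degree 0 to \<open>g\<close>, which is nonzero and has a
    root.\<close>
  have "int p dvd coeff G 0"
  proof (rule ccontr)
    assume "\<not> int p dvd coeff G 0"
    hence "(p - 1) * q \<le> degree K"
      using low by (intro eisenstein_degree[OF ip _ _ nlc(2), of _ G]) (simp_all add: mult.commute)
    thus False using ddeg dG deg_g by simp
  qed
  hence "\<not> int p dvd coeff K 0" using not_both by blast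
  hence "(p - 1) * q \<le> degree G" using low by (intro eisenstein_degree[OF ip _ _ nlc(1)]) auto
  hence "degree h = 0" using ddeg dG by simp
  then obtain c where c: "h = [:c:]" by (rule degree_eq_zeroE)
  hence "lead_coeff g * c = 1" using lead_coeff_cyclo(2)[OF p0 q0] by (auto simp: h lead_coeff_mult mult.commute split: if_splits)
  hence "c dvd 1" by (metis dvd_triv_right)
  hence "h dvd 1" using c by (simp add: is_unit_const_poly_iff)
  hence "cyclo p q dvd g" unfolding h by (simp add: mult_unit_dvd_iff)
  thus ?thesis using dvd[OF f] dvd_trans by blast
qed

text \<open>The polynomial is a multiple of the cyclotomic polynomial, and comparing degrees bounds
  the cofactor below p^(k-1), so the coefficients repeat blockwise. If they count how often each
  power of the root occurs in a vanishing sum, the multiplicity is constant on cosets of the p-th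
  roots of unity.\<close>

lemma root_of_unity_coeff_periodic:
  fixes f :: "int poly"
  assumes p: "prime p" and k: "k > 0" and f: "ipoly f (cis (2 * pi / real (p ^ k))) = 0"
    and deg: "degree f < p ^ k" and c: "c < p ^ (k - 1)" and j: "j < p"
  shows "coeff f (c + j * p ^ (k - 1)) = coeff f c"
proof -
  define q where "q = p ^ (k - 1)"
  define z where "z = cis (2 * pi / real (p ^ k))"
  have p2: "p \<ge> 2" using p prime_ge_2_nat by blast
  have q0: "q > 0" using p2 by (simp add: q_def)
  have pk: "p ^ k = p * q" using k by (cases k) (simp_all add: q_def)
  have "z ^ q \<noteq> 1"
  proof
    assume "z ^ q = 1"
    moreover have "real q * (2 * pi / real (p ^ k)) = 2 * pi / p" using q0 by (simp add: pk)
    hence "z ^ q = cis (2 * pi / p)" unfolding z_def Complex.DeMoivre by (simp only:)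
    ultimately have "cos (2 * pi / p) = 1" by (metis cis.simps(1) one_complex.sel(1))
    then obtain m :: int where "2 * pi / p = of_int m * 2 * pi" using cos_one_2pi_int by blast
    hence "1 = of_int m * real p" using p2 by (simp add: field_simps)
    hence "1 = m * int p" by (metis of_int_1 of_int_eq_iff of_int_mult of_int_of_nat_eq)
    hence "int p dvd 1" by (metis dvd_triv_right)
    thus False using p2 by simp
  qed
  moreover have "real (p * q) * (2 * pi / real (p ^ k)) = 2 * pi" using q0 p2 by (simp add: pk)
  hence "z ^ (p * q) = 1" unfolding z_def Complex.DeMoivre by (simp only: cis_2pi)
  moreover have "ipoly (cyclo p q) z = (\<Sum>j<p. (z ^ q) ^ j)"
    by (simp add: cyclo_def ipoly_sum ipoly_monom power_mult[symmetric] mult.commute)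
  moreover have "(z ^ q) ^ p = z ^ (p * q)" by (simp add: power_mult[symmetric] mult.commute)
  ultimately have "ipoly (cyclo p q) z = 0" using geometric_sum[of "z ^ q" p] by simp
  hence "cyclo p q dvd f" using f p unfolding z_def by (intro cyclo_dvd_of_root) (auto simp: q_def)
  then obtain h where h: "f = cyclo p q * h" by (elim dvdE)
  have "degree h < q"
  proof (cases "h = 0")
    case False
    hence "degree f = (p - 1) * q + degree h"
      using lead_coeff_cyclo(1)[of p q] cyclo_nonzero[of p q] p2 q0 by (simp add: h degree_mult_eq)
    moreover have "p * q = (p - 1) * q + q" using p2 by (cases p) auto
    ultimately show ?thesis using deg pk by simp
  qed (use q0 in simp)
  thus ?thesis
    using coeff_cyclo_mult[of h q c j p] coeff_cyclo_mult[of h q c 0 p] c j p2 unfolding h q_def by simp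
qed

section \<open>Arithmetic of digit sequences\<close>

text \<open>Congruence modulo the integer multiples of q^n, on real numbers because truncations are
  real and \<open>n\<close> may be negative.\<close>

definition pcong :: "real \<Rightarrow> int \<Rightarrow> real \<Rightarrow> real \<Rightarrow> bool" where
  "pcong q n a b \<longleftrightarrow> (\<exists>z::int. a - b = of_int z * q powi n)"

lemma pcong_refl [simp]: "pcong q n a a"
  unfolding pcong_def by (rule exI[of _ 0]) simp

lemma pcong_sym: "pcong q n a b \<Longrightarrow> pcong q n b a"
  unfolding pcong_def by (metis minus_diff_eq mult_minus_left of_int_minus)

lemma pcong_add: "pcong q n a b \<Longrightarrow> pcong q n c d \<Longrightarrow> pcong q n (a + c) (b + d)"
  unfolding pcong_def by (metis add_diff_add distrib_right of_int_add)

lemma pcong_minus: "pcong q n a b \<Longrightarrow> pcong q n (- a) (- b)"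
  unfolding pcong_def by (metis minus_diff_minus mult_minus_left of_int_minus)

lemma pcong_diff: "pcong q n a b \<Longrightarrow> pcong q n c d \<Longrightarrow> pcong q n (a - c) (b - d)"
  using pcong_add[OF _ pcong_minus, of q n a b c d] by simp

lemma pcong_trans [trans]: "pcong q n a b \<Longrightarrow> pcong q n b c \<Longrightarrow> pcong q n a c"
  using pcong_add[of q n a b b c] pcong_diff[of q n "a + b" "b + c" b b] by simp

lemma pcong_mono:
  assumes "pcong (real p) n a b" "m \<le> n" "p > 0"
  shows "pcong (real p) m a b"
proof -
  obtain z where z: "a - b = of_int z * real p powi n" using assms unfolding pcong_def by blast
  obtain k where "n = m + int k" using assms(2) zle_iff_zadd by blast
  hence "a - b = of_int (z * int p ^ k) * real p powi m" using z assms(3) by (simp add: power_int_add)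
  thus ?thesis unfolding pcong_def by blast
qed

lemma pcong_mult:
  assumes "pcong q m a 0" "pcong q n b c" "q \<noteq> 0"
  shows "pcong q (m + n) (a * b) (a * c)"
proof -
  obtain y z where "a = of_int y * q powi m" "b - c = of_int z * q powi n"
    using assms unfolding pcong_def by auto
  hence "a * b - a * c = of_int (y * z) * q powi (m + n)"
    using assms(3) by (simp add: power_int_add right_diff_distrib[symmetric])
  thus ?thesis unfolding pcong_def by blast
qed

lemma pcong_unique:
  assumes "pcong q n a b" "0 \<le> a" "a < q powi n" "0 \<le> b" "b < q powi n"
  shows "a = b"
proof -
  obtain z where z: "a - b = of_int z * q powi n" using assms unfolding pcong_def by blast
  have q: "q powi n > 0" using assms by simp
  have "of_int z * q powi n < 1 * q powi n" "-1 * q powi n < of_int z * q powi n"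
    using z assms by linarith+
  hence "z < 1" "-1 < z" using q by (simp_all only: mult_less_cancel_right_pos)
  hence "z = 0" by simp
  thus ?thesis using z by simp
qed

section \<open>Truncations determine the digits\<close>

lemma Rep_less: "Rep_qp (x :: 'p::finite qp) k < CARD('p)"
  using Rep_qp[of x] by blast

lemma Rep_low: "\<exists>N. \<forall>k<N. Rep_qp x k = 0"
  using Rep_qp[of x] by blast

lemma finite_trunc_support: "finite {k. k < n \<and> Rep_qp x k \<noteq> 0}"
proof -
  obtain N where "\<forall>k<N. Rep_qp x k = 0" using Rep_low by blast
  hence "{k. k < n \<and> Rep_qp x k \<noteq> 0} \<subseteq> {N..<n}" by (auto simp: linorder_not_less[symmetric])
  thus ?thesis using finite_subset by blast
qed

lemma qp_trunc_Suc:
  "qp_trunc (x :: 'p::finite qp) (n + 1) = qp_trunc x n + real (Rep_qp x n) * real CARD('p) powi n"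
proof (cases "Rep_qp x n = 0")
  case True
  hence "{k. k < n + 1 \<and> Rep_qp x k \<noteq> 0} = {k. k < n \<and> Rep_qp x k \<noteq> 0}"
    by (metis (lifting) zless_add1_eq)
  thus ?thesis by (simp add: qp_trunc_def True)
next
  case False
  hence "{k. k < n + 1 \<and> Rep_qp x k \<noteq> 0} = insert n {k. k < n \<and> Rep_qp x k \<noteq> 0}" by auto
  thus ?thesis using finite_trunc_support[of n x] by (simp add: qp_trunc_def add.commute)
qed

lemma qp_trunc_low: "(\<And>k. k < n \<Longrightarrow> Rep_qp x k = 0) \<Longrightarrow> qp_trunc x n = 0"
  unfolding qp_trunc_def by (rule sum.neutral) auto

lemma qp_trunc_nonneg: "0 \<le> qp_trunc x n"
  unfolding qp_trunc_def by (intro sum_nonneg) simp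

text \<open>Digits vanish far to the left, but from a place that depends on the number. The
  induction starts at such an unspecified place, below which the claim is trivial.\<close>

lemma upward_int_induct [case_names low step]:
  fixes n :: int
  assumes "\<exists>N. \<forall>n\<le>N. P n" and step: "\<And>n. P n \<Longrightarrow> P (n + 1)"
  shows "P n"
proof -
  obtain N where N: "\<And>n. n \<le> N \<Longrightarrow> P n" using assms(1) by blast
  show ?thesis
  proof (cases "n \<le> N")
    case False
    hence "N \<le> n" by simp
    thus ?thesis by (induction rule: int_ge_induct) (auto intro: N step)
  qed (rule N)
qed

lemma qp_trunc_less: "qp_trunc (x :: 'p::finite qp) n < real CARD('p) powi n"
proof (induction n rule: upward_int_induct)
  case low
  obtain N where "\<forall>k<N. Rep_qp x k = 0" using Rep_low by blast
  hence "qp_trunc x n = 0" if "n \<le> N" for n using that by (intro qp_trunc_low) auto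
  thus ?case by (intro exI[of _ N]) auto
next
  case (step n)
  have "qp_trunc x (n + 1) < (1 + real (Rep_qp x n)) * real CARD('p) powi n"
    using step by (simp only: qp_trunc_Suc) (simp add: algebra_simps)
  also have "\<dots> \<le> real CARD('p) * real CARD('p) powi n"
    using Rep_less[of x n] by (intro mult_right_mono) auto
  also have "\<dots> = real CARD('p) powi (n + 1)" by (simp add: power_int_add)
  finally show ?case .
qed

lemma qp_trunc_cong_le:
  assumes "n \<le> m"
  shows "pcong (real CARD('p)) n (qp_trunc (x :: 'p::finite qp) m) (qp_trunc x n)"
  using assms
proof (induction m rule: int_ge_induct)
  case (step m)
  have "pcong (real CARD('p)) m (qp_trunc x (m + 1)) (qp_trunc x m)"
    unfolding pcong_def by (rule exI[of _ "int (Rep_qp x m)"]) (simp add: qp_trunc_Suc)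
  thus ?case using step pcong_mono pcong_trans by (metis zero_less_card_finite)
qed simp

lemma digit_of_trunc: "digit_of CARD('p) (qp_trunc (x :: 'p::finite qp) (n + 1)) n = Rep_qp x n"
proof -
  have "qp_trunc x (n + 1) / real CARD('p) powi n = qp_trunc x n / real CARD('p) powi n + of_int (int (Rep_qp x n))"
    by (simp only: qp_trunc_Suc) (simp add: field_simps)
  moreover have "0 \<le> qp_trunc x n / real CARD('p) powi n" "qp_trunc x n / real CARD('p) powi n < 1"
    using qp_trunc_nonneg[of x n] qp_trunc_less[of x n] by simp_all
  ultimately have "\<lfloor>qp_trunc x (n + 1) / real CARD('p) powi n\<rfloor> = int (Rep_qp x n)" by linarith
  thus ?thesis using Rep_less[of x n] by (simp add: digit_of_def)
qed

lemma qp_eq_iff_trunc: "x = y \<longleftrightarrow> (\<forall>n. qp_trunc x n = qp_trunc y n)"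
proof
  assume "\<forall>n. qp_trunc x n = qp_trunc y n"
  hence "Rep_qp x = Rep_qp y" by (intro ext) (metis digit_of_trunc)
  thus "x = y" by (simp add: Rep_qp_inject)
qed simp

lemma qp_trunc_eqI:
  "pcong (real CARD('p)) n (qp_trunc (x :: 'p::finite qp) n) (qp_trunc (y :: 'p qp) n) \<Longrightarrow> qp_trunc x n = qp_trunc y n"
  by (erule pcong_unique) (auto simp: qp_trunc_nonneg qp_trunc_less)

lemma qp_eqI:
  "(\<And>n. pcong (real CARD('p)) n (qp_trunc (x :: 'p::finite qp) n) (qp_trunc y n)) \<Longrightarrow> x = y"
  using qp_eq_iff_trunc qp_trunc_eqI by blast

lemma qp_trunc_eq_iff_digits: "qp_trunc x n = qp_trunc y n \<longleftrightarrow> (\<forall>k<n. Rep_qp x k = Rep_qp y k)"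
  for x y :: "'p::finite qp"
proof
  assume eq: "qp_trunc x n = qp_trunc y n"
  show "\<forall>k<n. Rep_qp x k = Rep_qp y k"
  proof (intro allI impI)
    fix k assume "k < n"
    hence "pcong (real CARD('p)) (k + 1) (qp_trunc x (k + 1)) (qp_trunc y (k + 1))"
      using pcong_trans[OF pcong_sym[OF qp_trunc_cong_le[of "k + 1" n x]] qp_trunc_cong_le[of "k + 1" n y, folded eq]]
      by simp
    hence "qp_trunc x (k + 1) = qp_trunc y (k + 1)" by (rule qp_trunc_eqI)
    thus "Rep_qp x k = Rep_qp y k" using digit_of_trunc[of x k] digit_of_trunc[of y k] by simp
  qed
next
  assume "\<forall>k<n. Rep_qp x k = Rep_qp y k"
  thus "qp_trunc x n = qp_trunc y n" unfolding qp_trunc_def by (intro sum.cong) auto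
qed

lemma qp_trunc_eq_0_iff: "qp_trunc x n = 0 \<longleftrightarrow> (\<forall>k<n. Rep_qp x k = 0)"
  for x :: "'p::finite qp"
proof -
  have "\<forall>k. Rep_qp (qp_zero :: 'p qp) k = 0" unfolding qp_zero_def by (subst Abs_qp_inverse) auto
  moreover from this have "qp_trunc (qp_zero :: 'p qp) n = 0" by (intro qp_trunc_low) simp
  ultimately show ?thesis using qp_trunc_eq_iff_digits[of x n qp_zero] by simp
qed

lemma qp_trunc_dvd:
  assumes "qp_trunc x a = 0"
  shows "pcong (real CARD('p)) a (qp_trunc (x :: 'p::finite qp) n) 0"
proof (cases "a \<le> n")
  case True
  thus ?thesis using qp_trunc_cong_le[OF True, of x] assms by simp
next
  case False
  hence "qp_trunc x n = 0" using assms by (simp add: qp_trunc_eq_0_iff)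
  thus ?thesis by simp
qed

text \<open>The description of Q_p as an inverse limit: a sequence that is coherent modulo p^n and
  has bounded denominators is, up to congruence, the sequence of truncations of a p-adic number.
  Sum, difference and product are all defined by digits of this form, so each of their laws reduces
  to real arithmetic modulo p^n.\<close>

lemma qp_trunc_Abs_digits:
  fixes s :: "int \<Rightarrow> real"
  assumes coh: "\<And>n. pcong (real CARD('p)) n (s (n + 1)) (s n)"
    and low: "\<And>n. pcong (real CARD('p)) N (s n) 0"
  shows "pcong (real CARD('p)) n (qp_trunc (Abs_qp (\<lambda>k. digit_of CARD('p) (s (k + 1)) k) :: 'p::finite qp) n) (s n)"
proof -
  let ?P = "real CARD('p)"
  define d where "d = (\<lambda>k. digit_of CARD('p) (s (k + 1)) k)"
  have zero: "d k = 0" if "k < N" for k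
  proof -
    obtain z where z: "s (k + 1) = of_int z * ?P powi N" using low[of "k + 1"] unfolding pcong_def by auto
    define m where "m = nat (N - k - 1)"
    have N: "N = k + 1 + int m" using that by (simp add: m_def)
    have "s (k + 1) / ?P powi k = of_int (z * int CARD('p) ^ m * int CARD('p))"
      unfolding z N by (simp add: power_int_add field_simps)
    thus ?thesis unfolding d_def digit_of_def by (simp only: floor_of_int) simp
  qed
  have d: "d \<in> {d. (\<forall>k. d k < CARD('p)) \<and> (\<exists>N. \<forall>k<N. d k = 0)}"
    using zero by (auto simp: d_def digit_of_def nat_less_iff)
  define x where "x = (Abs_qp d :: 'p qp)"
  have Rep: "Rep_qp x = d" unfolding x_def by (rule Abs_qp_inverse[OF d])
  have "pcong ?P n (qp_trunc x n) (s n)"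
  proof (induction n rule: upward_int_induct)
    case low
    have "pcong ?P n (qp_trunc x n) (s n)" if "n \<le> N" for n
    proof -
      have "qp_trunc x n = 0" using that zero Rep by (intro qp_trunc_low) auto
      thus ?thesis using pcong_mono[OF assms(2) that] pcong_sym by simp
    qed
    thus ?case by blast
  next
    case (step n)
    have "pcong ?P n (s (n + 1)) (qp_trunc x n)" using step coh pcong_trans pcong_sym by blast
    then obtain z where "s (n + 1) - qp_trunc x n = of_int z * ?P powi n"
      unfolding pcong_def by blast
    hence z: "s (n + 1) = qp_trunc x n + of_int z * ?P powi n" by linarith
    have "s (n + 1) / ?P powi n = qp_trunc x n / ?P powi n + of_int z" by (simp only: z) (simp add: field_simps)
    moreover have "0 \<le> qp_trunc x n / ?P powi n" "qp_trunc x n / ?P powi n < 1"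
      using qp_trunc_nonneg[of x n] qp_trunc_less[of x n] by simp_all
    ultimately have "\<lfloor>s (n + 1) / ?P powi n\<rfloor> = z" by linarith
    hence "int (d n) = z mod int CARD('p)" by (simp add: d_def digit_of_def)
    hence "real (d n) = of_int (z mod int CARD('p))" by (metis of_int_of_nat_eq)
    hence "s (n + 1) - qp_trunc x (n + 1) = (of_int z - of_int (z mod int CARD('p))) * ?P powi n"
      by (simp only: qp_trunc_Suc Rep z) (simp add: algebra_simps)
    also have "of_int z - of_int (z mod int CARD('p)) = (of_int (z div int CARD('p)) * ?P)"
      by (metis minus_mod_eq_div_mult of_int_diff of_int_mult of_int_of_nat_eq)
    finally have "s (n + 1) - qp_trunc x (n + 1) = of_int (z div int CARD('p)) * ?P powi (n + 1)"
      by (simp add: power_int_add)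
    thus ?case using pcong_sym unfolding pcong_def by blast
  qed
  thus ?thesis by (simp add: x_def d_def)
qed

section \<open>The additive group\<close>

lemma trunc_low_bound: "\<exists>N. \<forall>m\<le>N. qp_trunc x m = 0" for x :: "'p::finite qp"
  using Rep_low[of x] qp_trunc_eq_0_iff[of x] by (metis order_less_le_trans)

lemma trunc_low_bound2:
  "\<exists>N. qp_trunc x N = 0 \<and> qp_trunc y N = 0" for x y :: "'p::finite qp"
proof -
  obtain N M where "\<forall>m\<le>N. qp_trunc x m = 0" "\<forall>m\<le>M. qp_trunc y m = 0" using trunc_low_bound by metis
  thus ?thesis by (intro exI[of _ "min N M"]) simp
qed

lemma trunc_add: "pcong (real CARD('p)) n (qp_trunc (x + y :: 'p::finite qp) n) (qp_trunc x n + qp_trunc y n)"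
proof -
  obtain N where N: "qp_trunc x N = 0" "qp_trunc y N = 0" using trunc_low_bound2 by blast
  show ?thesis unfolding plus_qp_def qp_add_def
    by (rule qp_trunc_Abs_digits[where N = N])
       (use pcong_add[OF qp_trunc_dvd[OF N(1)] qp_trunc_dvd[OF N(2)]] in
         \<open>auto intro!: pcong_add qp_trunc_cong_le\<close>)
qed

lemma trunc_diff: "pcong (real CARD('p)) n (qp_trunc (x - y :: 'p::finite qp) n) (qp_trunc x n - qp_trunc y n)"
proof -
  obtain N where N: "qp_trunc x N = 0" "qp_trunc y N = 0" using trunc_low_bound2 by blast
  show ?thesis unfolding minus_qp_def qp_sub_def
    by (rule qp_trunc_Abs_digits[where N = N])
       (use pcong_diff[OF qp_trunc_dvd[OF N(1)] qp_trunc_dvd[OF N(2)]] in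
         \<open>auto intro!: pcong_diff qp_trunc_cong_le\<close>)
qed

lemma trunc_zero [simp]: "qp_trunc (0 :: 'p::finite qp) n = 0"
  unfolding zero_qp_def qp_zero_def by (rule qp_trunc_low) (subst Abs_qp_inverse, auto)

lemma trunc_uminus: "pcong (real CARD('p)) n (qp_trunc (- x :: 'p::finite qp) n) (- qp_trunc x n)"
proof -
  have "- x = 0 - x" by (simp add: uminus_qp_def minus_qp_def)
  thus ?thesis using trunc_diff[of n 0 x] by simp
qed

instance qp :: (finite) ab_group_add
proof
  fix a b c :: "'a qp"
  show "a + b + c = a + (b + c)"
  proof (rule qp_eqI)
    fix n
    have "pcong (real CARD('a)) n (qp_trunc (a + b + c) n) (qp_trunc a n + qp_trunc b n + qp_trunc c n)"
      by (rule pcong_trans[OF trunc_add pcong_add[OF trunc_add pcong_refl]])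
    moreover have "pcong (real CARD('a)) n (qp_trunc (a + (b + c)) n) (qp_trunc a n + (qp_trunc b n + qp_trunc c n))"
      by (rule pcong_trans[OF trunc_add pcong_add[OF pcong_refl trunc_add]])
    ultimately show "pcong (real CARD('a)) n (qp_trunc (a + b + c) n) (qp_trunc (a + (b + c)) n)"
      unfolding add.assoc[of "qp_trunc a n"] by (rule pcong_trans[OF _ pcong_sym])
  qed
  show "a + b = b + a" by (simp add: plus_qp_def qp_add_def add.commute)
  show "0 + a = a"
  proof (rule qp_eqI)
    fix n
    show "pcong (real CARD('a)) n (qp_trunc (0 + a) n) (qp_trunc a n)" using trunc_add[of n 0 a] by simp
  qed
  show "- a + a = 0"
  proof (rule qp_eqI)
    fix n
    have "pcong (real CARD('a)) n (qp_trunc (- a + a) n) (- qp_trunc a n + qp_trunc a n)"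
      by (rule pcong_trans[OF trunc_add pcong_add[OF trunc_uminus pcong_refl]])
    thus "pcong (real CARD('a)) n (qp_trunc (- a + a) n) (qp_trunc 0 n)" by simp
  qed
  show "a - b = a + - b"
  proof (rule qp_eqI)
    fix n
    have "pcong (real CARD('a)) n (qp_trunc (a + - b) n) (qp_trunc a n + - qp_trunc b n)"
      by (rule pcong_trans[OF trunc_add pcong_add[OF pcong_refl trunc_uminus]])
    thus "pcong (real CARD('a)) n (qp_trunc (a - b) n) (qp_trunc (a + - b) n)"
      using pcong_trans[OF trunc_diff[of n a b] pcong_sym] by simp
  qed
qed

section \<open>Products\<close>

lemma trunc_prod_stable:
  fixes x y :: "'p::finite qp"
  assumes "qp_trunc x L = 0" "qp_trunc y L = 0" "m \<le> m'"
  shows "pcong (real CARD('p)) (m + L) (qp_trunc x m' * qp_trunc y m') (qp_trunc x m * qp_trunc y m)"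
proof -
  have "pcong (real CARD('p)) (L + m) (qp_trunc x m' * qp_trunc y m') (qp_trunc x m' * qp_trunc y m)"
    by (intro pcong_mult qp_trunc_dvd assms qp_trunc_cong_le) simp
  moreover have "pcong (real CARD('p)) (L + m) (qp_trunc y m * qp_trunc x m') (qp_trunc y m * qp_trunc x m)"
    by (intro pcong_mult qp_trunc_dvd assms qp_trunc_cong_le) simp
  ultimately show ?thesis
    unfolding mult.commute[of "qp_trunc y m"] add.commute[of L] by (rule pcong_trans)
qed

lemma qp_lo: "qp_trunc x (qp_lo x) = 0" for x :: "'p::finite qp"
  unfolding qp_trunc_eq_0_iff qp_lo_def using someI_ex[OF Rep_low[of x]] .

lemma trunc_eq_0_mono: "qp_trunc x n = 0 \<Longrightarrow> m \<le> n \<Longrightarrow> qp_trunc x m = 0"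
  for x :: "'p::finite qp"
  by (simp add: qp_trunc_eq_0_iff)

text \<open>Frees the product from the arbitrary choice made by \<open>qp_lo\<close>: any common
  lower bound \<open>L\<close> of the digits will do, and precision \<open>m\<close> in the factors
  gives precision \<open>m + L\<close> in the product. Both computations are compared at a larger
  precision \<open>M\<close>.\<close>

lemma trunc_mult:
  fixes x y :: "'p::finite qp"
  assumes L: "qp_trunc x L = 0" "qp_trunc y L = 0" and m: "n \<le> m + L"
  shows "pcong (real CARD('p)) n (qp_trunc (x * y) n) (qp_trunc x m * qp_trunc y m)"
proof -
  let ?P = "real CARD('p)"
  define K where "K = min (qp_lo x) (qp_lo y)"
  have K: "qp_trunc x K = 0" "qp_trunc y K = 0"
    unfolding K_def by (auto intro: trunc_eq_0_mono[OF qp_lo])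
  define s where "s = (\<lambda>n. qp_trunc x (n - K) * qp_trunc y (n - K))"
  have "x * y = Abs_qp (\<lambda>k. digit_of CARD('p) (s (k + 1)) k)"
    by (simp add: times_qp_def qp_mult_def s_def K_def Let_def)
  moreover have "pcong ?P n (s (n + 1)) (s n)" for n
    using trunc_prod_stable[OF K, of "n - K" "n + 1 - K"] by (simp add: s_def)
  moreover have "pcong ?P (K + K) (s n) 0" for n
    using pcong_mult[OF qp_trunc_dvd[OF K(1)] qp_trunc_dvd[OF K(2)]] by (simp add: s_def)
  ultimately have 1: "pcong ?P n (qp_trunc (x * y) n) (s n)" for n
    using qp_trunc_Abs_digits[where 'p = 'p and s = s and N = "K + K"] by (simp only:)
  define M where "M = max m (n - K)"
  have "pcong ?P n (qp_trunc x M * qp_trunc y M) (s n)"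
    using trunc_prod_stable[OF K, of "n - K" M] by (simp add: s_def M_def)
  moreover have "pcong ?P n (qp_trunc x M * qp_trunc y M) (qp_trunc x m * qp_trunc y m)"
    using pcong_mono[OF trunc_prod_stable[OF L, of m M] m] by (simp add: M_def)
  ultimately show ?thesis using 1 pcong_trans pcong_sym by blast
qed

lemma qp_mult_commute: "x * y = y * x" for x y :: "'p::finite qp"
  by (simp add: times_qp_def qp_mult_def min.commute mult.commute)

lemma trunc_add_eq_0:
  "qp_trunc x n = 0 \<Longrightarrow> qp_trunc y n = 0 \<Longrightarrow> qp_trunc (x + y) n = 0" for x y :: "'p::finite qp"
  using qp_trunc_eqI[of n "x + y" 0] trunc_add[of n x y] by simp

lemma qp_distrib_right: "(x + y) * z = x * z + y * z" for x y z :: "'p::finite qp"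
proof (rule qp_eqI)
  fix n
  let ?P = "real CARD('p)"
  obtain A B where AB: "qp_trunc x A = 0" "qp_trunc y A = 0" "qp_trunc z B = 0" "qp_trunc z B = 0"
    using trunc_low_bound2 by metis
  define L where "L = min A B"
  have L: "qp_trunc x L = 0" "qp_trunc y L = 0" "qp_trunc z L = 0"
    using AB by (auto simp: L_def intro: trunc_eq_0_mono)
  define m where "m = n - L"
  have "pcong ?P n (qp_trunc ((x + y) * z) n) (qp_trunc (x + y) m * qp_trunc z m)"
    by (rule trunc_mult[of _ L]) (use L trunc_add_eq_0 in \<open>auto simp: m_def\<close>)
  moreover have "pcong ?P n (qp_trunc (x + y) m * qp_trunc z m) ((qp_trunc x m + qp_trunc y m) * qp_trunc z m)"
    using pcong_mult[OF qp_trunc_dvd[OF L(3), of m] trunc_add[of m x y]]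
    by (simp add: m_def mult.commute)
  moreover have "pcong ?P n (qp_trunc (x * z + y * z) n) (qp_trunc x m * qp_trunc z m + qp_trunc y m * qp_trunc z m)"
    by (rule pcong_trans[OF trunc_add]) (intro pcong_add trunc_mult[of _ L], use L in \<open>auto simp: m_def\<close>)
  ultimately show "pcong ?P n (qp_trunc ((x + y) * z) n) (qp_trunc (x * z + y * z) n)"
    unfolding distrib_right by (meson pcong_trans pcong_sym)
qed

lemma qp_diff_distrib_right: "(x - y) * z = x * z - y * z" for x y z :: "'p::finite qp"
  using qp_distrib_right[of "x - y" y z] by (simp add: algebra_simps)

lemma qp_diff_distrib_left: "z * (x - y) = z * x - z * y" for x y z :: "'p::finite qp"
  by (simp add: qp_mult_commute[of z] qp_diff_distrib_right)

text \<open>The group p^n Z_p. Membership expresses that the valuation is at least \<open>n\<close>,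
  and does so for 0 too, where \<open>qp_val\<close> is unspecified.\<close>

definition pZ :: "int \<Rightarrow> 'p::finite qp set" where
  "pZ n = {x. \<forall>k<n. Rep_qp x k = 0}"

lemma pZ_iff_trunc: "x \<in> pZ n \<longleftrightarrow> qp_trunc x n = 0"
  by (simp add: pZ_def qp_trunc_eq_0_iff)

lemma pZ_zero [simp]: "0 \<in> pZ n"
  by (simp add: pZ_iff_trunc)

lemma pZ_add: "x \<in> pZ n \<Longrightarrow> y \<in> pZ n \<Longrightarrow> x + y \<in> pZ n"
  by (simp add: pZ_iff_trunc trunc_add_eq_0)

lemma pZ_diff: "x \<in> pZ n \<Longrightarrow> y \<in> pZ n \<Longrightarrow> x - y \<in> pZ n" for x :: "'p::finite qp"
  using qp_trunc_eqI[of n "x - y" 0] trunc_diff[of n x y] by (simp add: pZ_iff_trunc)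

lemma pZ_minus: "x \<in> pZ n \<Longrightarrow> - x \<in> pZ n"
  using pZ_diff[of 0 n x] by simp

lemma pZ_diff_commute: "x - y \<in> pZ n \<longleftrightarrow> y - x \<in> pZ n"
  using pZ_minus by (metis minus_diff_eq)

lemma pZ_mono: "x \<in> pZ n \<Longrightarrow> m \<le> n \<Longrightarrow> x \<in> pZ m"
  by (simp add: pZ_def)

lemma pZ_diff_iff: "x - y \<in> pZ n \<longleftrightarrow> (\<forall>k<n. Rep_qp x k = Rep_qp y k)" for x :: "'p::finite qp"
proof -
  have "qp_trunc (x - y) n = 0 \<longleftrightarrow> qp_trunc x n = qp_trunc y n"
  proof
    assume "qp_trunc (x - y) n = 0"
    hence "pcong (real CARD('p)) n (0 + qp_trunc y n) (qp_trunc x n - qp_trunc y n + qp_trunc y n)"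
      using trunc_diff[of n x y] by (intro pcong_add) simp_all
    thus "qp_trunc x n = qp_trunc y n" using qp_trunc_eqI[of n x y] pcong_sym by simp
  next
    assume "qp_trunc x n = qp_trunc y n"
    thus "qp_trunc (x - y) n = 0" using qp_trunc_eqI[of n "x - y" 0] trunc_diff[of n x y] by simp
  qed
  thus ?thesis by (simp add: pZ_iff_trunc qp_trunc_eq_iff_digits)
qed

lemma pZ_exists: "\<exists>n. x \<in> pZ n"
  using Rep_low[of x] by (auto simp: pZ_def)

lemma pZ_all_imp_zero: "(\<And>n. x \<in> pZ n) \<Longrightarrow> x = 0"
  by (rule qp_eq_iff_trunc[THEN iffD2]) (simp add: pZ_iff_trunc)

lemma pZ_mult: "x \<in> pZ a \<Longrightarrow> y \<in> pZ b \<Longrightarrow> x * y \<in> pZ (a + b)" for x :: "'p::finite qp"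
proof -
  assume *: "x \<in> pZ a" "y \<in> pZ b"
  define L where "L = min a b"
  have "pcong (real CARD('p)) (a + b) (qp_trunc (x * y) (a + b))
     (qp_trunc x (a + b - L) * qp_trunc y (a + b - L))"
    using * by (intro trunc_mult[of _ L]) (auto simp: L_def pZ_iff_trunc intro: trunc_eq_0_mono)
  also have "pcong (real CARD('p)) (a + b) \<dots> 0"
    using pcong_mult[OF qp_trunc_dvd qp_trunc_dvd, of x a y b] * by (simp add: pZ_iff_trunc)
  finally show ?thesis using qp_trunc_eqI[of "a + b" "x * y" 0] by (simp add: pZ_iff_trunc)
qed

text \<open>Modulo p^(a+b+1) the product is X Y p^(a+b) with \<open>X\<close> and \<open>Y\<close>
  the leading digits, and a prime divides neither of them, hence not their product. Together with
  \<open>pZ_mult\<close> this is additivity of the valuation.\<close>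

lemma pZ_mult_not:
  fixes x y :: "'p::finite qp"
  assumes p: "prime CARD('p)" and x: "x \<in> pZ a" "x \<notin> pZ (a + 1)" and y: "y \<in> pZ b" "y \<notin> pZ (b + 1)"
  shows "x * y \<notin> pZ (a + b + 1)"
proof
  let ?P = "real CARD('p)"
  assume *: "x * y \<in> pZ (a + b + 1)"
  define L where "L = min a b"
  define m where "m = a + b + 1 - L"
  have lead: "Rep_qp z c > 0 \<and> pcong ?P (c + 1) (qp_trunc z m) (real (Rep_qp z c) * ?P powi c)"
    if "z \<in> pZ c" "z \<notin> pZ (c + 1)" "c + 1 \<le> m" for z :: "'p qp" and c
  proof -
    have "Rep_qp z c \<noteq> 0" using that(1,2) unfolding pZ_def by (auto simp: order_le_less)
    moreover have "qp_trunc z (c + 1) = real (Rep_qp z c) * ?P powi c"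
      using that(1) by (simp add: qp_trunc_Suc pZ_iff_trunc)
    ultimately show ?thesis using qp_trunc_cong_le[OF that(3), of z] by simp
  qed
  have m: "a + 1 \<le> m" "b + 1 \<le> m" by (auto simp: m_def L_def)
  define X Y where "X = Rep_qp x a" and "Y = Rep_qp y b"
  have X: "X > 0" "pcong ?P (a + 1) (qp_trunc x m) (real X * ?P powi a)" "X < CARD('p)"
    and Y: "Y > 0" "pcong ?P (b + 1) (qp_trunc y m) (real Y * ?P powi b)" "Y < CARD('p)"
    using lead[OF x m(1)] lead[OF y m(2)] Rep_less unfolding X_def Y_def by auto
  have "pcong ?P (a + b + 1) (qp_trunc x m * qp_trunc y m) (qp_trunc x m * (real Y * ?P powi b))"
    using pcong_mult[OF qp_trunc_dvd Y(2), of x a m] x by (simp add: pZ_iff_trunc add_ac)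
  also have "pcong ?P (a + b + 1) \<dots> (real X * ?P powi a * (real Y * ?P powi b))"
  proof -
    have "pcong ?P b (real Y * ?P powi b) 0" unfolding pcong_def by (rule exI[of _ "int Y"]) simp
    from pcong_mult[OF this X(2)] show ?thesis by (simp add: mult.commute add_ac)
  qed
  finally have 1: "pcong ?P (a + b + 1) (qp_trunc x m * qp_trunc y m) (real X * ?P powi a * (real Y * ?P powi b))" .
  have 2: "pcong ?P (a + b + 1) (qp_trunc (x * y) (a + b + 1)) (qp_trunc x m * qp_trunc y m)"
    using x y by (intro trunc_mult[of _ L]) (auto simp: L_def m_def pZ_iff_trunc intro: trunc_eq_0_mono)
  have "pcong ?P (a + b + 1) 0 (real X * ?P powi a * (real Y * ?P powi b))"
    using pcong_trans[OF 2 1] * by (simp only: pZ_iff_trunc)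
  then obtain z where "0 - real X * ?P powi a * (real Y * ?P powi b) = of_int z * ?P powi (a + b + 1)"
    unfolding pcong_def by blast
  hence "(- (real X * real Y)) * ?P powi (a + b) = (of_int z * ?P) * ?P powi (a + b)"
    by (simp add: power_int_add mult_ac)
  hence "- (real X * real Y) = of_int z * ?P"
    by (subst (asm) mult_cancel_right) auto
  hence "real_of_int (int (X * Y)) = of_int (- z * int CARD('p))" by simp
  hence "int (X * Y) = - z * int CARD('p)" by (simp only: of_int_eq_iff)
  hence "int CARD('p) dvd int (X * Y)" by simp
  hence "CARD('p) dvd X * Y" by (simp only: int_dvd_int_iff)
  hence "CARD('p) dvd X \<or> CARD('p) dvd Y" using p by (simp add: prime_dvd_mult_iff)
  thus False using X Y by (auto dest: dvd_imp_le)
qed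

section \<open>The standard character\<close>

lemma cis_2pi_eq_iff: "cis (2 * pi * a) = cis (2 * pi * b) \<longleftrightarrow> pcong q 0 a b"
proof
  assume "cis (2 * pi * a) = cis (2 * pi * b)"
  hence "cis (2 * pi * a - 2 * pi * b) = 1" by (simp flip: cis_divide)
  hence "cos (2 * pi * a - 2 * pi * b) = 1" by (metis cis.simps(1) one_complex.sel(1))
  then obtain m :: int where "2 * pi * a - 2 * pi * b = of_int m * 2 * pi" using cos_one_2pi_int by blast
  hence "(a - b) * (2 * pi) = of_int m * (2 * pi)" by (simp add: algebra_simps)
  hence "a - b = of_int m" by simp
  thus "pcong q 0 a b" by (auto simp: pcong_def)
next
  assume "pcong q 0 a b"
  then obtain z where "a = b + of_int z" by (auto simp: pcong_def algebra_simps)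
  hence "2 * pi * a = 2 * pi * b + 2 * pi * of_int z" by (simp add: algebra_simps)
  thus "cis (2 * pi * a) = cis (2 * pi * b)" by (simp add: cis_mult[symmetric] cis_multiple_2pi)
qed

lemma qp_chi_add: "qp_chi (x + y) = qp_chi x * qp_chi y" for x :: "'p::finite qp"
  unfolding qp_chi_def cis_mult qp_frac_def distrib_left[symmetric]
  by (rule cis_2pi_eq_iff[THEN iffD2, OF trunc_add])

lemma qp_chi_norm: "cmod (qp_chi x) = 1" by (simp add: qp_chi_def)

lemma qp_chi_nonzero [simp]: "qp_chi x \<noteq> 0"
  using qp_chi_norm[of x] by auto

lemma qp_chi_eq_1_iff: "qp_chi x = 1 \<longleftrightarrow> x \<in> pZ 0" for x :: "'p::finite qp"
proof -
  have "qp_chi x = 1 \<longleftrightarrow> pcong (real CARD('p)) 0 (qp_trunc x 0) (qp_trunc (0 :: 'p qp) 0)"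
    using cis_2pi_eq_iff[of "qp_frac x" 0] by (simp add: qp_chi_def qp_frac_def)
  also have "\<dots> \<longleftrightarrow> qp_trunc x 0 = 0" using qp_trunc_eqI[of 0 x 0] by auto
  finally show ?thesis by (simp add: pZ_iff_trunc)
qed

lemma qp_chi_zero [simp]: "qp_chi 0 = 1"
  by (simp add: qp_chi_eq_1_iff)

lemma qp_chi_minus: "qp_chi (- x) = cnj (qp_chi x)"
proof -
  have "qp_chi (- x) * qp_chi x = 1" using qp_chi_add[of "- x" x] by simp
  moreover have "cnj (qp_chi x) * qp_chi x = 1" using qp_chi_norm[of x]
    by (simp add: complex_norm_square[symmetric] mult.commute)
  ultimately show ?thesis using qp_chi_nonzero by (metis mult_right_cancel)
qed

lemma qp_chi_diff: "qp_chi (x - y) = qp_chi x * cnj (qp_chi y)"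
  using qp_chi_add[of x "- y"] by (simp add: qp_chi_minus)

lemma qp_chi_eq_iff: "qp_chi x = qp_chi y \<longleftrightarrow> x - y \<in> pZ 0"
proof -
  have "qp_chi x = qp_chi (x - y) * qp_chi y" using qp_chi_add[of "x - y" y] by simp
  thus ?thesis by (simp add: qp_chi_eq_1_iff[symmetric])
qed

section \<open>Homogeneous sets\<close>

text \<open>Balls are indexed by their level: \<open>pball a n\<close> has radius \<open>p\<^sup>-\<^sup>n\<close>, whereas \<open>qp_ball a n\<close> has radius \<open>p\<^sup>n\<close>.\<close>

definition pball :: "'p::finite qp \<Rightarrow> int \<Rightarrow> 'p qp set" where
  "pball a n = {x. x - a \<in> pZ n}"

lemma qp_ball_conv: "qp_ball a n = pball a (- n)"
  by (simp add: qp_ball_def pball_def pZ_def)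

lemma pball_self [simp]: "a \<in> pball a n" by (simp add: pball_def)

lemma pball_mono: "m \<le> n \<Longrightarrow> pball a n \<subseteq> pball a m"
  by (auto simp: pball_def intro: pZ_mono)

lemma pball_eq: "b \<in> pball a n \<Longrightarrow> pball b n = pball a n"
proof -
  assume b: "b \<in> pball a n"
  have "x - b \<in> pZ n \<longleftrightarrow> x - a \<in> pZ n" for x
    using pZ_add[of "x - b" n "b - a"] pZ_diff[of "x - a" n "b - a"] b by (auto simp: pball_def)
  thus ?thesis by (simp add: pball_def)
qed

lemma pball_digits: "x \<in> pball a n \<longleftrightarrow> (\<forall>k<n. Rep_qp x k = Rep_qp a k)"
  by (simp add: pball_def pZ_diff_iff)

text \<open>The number d p^i. As \<open>d\<close> runs through the digits, adding it to the centre
  of a ball of level \<open>i\<close> gives centres of all its children.\<close>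

definition qp_digit :: "int \<Rightarrow> nat \<Rightarrow> 'p::finite qp" where
  "qp_digit i d = Abs_qp (\<lambda>k. if k = i then d else 0)"

lemma Rep_qp_digit: "d < CARD('p) \<Longrightarrow> Rep_qp (qp_digit i d :: 'p::finite qp) k = (if k = i then d else 0)"
proof -
  assume d: "d < CARD('p)"
  have "\<forall>k<i. (if k = i then d else 0) = 0" by simp
  hence "\<exists>N. \<forall>k<N. (if k = i then d else 0) = 0" by (rule exI)
  thus ?thesis unfolding qp_digit_def using d by (subst Abs_qp_inverse) simp_all
qed

lemma qp_digit_pZ: "d < CARD('p) \<Longrightarrow> (qp_digit i d :: 'p::finite qp) \<in> pZ i"
  by (simp add: pZ_def Rep_qp_digit)

lemma qp_digit_not_pZ: "d < CARD('p) \<Longrightarrow> d \<noteq> 0 \<Longrightarrow> (qp_digit i d :: 'p::finite qp) \<notin> pZ (i + 1)"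
  unfolding pZ_def by (simp add: Rep_qp_digit)

lemma qp_digit_approx:
  assumes "z \<in> pZ i"
  shows "z - qp_digit i (Rep_qp z i) \<in> pZ (i + 1)"
  using assms Rep_less[of z i] unfolding pZ_diff_iff by (auto simp: pZ_def Rep_qp_digit)

lemma qp_digit_inj:
  "d < CARD('p) \<Longrightarrow> d' < CARD('p) \<Longrightarrow> (qp_digit i d :: 'p::finite qp) - qp_digit i d' \<in> pZ (i + 1) \<Longrightarrow> d = d'"
  unfolding pZ_diff_iff by (drule spec[of _ i]) (simp add: Rep_qp_digit)

lemma ex_valuation:
  assumes "z \<noteq> 0"
  shows "\<exists>k. z \<in> pZ k \<and> z \<notin> pZ (k + 1)"
proof (rule ccontr)
  assume *: "\<not> ?thesis"
  have "z \<in> pZ n" for n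
  proof (induction n rule: upward_int_induct)
    case low
    obtain n where "z \<in> pZ n" using pZ_exists by blast
    thus ?case using pZ_mono by blast
  next
    case (step n)
    thus ?case using * by blast
  qed
  thus False using pZ_all_imp_zero assms by blast
qed

lemma qp_val_eqI: "z \<in> pZ k \<Longrightarrow> z \<notin> pZ (k + 1) \<Longrightarrow> qp_val z = k"
proof -
  assume z: "z \<in> pZ k" "z \<notin> pZ (k + 1)"
  have "Rep_qp z k \<noteq> 0" using z unfolding pZ_def by (auto simp: order_le_less)
  moreover have "\<forall>j<k. Rep_qp z j = 0" using z(1) by (simp add: pZ_def)
  ultimately show ?thesis unfolding qp_val_def by (intro the_equality) (blast, meson linorder_cases)
qed

lemma adm_orders_iff: "i \<in> adm_orders E \<longleftrightarrow> (\<exists>x\<in>E. \<exists>y\<in>E. x - y \<in> pZ i \<and> x - y \<notin> pZ (i + 1))"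
proof
  assume "i \<in> adm_orders E"
  then obtain x y where xy: "x \<in> E" "y \<in> E" "x \<noteq> y" "i = qp_val (x - y)" by (auto simp: adm_orders_def)
  obtain k where k: "x - y \<in> pZ k" "x - y \<notin> pZ (k + 1)" using ex_valuation[of "x - y"] xy by auto
  thus "\<exists>x\<in>E. \<exists>y\<in>E. x - y \<in> pZ i \<and> x - y \<notin> pZ (i + 1)" using xy qp_val_eqI by metis
next
  assume "\<exists>x\<in>E. \<exists>y\<in>E. x - y \<in> pZ i \<and> x - y \<notin> pZ (i + 1)"
  then obtain x y where xy: "x \<in> E" "y \<in> E" "x - y \<in> pZ i" "x - y \<notin> pZ (i + 1)" by blast
  hence "x \<noteq> y" "qp_val (x - y) = i" using qp_val_eqI by auto
  thus "i \<in> adm_orders E" using xy by (auto simp: adm_orders_def)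
qed

lemma not_adm_order: "i \<notin> adm_orders E \<Longrightarrow> x \<in> E \<Longrightarrow> y \<in> E \<Longrightarrow> x - y \<in> pZ i \<Longrightarrow> x - y \<in> pZ (i + 1)"
  by (auto simp: adm_orders_iff)

text \<open>The children of the ball of level \<open>i\<close> around \<open>e\<close> are the balls
  of level \<open>i + 1\<close> around \<open>e + z\<close>. Letting \<open>z\<close> run over all
  of p^i Z_p rather than over digits allows any error of size p^-i to be used as \<open>z\<close>
  directly.\<close>

definition full_level :: "'p::finite qp set \<Rightarrow> int \<Rightarrow> bool" where
  "full_level E i \<longleftrightarrow> (\<forall>e\<in>E. \<forall>z\<in>pZ i. \<exists>e'\<in>E. e' - (e + z) \<in> pZ (i + 1))"

definition homog :: "'p::finite qp set \<Rightarrow> bool" where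
  "homog E \<longleftrightarrow> bdd_above (adm_orders E) \<and> (\<forall>i\<in>adm_orders E. full_level E i)"

text \<open>A full ball has at least two children meeting the set, and points of two different
  children differ by valuation exactly \<open>i\<close>.\<close>

lemma full_imp_adm:
  fixes E :: "'p::finite qp set"
  assumes "full_level E i" "E \<noteq> {}" "CARD('p) \<ge> 2"
  shows "i \<in> adm_orders E"
proof -
  obtain e where e: "e \<in> E" using assms by blast
  have d: "1 < CARD('p)" using assms by simp
  obtain e' where e': "e' \<in> E" "e' - (e + qp_digit i 1) \<in> pZ (i + 1)"
    using assms(1) e qp_digit_pZ[OF d] unfolding full_level_def by blast
  have "e' - e \<in> pZ i"
    using pZ_add[OF pZ_mono[OF e'(2)] qp_digit_pZ[OF d], of i] by (simp add: algebra_simps)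
  moreover have "e' - e \<notin> pZ (i + 1)"
    using pZ_diff[OF _ e'(2), of "e' - e"] qp_digit_not_pZ[OF d, of i] by auto
  ultimately show ?thesis using e e' by (auto simp: adm_orders_iff)
qed

section \<open>Children of balls and counting of points\<close>

lemma pball_split:
  "E \<inter> pball a n = (\<Union>d<CARD('p). E \<inter> pball (a + qp_digit n d) (n + 1))" for a :: "'p::finite qp"
proof (intro equalityI subsetI)
  fix x assume x: "x \<in> E \<inter> pball a n"
  hence "x - a - qp_digit n (Rep_qp (x - a) n) \<in> pZ (n + 1)" by (intro qp_digit_approx) (auto simp: pball_def)
  hence "x \<in> pball (a + qp_digit n (Rep_qp (x - a) n)) (n + 1)" by (simp add: pball_def algebra_simps)
  thus "x \<in> (\<Union>d<CARD('p). E \<inter> pball (a + qp_digit n d) (n + 1))" using x Rep_less[of "x - a" n] by blast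
next
  fix x assume "x \<in> (\<Union>d<CARD('p). E \<inter> pball (a + qp_digit n d) (n + 1))"
  then obtain d where d: "d < CARD('p)" "x \<in> E" "x - (a + qp_digit n d) \<in> pZ (n + 1)"
    by (auto simp: pball_def)
  show "x \<in> E \<inter> pball a n"
    using d pZ_add[OF pZ_mono[OF d(3)] qp_digit_pZ[OF d(1)], of n] by (simp add: pball_def algebra_simps)
qed

lemma pball_split_disjoint:
  assumes "d < CARD('p)" "d' < CARD('p)" "d \<noteq> d'"
  shows "pball (a + qp_digit n d) (n + 1) \<inter> pball (a + qp_digit n d' :: 'p::finite qp) (n + 1) = {}"
proof (rule ccontr)
  assume "\<not> ?thesis"
  then obtain x where "x - (a + qp_digit n d) \<in> pZ (n + 1)" "x - (a + qp_digit n d') \<in> pZ (n + 1)"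
    by (auto simp: pball_def)
  from pZ_diff[OF this(2,1)] have "(qp_digit n d :: 'p qp) - qp_digit n d' \<in> pZ (n + 1)" by (simp add: algebra_simps)
  thus False using qp_digit_inj assms by blast
qed

lemma card_pball_split:
  fixes a :: "'p::finite qp"
  assumes "finite (E \<inter> pball a n)"
  shows "card (E \<inter> pball a n) = (\<Sum>d<CARD('p). card (E \<inter> pball (a + qp_digit n d) (n + 1)))"
proof -
  have "finite (E \<inter> pball (a + qp_digit n d) (n + 1))" if "d < CARD('p)" for d
    using assms that pball_split[of E a n] by (auto intro: finite_subset)
  moreover have "\<forall>d\<in>{..<CARD('p)}. \<forall>d'\<in>{..<CARD('p)}. d \<noteq> d' \<longrightarrow>
      (E \<inter> pball (a + qp_digit n d) (n + 1)) \<inter> (E \<inter> pball (a + qp_digit n d') (n + 1)) = {}"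
    using pball_split_disjoint[of _ _ a n] by blast
  ultimately show ?thesis unfolding pball_split[of E a n] by (subst card_UN_disjoint) auto
qed

text \<open>Going down from a level \<open>L\<close> above all orders, where a ball holds a single
  point, an order multiplies the count by p, since all children are occupied, and a level that is no
  order leaves it unchanged, since only one child is.\<close>

lemma homog_count_below:
  fixes E :: "'p::finite qp set"
  assumes bdd: "\<And>i. i \<in> adm_orders E \<Longrightarrow> i < L" and full: "\<And>i. i \<in> adm_orders E \<Longrightarrow> full_level E i"
    and "n \<le> L" "e \<in> E"
  shows "finite (E \<inter> pball e n) \<and> card (E \<inter> pball e n) = CARD('p) ^ card {i \<in> adm_orders E. n \<le> i}"
  using \<open>n \<le> L\<close> \<open>e \<in> E\<close>
proof (induction n arbitrary: e rule: int_le_induct)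
  case base
  have "E \<inter> pball e L = {e}"
  proof (intro equalityI subsetI)
    fix x assume x: "x \<in> E \<inter> pball e L"
    have "x = e"
    proof (rule ccontr)
      assume "x \<noteq> e"
      then obtain k where k: "x - e \<in> pZ k" "x - e \<notin> pZ (k + 1)" using ex_valuation[of "x - e"] by auto
      hence "k < L" using bdd[of k] x base by (auto simp: adm_orders_iff)
      moreover have "x - e \<in> pZ L" using x by (simp add: pball_def)
      ultimately show False using k pZ_mono[of "x - e" L "k + 1"] by simp
    qed
    thus "x \<in> {e}" by simp
  qed (use base in simp)
  moreover have "{i \<in> adm_orders E. L \<le> i} = {}" using bdd by fastforce
  hence "card {i \<in> adm_orders E. L \<le> i} = 0" by (simp only: card.empty)
  ultimately show ?case by simp
next
  case (step m)
  define n where "n = m - 1"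
  have m: "m = n + 1" by (simp add: n_def)
  have fin: "finite {i \<in> adm_orders E. m \<le> i}"
    by (rule finite_subset[of _ "{m..<L}"]) (use bdd in auto)
  have IH: "finite (E \<inter> pball e (n + 1)) \<and> card (E \<inter> pball e (n + 1)) = CARD('p) ^ card {i \<in> adm_orders E. m \<le> i}"
    if "e \<in> E" for e using step.IH[OF that] m by simp
  show ?case unfolding n_def[symmetric]
  proof (cases "n \<in> adm_orders E")
    case True
    have child: "finite (E \<inter> pball (e + qp_digit n d) (n + 1)) \<and>
        card (E \<inter> pball (e + qp_digit n d) (n + 1)) = CARD('p) ^ card {i \<in> adm_orders E. m \<le> i}"
      if d: "d < CARD('p)" for d
    proof -
      obtain e' where e': "e' \<in> E" "e' - (e + qp_digit n d) \<in> pZ (n + 1)"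
        using full[OF True] step.prems qp_digit_pZ[OF d] unfolding full_level_def by blast
      hence "pball e' (n + 1) = pball (e + qp_digit n d) (n + 1)" by (intro pball_eq) (simp add: pball_def)
      thus ?thesis using IH[OF e'(1)] by simp
    qed
    have f: "finite (E \<inter> pball e n)" unfolding pball_split[of E e n] using child by blast
    have "{i \<in> adm_orders E. n \<le> i} = insert n {i \<in> adm_orders E. m \<le> i}" using True m by auto
    hence "card {i \<in> adm_orders E. n \<le> i} = Suc (card {i \<in> adm_orders E. m \<le> i})"
      using fin m by simp
    moreover have "card (E \<inter> pball e n) = (\<Sum>d<CARD('p). CARD('p) ^ card {i \<in> adm_orders E. m \<le> i})"
      unfolding card_pball_split[OF f] using child by (intro sum.cong) auto
    ultimately show "finite (E \<inter> pball e n) \<and> card (E \<inter> pball e n) = CARD('p) ^ card {i \<in> adm_orders E. n \<le> i}"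
      using f by simp
  next
    case False
    have "E \<inter> pball e n = E \<inter> pball e (n + 1)"
      using not_adm_order[OF False _ step.prems] pball_mono[of n "n + 1" e] by (auto simp: pball_def)
    moreover have "{i \<in> adm_orders E. n \<le> i} = {i \<in> adm_orders E. m \<le> i}"
      using False m by (auto simp: order_le_less)
    ultimately show "finite (E \<inter> pball e n) \<and> card (E \<inter> pball e n) = CARD('p) ^ card {i \<in> adm_orders E. n \<le> i}"
      using IH[OF step.prems] by simp
  qed
qed

lemma homog_count:
  fixes E :: "'p::finite qp set"
  assumes "homog E" "e \<in> E"
  shows "finite (E \<inter> pball e n)" "card (E \<inter> pball e n) = CARD('p) ^ card {i \<in> adm_orders E. n \<le> i}"
proof -
  obtain L where L: "\<And>i. i \<in> adm_orders E \<Longrightarrow> i \<le> L" using assms unfolding homog_def bdd_above_def by blast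
  have "i < max n (L + 1)" if "i \<in> adm_orders E" for i using L[OF that] by simp
  thus "finite (E \<inter> pball e n)" "card (E \<inter> pball e n) = CARD('p) ^ card {i \<in> adm_orders E. n \<le> i}"
    using homog_count_below[of E "max n (L + 1)" n e] assms by (auto simp: homog_def)
qed

text \<open>One direction is the count above. For the other, at an order \<open>i\<close> a ball
  meeting \<open>E\<close> holds p * p^c points, while each of its p children holds at most p^c;
  hence no child can be empty.\<close>

lemma p_hom_discrete_iff_homog:
  fixes E :: "'p::finite qp set"
  assumes p: "CARD('p) \<ge> 2"
  shows "p_hom_discrete E \<longleftrightarrow> homog E"
proof
  assume h: "homog E"
  show "p_hom_discrete E" unfolding p_hom_discrete_def
  proof (intro conjI allI)
    show "bdd_above (adm_orders E)" using h by (simp add: homog_def)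
    fix n a
    have "finite (E \<inter> pball a n) \<and> card (E \<inter> pball a n) \<in> {0, CARD('p) ^ card {i \<in> adm_orders E. n \<le> i}}"
    proof (cases "E \<inter> pball a n = {}")
      case False
      then obtain e where e: "e \<in> E" "e \<in> pball a n" by blast
      thus ?thesis using homog_count[OF h e(1), of n] pball_eq[OF e(2)] by simp
    qed simp
    thus "finite (E \<inter> qp_ball a (- n))"
      "card (E \<inter> qp_ball a (- n)) \<in> {0, CARD('p) ^ card {i \<in> adm_orders E. n \<le> i}}"
      unfolding qp_ball_conv minus_minus by blast+
  qed
next
  assume h: "p_hom_discrete E"
  hence fin: "finite (E \<inter> pball a n)" and
    card: "card (E \<inter> pball a n) \<in> {0, CARD('p) ^ card {i \<in> adm_orders E. n \<le> i}}" for a n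
    unfolding p_hom_discrete_def qp_ball_conv minus_minus by blast+
  have bdd: "bdd_above (adm_orders E)" using h by (simp add: p_hom_discrete_def)
  have "full_level E i" if i: "i \<in> adm_orders E" for i
    unfolding full_level_def
  proof (intro ballI)
    fix e z assume e: "e \<in> E" and z: "z \<in> (pZ i :: 'p qp set)"
    obtain L where L: "\<And>i. i \<in> adm_orders E \<Longrightarrow> i \<le> L" using bdd unfolding bdd_above_def by blast
    define c where "c = card {j \<in> adm_orders E. i + 1 \<le> j}"
    have f: "finite {j \<in> adm_orders E. i + 1 \<le> j}"
      by (rule finite_subset[of _ "{i + 1..L}"]) (use L in auto)
    have "{j \<in> adm_orders E. i \<le> j} = insert i {j \<in> adm_orders E. i + 1 \<le> j}" using i by auto
    hence "card {j \<in> adm_orders E. i \<le> j} = Suc c" using f by (simp add: c_def)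
    moreover have "card (E \<inter> pball e i) \<noteq> 0" using fin e by auto
    ultimately have total: "card (E \<inter> pball e i) = CARD('p) * CARD('p) ^ c" using card[of e i] by auto
    have le: "card (E \<inter> pball (e + qp_digit i d) (i + 1)) \<le> CARD('p) ^ c" for d
      using card[of "e + qp_digit i d" "i + 1"] by (auto simp: c_def)
    define d0 where "d0 = Rep_qp z i"
    have d0: "d0 < CARD('p)" by (simp add: d0_def Rep_less)
    have "E \<inter> pball (e + qp_digit i d0) (i + 1) \<noteq> {}"
    proof
      assume "E \<inter> pball (e + qp_digit i d0) (i + 1) = {}"
      hence "card (E \<inter> pball (e + qp_digit i d0) (i + 1)) < CARD('p) ^ c" by simp
      hence "\<exists>d\<in>{..<CARD('p)}. card (E \<inter> pball (e + qp_digit i d) (i + 1)) < CARD('p) ^ c" using d0 by blast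
      moreover have "\<forall>d\<in>{..<CARD('p)}. card (E \<inter> pball (e + qp_digit i d) (i + 1)) \<le> CARD('p) ^ c" using le by blast
      ultimately have "card (E \<inter> pball e i) < (\<Sum>d<CARD('p). CARD('p) ^ c)"
        unfolding card_pball_split[OF fin[of e i]] by (intro sum_strict_mono_ex1) blast+
      thus False using total by simp
    qed
    then obtain e' where e': "e' \<in> E" "e' - (e + qp_digit i d0) \<in> pZ (i + 1)" by (auto simp: pball_def)
    have "e' - (e + z) \<in> pZ (i + 1)"
      using pZ_diff[OF e'(2) qp_digit_approx[OF z]] by (simp add: d0_def algebra_simps)
    thus "\<exists>e'\<in>E. e' - (e + z) \<in> pZ (i + 1)" using e' by blast
  qed
  thus "homog E" using bdd by (simp add: homog_def)
qed

lemma children_of_ball: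
  fixes a :: "'p::finite qp"
  shows "{B'. (\<exists>b. B' = pball b (n + 1)) \<and> B' \<subseteq> pball a n} = (\<lambda>d. pball (a + qp_digit n d) (n + 1)) ` {..<CARD('p)}"
proof (intro equalityI subsetI)
  fix B assume "B \<in> {B'. (\<exists>b. B' = pball b (n + 1)) \<and> B' \<subseteq> pball a n}"
  then obtain b where b: "B = pball b (n + 1)" "B \<subseteq> pball a n" by blast
  hence "b \<in> UNIV \<inter> pball a n" by auto
  then obtain d where "d < CARD('p)" "b \<in> pball (a + qp_digit n d) (n + 1)" unfolding pball_split[of UNIV a n] by auto
  thus "B \<in> (\<lambda>d. pball (a + qp_digit n d) (n + 1)) ` {..<CARD('p)}" using b pball_eq by blast
next
  fix B assume "B \<in> (\<lambda>d. pball (a + qp_digit n d) (n + 1)) ` {..<CARD('p)}"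
  thus "B \<in> {B'. (\<exists>b. B' = pball b (n + 1)) \<and> B' \<subseteq> pball a n}" using pball_split[of UNIV a n] by auto
qed

text \<open>Two points of \<Omega> whose difference has valuation \<open>i\<close> lie in one ball
  but in different children. This excludes the alternative of a single child at level
  \<open>i\<close>, and the other alternative speaks about all balls of that level.\<close>

lemma p_hom_compact_open_full:
  fixes \<Omega> :: "'p::finite qp set"
  assumes h: "p_hom_compact_open \<Omega>" and i: "i \<in> adm_orders \<Omega>"
  shows "full_level \<Omega> i"
proof -
  define C where "C = (\<lambda>B. {B' \<in> nbhd_balls \<Omega> (i + 1). B' \<subseteq> B})"
  have nb: "B \<in> nbhd_balls \<Omega> n \<longleftrightarrow> (\<exists>a. B = pball a n \<and> pball a n \<inter> \<Omega> \<noteq> {})" for B n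
    by (auto simp: nbhd_balls_def qp_ball_conv)
  have Csub: "C (pball a i) \<subseteq> (\<lambda>d. pball (a + qp_digit i d) (i + 1)) ` {..<CARD('p)}" for a
    using children_of_ball[of i a] by (auto simp: C_def nb)
  obtain x y where xy: "x \<in> \<Omega>" "y \<in> \<Omega>" "x - y \<in> pZ i" "x - y \<notin> pZ (i + 1)"
    using i by (auto simp: adm_orders_iff)
  have B: "pball y i \<in> nbhd_balls \<Omega> i" using xy(2) pball_self[of y i] unfolding nb by blast
  have "pball x i = pball y i" using xy(3) by (intro pball_eq) (simp add: pball_def)
  hence "pball x (i + 1) \<subseteq> pball y i" "pball y (i + 1) \<subseteq> pball y i"
    using pball_mono[of i "i + 1" x] pball_mono[of i "i + 1" y] by auto
  moreover have "pball w (i + 1) \<in> nbhd_balls \<Omega> (i + 1)" if "w \<in> \<Omega>" for w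
    unfolding nb using that pball_self[of w "i + 1"] by blast
  ultimately have "pball x (i + 1) \<in> C (pball y i)" "pball y (i + 1) \<in> C (pball y i)"
    using xy(1,2) by (simp_all add: C_def)
  moreover have "pball x (i + 1) \<noteq> pball y (i + 1)" using xy(4) pball_self[of x "i + 1"] by (auto simp: pball_def)
  ultimately have "card (C (pball y i)) \<noteq> 1" by (metis card_1_singletonE singletonD)
  hence all: "card (C B) = CARD('p)" if "B \<in> nbhd_balls \<Omega> i" for B
    using h B that unfolding p_hom_compact_open_def C_def by blast
  show ?thesis unfolding full_level_def
  proof (intro ballI)
    fix e z assume e: "e \<in> \<Omega>" and z: "z \<in> (pZ i :: 'p qp set)"
    define A where "A = (\<lambda>d. pball (e + qp_digit i d) (i + 1)) ` {..<CARD('p)}"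
    have "card A \<le> CARD('p)" unfolding A_def using card_image_le[of "{..<CARD('p)}"] by simp
    moreover have "card (C (pball e i)) = CARD('p)" using e pball_self[of e i] by (intro all) (unfold nb, blast)
    moreover have "finite A" by (simp add: A_def)
    ultimately have "C (pball e i) = A" using Csub[of e] card_seteq[of A "C (pball e i)"] unfolding A_def by simp
    moreover have "pball (e + qp_digit i (Rep_qp z i)) (i + 1) \<in> A" using Rep_less[of z i] by (auto simp: A_def)
    ultimately have "pball (e + qp_digit i (Rep_qp z i)) (i + 1) \<in> nbhd_balls \<Omega> (i + 1)" by (auto simp: C_def)
    then obtain e' where e': "e' \<in> \<Omega>" "e' \<in> pball (e + qp_digit i (Rep_qp z i)) (i + 1)" unfolding nb by auto
    have "e' - (e + z) \<in> pZ (i + 1)"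
      using pZ_diff[OF _ qp_digit_approx[OF z], of "e' - (e + qp_digit i (Rep_qp z i))"] e'(2)
      by (simp add: pball_def algebra_simps)
    thus "\<exists>e'\<in>\<Omega>. e' - (e + z) \<in> pZ (i + 1)" using e' by blast
  qed
qed

section \<open>Representatives modulo p^L Z_p and restriction to balls\<close>

definition qp_cut :: "'p::finite qp \<Rightarrow> int \<Rightarrow> 'p qp" where
  "qp_cut x L = Abs_qp (\<lambda>k. if k < L then Rep_qp x k else 0)"

text \<open>A system of representatives of Q_p modulo p^L Z_p, finite in every ball;
  \<open>qp_cut x L\<close> is the representative of \<open>x\<close>.\<close>

definition qp_short :: "int \<Rightarrow> 'p::finite qp set" where
  "qp_short L = {x. \<forall>k\<ge>L. Rep_qp x k = 0}"

lemma Rep_qp_cut: "Rep_qp (qp_cut x L) k = (if k < L then Rep_qp x k else 0)"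
proof -
  obtain N where "\<forall>k<N. Rep_qp x k = 0" using Rep_low by blast
  hence "\<forall>k<N. (if k < L then Rep_qp x k else 0) = 0" by simp
  hence "\<exists>N. \<forall>k<N. (if k < L then Rep_qp x k else 0) = 0" by (rule exI)
  thus ?thesis unfolding qp_cut_def by (subst Abs_qp_inverse) (simp_all add: Rep_less)
qed

lemma qp_cut_qp_short [simp]: "qp_cut x L \<in> qp_short L"
  by (simp add: qp_short_def Rep_qp_cut)

lemma qp_cut_diff: "x - qp_cut x L \<in> pZ L"
  by (simp add: pZ_diff_iff Rep_qp_cut)

lemma qp_short_unique: "x \<in> qp_short L \<Longrightarrow> y \<in> qp_short L \<Longrightarrow> x - y \<in> pZ L \<Longrightarrow> x = y"
proof -
  assume *: "x \<in> qp_short L" "y \<in> qp_short L" "x - y \<in> pZ L"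
  have "Rep_qp x k = Rep_qp y k" for k
    using * by (cases "k < L") (auto simp: qp_short_def pZ_diff_iff)
  thus "x = y" by (simp add: Rep_qp_inject[symmetric] ext)
qed

lemma finite_qp_short_pball: "finite (qp_short L \<inter> pball (a :: 'p::finite qp) M)"
proof -
  obtain n where n: "a \<in> pZ n" using pZ_exists by blast
  define K where "K = min n M"
  have "inj_on (\<lambda>x. restrict (Rep_qp x) {K..<L}) (qp_short L \<inter> pZ K :: 'p qp set)"
  proof (rule inj_onI)
    fix x y :: "'p qp"
    assume x: "x \<in> qp_short L \<inter> pZ K" and y: "y \<in> qp_short L \<inter> pZ K"
      and eq: "restrict (Rep_qp x) {K..<L} = restrict (Rep_qp y) {K..<L}"
    have "Rep_qp x k = Rep_qp y k" for k
      using x y fun_cong[OF eq, of k] by (cases "k < K"; cases "k < L") (auto simp: qp_short_def pZ_def restrict_def)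
    thus "x = y" by (simp add: Rep_qp_inject[symmetric] ext)
  qed
  moreover have "(\<lambda>x. restrict (Rep_qp x) {K..<L}) ` (qp_short L \<inter> pZ K :: 'p qp set) \<subseteq> {K..<L} \<rightarrow>\<^sub>E {..<CARD('p)}"
    using Rep_less by auto
  ultimately have "finite (qp_short L \<inter> pZ K :: 'p qp set)"
    by (meson finite_PiE finite_atLeastLessThan_int finite_imageD finite_lessThan finite_subset)
  moreover have "pball a M \<subseteq> pZ K"
  proof
    fix x assume "x \<in> pball a M"
    hence "x - a \<in> pZ K" "a \<in> pZ K" using n by (auto simp: pball_def K_def intro: pZ_mono)
    from pZ_add[OF this] show "x \<in> pZ K" by simp
  qed
  ultimately show ?thesis by (metis Int_mono finite_subset order_refl)
qed

lemma countable_qp_short: "countable (qp_short L :: 'p::finite qp set)"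
proof -
  have "qp_short L \<subseteq> (\<Union>M::int. qp_short L \<inter> pball (0 :: 'p qp) M)" using pZ_exists by (auto simp: pball_def)
  moreover have "countable (\<Union>M::int. qp_short L \<inter> pball (0 :: 'p qp) M)"
    by (rule countable_UN[OF countableI_type countable_finite[OF finite_qp_short_pball]])
  ultimately show ?thesis using countable_subset by blast
qed

definition periodic :: "int \<Rightarrow> 'p::finite qp set \<Rightarrow> bool" where
  "periodic L S \<longleftrightarrow> (\<forall>x\<in>S. pball x L \<subseteq> S)"

lemma periodicD: "periodic L S \<Longrightarrow> x \<in> S \<Longrightarrow> y - x \<in> pZ L \<Longrightarrow> y \<in> S"
  by (auto simp: periodic_def pball_def)

lemma periodic_mono: "periodic L S \<Longrightarrow> L \<le> M \<Longrightarrow> periodic M S"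
  unfolding periodic_def using pball_mono by blast

lemma qp_cut_mem: "periodic L S \<Longrightarrow> x \<in> S \<Longrightarrow> qp_cut x L \<in> S \<inter> qp_short L"
  using periodicD[of L S x "qp_cut x L"] qp_cut_diff[of x L, unfolded pZ_diff_commute[of x]] by simp

lemma periodic_pball: "n \<le> L \<Longrightarrow> periodic L (pball a n)"
  unfolding periodic_def
proof
  fix x assume "n \<le> L" "x \<in> pball a n"
  thus "pball x L \<subseteq> pball a n" using pball_eq[of x a n] pball_mono[of n L x] by simp
qed

lemma full_reps:
  assumes "periodic L S" "full_level S i" "i < L"
  shows "full_level (S \<inter> qp_short L) i"
  unfolding full_level_def
proof (intro ballI)
  fix e z :: "'a qp"
  assume e: "e \<in> S \<inter> qp_short L" and z: "z \<in> pZ i"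
  then obtain w where w: "w \<in> S" "w - (e + z) \<in> pZ (i + 1)" using assms(2) unfolding full_level_def by blast
  have "w - qp_cut w L \<in> pZ (i + 1)" by (rule pZ_mono[OF qp_cut_diff]) (use assms(3) in simp)
  from pZ_diff[OF w(2) this] have "qp_cut w L - (e + z) \<in> pZ (i + 1)" by (simp add: algebra_simps)
  thus "\<exists>e'\<in>S \<inter> qp_short L. e' - (e + z) \<in> pZ (i + 1)" using qp_cut_mem[OF assms(1) w(1)] by blast
qed

lemma adm_orders_mono: "A \<subseteq> B \<Longrightarrow> adm_orders A \<subseteq> adm_orders B"
  by (auto simp: adm_orders_def)

lemma adm_orders_reps: "i \<in> adm_orders (S \<inter> qp_short L) \<Longrightarrow> i \<in> adm_orders S \<and> i < L"
  for S :: "'p::finite qp set"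
proof
  assume i: "i \<in> adm_orders (S \<inter> qp_short L)"
  thus "i \<in> adm_orders S" using adm_orders_mono[of "S \<inter> qp_short L" S] by blast
  obtain x y :: "'p qp" where xy: "x \<in> qp_short L" "y \<in> qp_short L" "x - y \<in> pZ i" "x - y \<notin> pZ (i + 1)"
    using i by (auto simp: adm_orders_iff)
  show "i < L"
  proof (rule ccontr)
    assume "\<not> i < L"
    hence "x - y \<in> pZ L" using xy(3) pZ_mono by force
    hence "x = y" using qp_short_unique xy by blast
    thus False using xy by simp
  qed
qed

text \<open>A nonempty open set has arbitrarily large orders when p is at least 2, so it is not
  itself \<open>homog\<close>. Its representatives forget the levels from \<open>L\<close> on and
  keep those below full, which makes the lemmas on discrete sets applicable.\<close>

lemma homog_reps:
  assumes "periodic L S" "\<And>i. i \<in> adm_orders S \<Longrightarrow> full_level S i"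
  shows "homog (S \<inter> qp_short L)"
proof -
  have "bdd_above (adm_orders (S \<inter> qp_short L))"
    unfolding bdd_above_def by (intro exI[of _ L] ballI less_imp_le) (simp add: adm_orders_reps)
  thus ?thesis unfolding homog_def using adm_orders_reps full_reps[OF assms(1)] assms(2) by blast
qed

text \<open>A shift by an element of p^i Z_p does not leave a ball of level at most
  \<open>i\<close>.\<close>

lemma full_Int_pball:
  assumes "full_level E i" "n \<le> i"
  shows "full_level (E \<inter> pball a n) i"
  unfolding full_level_def
proof (intro ballI)
  fix e z :: "'a qp"
  assume e: "e \<in> E \<inter> pball a n" and z: "z \<in> pZ i"
  then obtain e' where e': "e' \<in> E" "e' - (e + z) \<in> pZ (i + 1)" using assms unfolding full_level_def by blast
  have "e' - (e + z) \<in> pZ n" "e - a \<in> pZ n" "z \<in> pZ n"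
    using e' e z assms pZ_mono by (force simp: pball_def)+
  hence "(e' - (e + z)) + ((e - a) + z) \<in> pZ n" by (intro pZ_add)
  hence "e' \<in> pball a n" by (simp add: pball_def algebra_simps)
  thus "\<exists>e'\<in>E \<inter> pball a n. e' - (e + z) \<in> pZ (i + 1)" using e' by blast
qed

lemma adm_orders_pball: "i \<in> adm_orders (E \<inter> pball a n) \<Longrightarrow> i \<in> adm_orders E \<and> n \<le> i"
  for E :: "'p::finite qp set"
proof
  assume i: "i \<in> adm_orders (E \<inter> pball a n)"
  thus "i \<in> adm_orders E" using adm_orders_mono[of "E \<inter> pball a n" E] by blast
  obtain x y where xy: "x - a \<in> pZ n" "y - a \<in> pZ n" "x - y \<notin> pZ (i + 1)"
    using i by (auto simp: adm_orders_iff pball_def)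
  have "x - y \<in> pZ n" using pZ_diff[OF xy(1,2)] by simp
  thus "n \<le> i" using xy(3) pZ_mono[of "x - y" n "i + 1"] by force
qed

lemma homog_Int_pball: "homog E \<Longrightarrow> homog (E \<inter> pball a n)"
  unfolding homog_def
proof (elim conjE, intro conjI ballI)
  assume "bdd_above (adm_orders E)"
  thus "bdd_above (adm_orders (E \<inter> pball a n))"
    by (rule bdd_above_mono) (intro adm_orders_mono Int_lower1)
next
  fix i assume "\<forall>i\<in>adm_orders E. full_level E i" "i \<in> adm_orders (E \<inter> pball a n)"
  thus "full_level (E \<inter> pball a n) i" using adm_orders_pball[of i E a n] by (simp add: full_Int_pball)
qed

section \<open>Zeros of character sums\<close>

lemma mult_pZ_0_iff:
  fixes x y :: "'p::finite qp"
  assumes p: "prime CARD('p)" and y: "y \<in> pZ (- i - 1)" "y \<notin> pZ (- i)"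
  shows "x * y \<in> pZ 0 \<longleftrightarrow> x \<in> pZ (i + 1)"
proof
  assume "x \<in> pZ (i + 1)"
  thus "x * y \<in> pZ 0" using pZ_mult[OF _ y(1), of x "i + 1"] by simp
next
  assume xy: "x * y \<in> pZ 0"
  show "x \<in> pZ (i + 1)"
  proof (rule ccontr)
    assume x: "x \<notin> pZ (i + 1)"
    hence "x \<noteq> 0" by auto
    then obtain k where k: "x \<in> pZ k" "x \<notin> pZ (k + 1)" using ex_valuation by blast
    have "x * y \<notin> pZ (k + (- i - 1) + 1)" using p k y by (intro pZ_mult_not) auto
    moreover have "k \<le> i" using x pZ_mono[OF k(1), of "i + 1"] by force
    ultimately show False using pZ_mono[OF xy, of "k + (- i - 1) + 1"] by simp
  qed
qed

lemma chi_mult_eq_iff: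
  fixes x x' y :: "'p::finite qp"
  assumes "prime CARD('p)" "y \<in> pZ (- i - 1)" "y \<notin> pZ (- i)"
  shows "qp_chi (x * y) = qp_chi (x' * y) \<longleftrightarrow> x - x' \<in> pZ (i + 1)"
  unfolding qp_chi_eq_iff qp_diff_distrib_right[symmetric] by (rule mult_pZ_0_iff[OF assms])

text \<open>The values \<chi>(ey) depend on \<open>e\<close> modulo p^(i+1) only, and by homogeneity
  each value is taken equally often. Fullness at level \<open>i\<close> makes the set of values
  invariant under multiplication by \<open>w\<close>, which is not 1, so the sum of the values
  equals \<open>w\<close> times itself.\<close>

lemma chi_sum_zero:
  fixes E :: "'p::finite qp set"
  assumes p: "prime CARD('p)" and fin: "finite E" and h: "homog E" and i: "i \<in> adm_orders E"
    and y: "y \<in> pZ (- i - 1)" "y \<notin> pZ (- i)"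
  shows "(\<Sum>e\<in>E. qp_chi (e * y)) = 0"
proof -
  define g where "g = (\<lambda>e. qp_chi (e * y))"
  define C where "C = CARD('p) ^ card {j \<in> adm_orders E. i + 1 \<le> j}"
  have full: "full_level E i" using h i by (simp add: homog_def)
  have g_eq: "g e = g e' \<longleftrightarrow> e - e' \<in> pZ (i + 1)" for e e'
    unfolding g_def by (rule chi_mult_eq_iff[OF p y])
  have p1: "1 < CARD('p)" using p prime_gt_1_nat by blast
  define z where "z = (qp_digit i 1 :: 'p qp)"
  have z: "z \<in> pZ i" "z \<notin> pZ (i + 1)"
    using qp_digit_pZ[OF p1, of i] qp_digit_not_pZ[OF p1, of i] by (simp_all add: z_def)
  define w where "w = qp_chi (z * y)"
  have "w \<noteq> 1" using mult_pZ_0_iff[OF p y, of z] z by (simp add: w_def qp_chi_eq_1_iff)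
  have w0: "w \<noteq> 0" by (simp add: w_def)
  have fiber: "sum g {e \<in> E. g e = v} = of_nat C * v" if "v \<in> g ` E" for v
  proof -
    obtain e where e: "e \<in> E" "v = g e" using \<open>v \<in> g ` E\<close> by blast
    have "{e' \<in> E. g e' = v} = E \<inter> pball e (i + 1)" unfolding e(2) g_eq by (auto simp: pball_def)
    hence "card {e' \<in> E. g e' = v} = C" using homog_count(2)[OF h e(1)] by (simp add: C_def)
    thus ?thesis by (simp add: sum.cong[of _ _ g "\<lambda>_. v"])
  qed
  have "(\<lambda>v. v * w) ` (g ` E) \<subseteq> g ` E"
  proof safe
    fix e assume "e \<in> E"
    then obtain e' where e': "e' \<in> E" "e' - (e + z) \<in> pZ (i + 1)" using full z unfolding full_level_def by blast
    hence "g e' = g (e + z)" by (simp add: g_eq)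
    also have "\<dots> = g e * w" by (simp add: g_def w_def qp_distrib_right qp_chi_add)
    finally have "g e * w = g e'" by simp
    thus "g e * w \<in> g ` E" using e' by (intro image_eqI)
  qed
  moreover have inj: "inj_on (\<lambda>v. v * w) (g ` E)" using w0 by (auto simp: inj_on_def)
  ultimately have "(\<lambda>v. v * w) ` (g ` E) = g ` E" using fin by (intro endo_inj_surj) auto
  hence "(\<Sum>v\<in>g ` E. v) = (\<Sum>v\<in>g ` E. v * w)" using sum.reindex[OF inj, of "\<lambda>v. v"] by simp
  hence "(\<Sum>v\<in>g ` E. v) = (\<Sum>v\<in>g ` E. v) * w" unfolding sum_distrib_right .
  hence "(\<Sum>v\<in>g ` E. v) * (1 - w) = 0" by (simp only: right_diff_distrib) simp
  hence zero: "(\<Sum>v\<in>g ` E. v) = 0" using \<open>w \<noteq> 1\<close> by simp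
  have "sum g E = (\<Sum>v\<in>g ` E. sum g {e \<in> E. g e = v})" by (rule sum.image_gen[OF fin])
  also have "\<dots> = (\<Sum>v\<in>g ` E. of_nat C * v)" using fiber by (intro sum.cong) auto
  also have "\<dots> = 0" using zero by (simp add: sum_distrib_left[symmetric])
  finally show ?thesis by (simp add: g_def)
qed

lemma frac_numerator:
  fixes x :: "'p::finite qp"
  assumes "x \<in> pZ (- int k)"
  shows "\<exists>c. c < CARD('p) ^ k \<and> qp_trunc x 0 = real c / real (CARD('p) ^ k)"
proof -
  let ?P = "real (CARD('p) ^ k)"
  have P: "?P > 0" by simp
  obtain z :: int where "qp_trunc x 0 = of_int z * real CARD('p) powi (- int k)"
    using qp_trunc_dvd[of x "- int k" 0] assms by (auto simp: pZ_iff_trunc pcong_def)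
  hence z: "qp_trunc x 0 = of_int z / ?P" by (simp add: power_int_minus field_simps)
  have "0 \<le> of_int z / ?P" "of_int z / ?P < 1"
    using qp_trunc_nonneg[of x 0] qp_trunc_less[of x 0] z by simp_all
  hence "0 \<le> real_of_int z" "of_int z < ?P" by (simp_all only: pos_le_divide_eq[OF P] pos_divide_less_eq[OF P] mult_1_left mult_zero_left)
  hence z0: "0 \<le> z" "real_of_int z < real_of_int (int (CARD('p) ^ k))" by simp_all
  hence "z < int (CARD('p) ^ k)" by (simp only: of_int_less_iff)
  hence "nat z < CARD('p) ^ k" using z0(1) by (simp only: nat_less_iff)
  hence "nat z < CARD('p) ^ k \<and> qp_trunc x 0 = real (nat z) / ?P" using z z0(1) by simp
  thus ?thesis by blast
qed

text \<open>Write each \<chi>(ey) as a power of one primitive p^k-th root of unity and let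
  \<open>f\<close> count the exponents. Adding \<open>z\<close> to \<open>e0\<close> multiplies the
  character value by a p-th root of unity, that is, moves the exponent by a multiple of p^(k-1). By
  periodicity of the coefficients the new exponent occurs as well, say for \<open>e'\<close>, and
  equality of the character values means congruence modulo p^(i+1).\<close>

lemma chi_sum_zero_imp_full:
  fixes E :: "'p::finite qp set"
  assumes p: "prime CARD('p)" and fin: "finite E"
    and y: "y \<in> pZ (- i - 1)" "y \<notin> pZ (- i)"
    and zero: "(\<Sum>e\<in>E. qp_chi (e * y)) = 0"
  shows "full_level E i"
  unfolding full_level_def
proof (intro ballI)
  fix e0 z assume e0: "e0 \<in> E" and z: "z \<in> (pZ i :: 'p qp set)"
  have "\<forall>e. \<exists>k. e * y \<in> pZ (- int k)"
  proof
    fix e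
    obtain n where "e * y \<in> pZ n" using pZ_exists by blast
    thus "\<exists>k. e * y \<in> pZ (- int k)" by (intro exI[of _ "nat (- n)"]) (rule pZ_mono, auto)
  qed
  then obtain K where K: "\<And>e. e * y \<in> pZ (- int (K e))" by metis
  \<comment> \<open>The point \<open>e0 + z\<close> need not lie in \<open>E\<close>, but its
    exponent is needed too.\<close>
  define F where "F = insert (e0 + z) E"
  \<comment> \<open>A common denominator p^k for all fractional parts; \<open>Suc\<close> keeps
    \<open>k\<close> positive, so that \<open>k - 1\<close> is a true predecessor.\<close>
  define k where "k = Suc (\<Sum>e\<in>F. K e)"
  have finF: "finite F" using fin by (simp add: F_def)
  have "e * y \<in> pZ (- int k)" if "e \<in> F" for e
  proof (rule pZ_mono[OF K])
    have "K e \<le> (\<Sum>e\<in>F. K e)" using finF that by (intro member_le_sum) auto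
    hence "K e \<le> k" by (simp only: k_def)
    thus "- int k \<le> - int (K e)" by simp
  qed
  hence "\<exists>c. c < CARD('p) ^ k \<and> qp_trunc (e * y) 0 = real c / real (CARD('p) ^ k)" if "e \<in> F" for e
    using frac_numerator that by blast
  then obtain c where c: "\<And>e. e \<in> F \<Longrightarrow> c e < CARD('p) ^ k"
    and ce: "\<And>e. e \<in> F \<Longrightarrow> qp_trunc (e * y) 0 = real (c e) / real (CARD('p) ^ k)" by metis
  define f where "f = (\<Sum>e\<in>E. monom (1 :: int) (c e))"
  have "ipoly f (cis (2 * pi / real (CARD('p) ^ k))) = (\<Sum>e\<in>E. qp_chi (e * y))"
    unfolding f_def ipoly_sum ipoly_monom Complex.DeMoivre qp_chi_def qp_frac_def
    by (intro sum.cong) (simp_all add: ce F_def mult_ac)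
  hence root: "ipoly f (cis (2 * pi / real (CARD('p) ^ k))) = 0" using zero by simp
  have "degree f \<le> CARD('p) ^ k - 1"
    unfolding f_def using c fin by (intro degree_sum_le order.trans[OF degree_monom_le]) (force simp: F_def)+
  hence deg: "degree f < CARD('p) ^ k" by (rule le_less_trans) simp
  define q where "q = CARD('p) ^ (k - 1)"
  have pk: "CARD('p) ^ k = CARD('p) * q" by (simp add: k_def q_def)
  have q0: "q > 0" by (simp add: q_def)
  have coeff_mod: "coeff f n = coeff f (n mod q)" if "n < CARD('p) ^ k" for n
  proof -
    have "n div q < CARD('p)" using that q0 by (simp add: pk div_less_iff_less_mult mult.commute)
    moreover have "n mod q < q" using q0 by simp
    ultimately have "coeff f (n mod q + n div q * q) = coeff f (n mod q)"
      using root_of_unity_coeff_periodic[OF p _ root deg, of "n mod q" "n div q"] by (simp add: k_def q_def)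
    thus ?thesis by simp
  qed
  have e0F: "e0 \<in> F" "e0 + z \<in> F" using e0 by (auto simp: F_def)
  \<comment> \<open>Hence the two fractional parts differ only in the digit at position -1, and one
    unit of that digit is worth \<open>q\<close> in the numerator over p^k.\<close>
  have "(e0 + z) * y - e0 * y \<in> pZ (- 1)"
    using pZ_mult[OF z y(1)] by (simp add: qp_distrib_right)
  hence "qp_trunc ((e0 + z) * y) (- 1) = qp_trunc (e0 * y) (- 1)"
    by (simp add: qp_trunc_eq_iff_digits pZ_diff_iff)
  moreover have "qp_trunc x 0 = qp_trunc x (- 1) + real (Rep_qp x (- 1)) / real CARD('p)" for x :: "'p qp"
    using qp_trunc_Suc[of x "- 1"] by (simp add: power_int_minus divide_inverse)
  ultimately have "qp_trunc ((e0 + z) * y) 0 - qp_trunc (e0 * y) 0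
      = (real (Rep_qp ((e0 + z) * y) (- 1)) - real (Rep_qp (e0 * y) (- 1))) / real CARD('p)"
    by (simp add: diff_divide_distrib)
  hence eq: "(real (c (e0 + z)) - real (c e0)) / real (CARD('p) * q)
      = (real (Rep_qp ((e0 + z) * y) (- 1)) - real (Rep_qp (e0 * y) (- 1))) / real CARD('p)"
    using ce[OF e0F(1)] ce[OF e0F(2)] unfolding pk by (simp add: diff_divide_distrib)
  have "real (c (e0 + z)) - real (c e0) = (real (Rep_qp ((e0 + z) * y) (- 1)) - real (Rep_qp (e0 * y) (- 1))) * real q"
  proof -
    have "A = B * Q" if "A / (P * Q) = B / P" "P \<noteq> 0" "Q \<noteq> 0" for A B P Q :: real
    proof -
      have "A = A / (P * Q) * (P * Q)" using that(2,3) by simp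
      also have "\<dots> = B * Q" unfolding that(1) using that(2) by simp
      finally show ?thesis .
    qed
    from this[OF eq[unfolded of_nat_mult]] show ?thesis using q0 by simp
  qed
  hence "real_of_int (int (c (e0 + z)) - int (c e0))
      = real_of_int ((int (Rep_qp ((e0 + z) * y) (- 1)) - int (Rep_qp (e0 * y) (- 1))) * int q)" by simp
  hence "int (c (e0 + z)) - int (c e0) = (int (Rep_qp ((e0 + z) * y) (- 1)) - int (Rep_qp (e0 * y) (- 1))) * int q"
    by (simp only: of_int_eq_iff)
  hence "int q dvd int (c (e0 + z)) - int (c e0)" by (metis dvd_triv_right)
  hence "int (c (e0 + z)) mod int q = int (c e0) mod int q" by (simp add: mod_eq_dvd_iff)
  hence mod_eq: "c (e0 + z) mod q = c e0 mod q" by (metis of_nat_mod of_nat_eq_iff)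
  have coeff: "coeff f n = int (card {e \<in> E. c e = n})" for n
    unfolding f_def coeff_sum using fin by (simp add: sum.If_cases Int_def)
  have "card {e \<in> E. c e = c e0} \<noteq> 0" using e0 fin by auto
  hence "card {e \<in> E. c e = c (e0 + z)} \<noteq> 0"
    using coeff_mod[OF c[OF e0F(1)]] coeff_mod[OF c[OF e0F(2)]] mod_eq by (simp add: coeff)
  then obtain e' where e': "e' \<in> E" "c e' = c (e0 + z)" by (metis (mono_tags, lifting) card.empty empty_Collect_eq)
  hence "qp_chi (e' * y) = qp_chi ((e0 + z) * y)"
    using ce[of e'] ce[OF e0F(2)] by (simp add: qp_chi_def qp_frac_def F_def)
  hence "e' - (e0 + z) \<in> pZ (i + 1)" using chi_mult_eq_iff[OF p y] by blast
  thus "\<exists>e'\<in>E. e' - (e0 + z) \<in> pZ (i + 1)" using e' by blast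
qed

section \<open>Haar measure of balls\<close>

abbreviation monna_floor :: "nat \<Rightarrow> real \<Rightarrow> int \<Rightarrow> int" where
  "monna_floor p t j \<equiv> \<lfloor>t * real p powi j\<rfloor>"

lemma monna_floor_div:
  assumes "p > 0"
  shows "monna_floor p t j = monna_floor p t (j + 1) div int p"
proof -
  have "t * real p powi j = t * real p powi (j + 1) / real_of_int (int p)"
    using assms by (simp add: power_int_add)
  thus ?thesis by (simp only: floor_divide_real_eq_div of_nat_0_le_iff)
qed

lemma monna_floor_low:
  assumes "p \<ge> 2" "t \<ge> 0"
  shows "\<exists>N. \<forall>j\<le>N. monna_floor p t j = 0"
proof -
  obtain n where n: "t < real p ^ n" using real_arch_pow[of "real p" t] assms by auto
  have "monna_floor p t j = 0" if "j \<le> - int n" for j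
  proof -
    have "t * real p powi j \<le> t * real p powi (- int n)"
      using assms that by (intro mult_left_mono power_int_increasing) auto
    also have "\<dots> < 1" using n assms by (simp add: power_int_minus field_simps)
    finally have "t * real p powi j < 1" .
    moreover have "0 \<le> t * real p powi j" using assms by simp
    ultimately show ?thesis by linarith
  qed
  thus ?thesis by blast
qed

lemma Rep_monna:
  assumes "CARD('p) \<ge> 2" "t \<ge> 0"
  shows "Rep_qp (qp_monna_inv t :: 'p::finite qp) k = nat (monna_floor CARD('p) t (k + 1) mod int CARD('p))"
proof -
  obtain N where N: "\<forall>j\<le>N. monna_floor CARD('p) t j = 0" using monna_floor_low[OF assms] by blast
  have "\<forall>k<N. nat (monna_floor CARD('p) t (k + 1) mod int CARD('p)) = 0" using N by simp
  hence "\<exists>N. \<forall>k<N. nat (monna_floor CARD('p) t (k + 1) mod int CARD('p)) = 0" by (rule exI)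
  moreover have "nat (monna_floor CARD('p) t (k + 1) mod int CARD('p)) < CARD('p)" for k
    by (simp add: nat_less_iff)
  ultimately show ?thesis
    unfolding qp_monna_inv_def using assms(2) by (subst Abs_qp_inverse) auto
qed

text \<open>The integer \<lfloor>t p^n\<rfloor> carries exactly the digits below \<open>n\<close>:
  dividing it by p drops the last one, and its residue modulo p is the last one.\<close>

lemma monna_digits_eq_iff:
  assumes p: "CARD('p) \<ge> 2" and t: "t \<ge> 0" "s \<ge> 0"
  shows "(\<forall>k<n. Rep_qp (qp_monna_inv t :: 'p::finite qp) k = Rep_qp (qp_monna_inv s :: 'p qp) k)
    \<longleftrightarrow> monna_floor CARD('p) t n = monna_floor CARD('p) s n"
proof
  assume eq: "monna_floor CARD('p) t n = monna_floor CARD('p) s n"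
  have "monna_floor CARD('p) t j = monna_floor CARD('p) s j" if "j \<le> n" for j
    using that
  proof (induction rule: int_le_induct)
    case (step i)
    thus ?case using monna_floor_div[of "CARD('p)" t "i - 1"] monna_floor_div[of "CARD('p)" s "i - 1"] by simp
  qed (rule eq)
  thus "\<forall>k<n. Rep_qp (qp_monna_inv t :: 'p qp) k = Rep_qp (qp_monna_inv s :: 'p qp) k"
    using p t by (simp add: Rep_monna)
next
  assume eq: "\<forall>k<n. Rep_qp (qp_monna_inv t :: 'p qp) k = Rep_qp (qp_monna_inv s :: 'p qp) k"
  have "j \<le> n \<longrightarrow> monna_floor CARD('p) t j = monna_floor CARD('p) s j" for j
  proof (induction j rule: upward_int_induct)
    case low
    obtain N M where "\<forall>j\<le>N. monna_floor CARD('p) t j = 0" "\<forall>j\<le>M. monna_floor CARD('p) s j = 0"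
      using monna_floor_low[OF p] t by metis
    thus ?case by (intro exI[of _ "min N M"]) simp
  next
    case (step j)
    show ?case
    proof
      assume j: "j + 1 \<le> n"
      have "nat (monna_floor CARD('p) t (j + 1) mod int CARD('p)) = nat (monna_floor CARD('p) s (j + 1) mod int CARD('p))"
        using eq j p t by (simp add: Rep_monna)
      hence "monna_floor CARD('p) t (j + 1) mod int CARD('p) = monna_floor CARD('p) s (j + 1) mod int CARD('p)"
        by (simp add: nat_eq_iff)
      moreover have "monna_floor CARD('p) t (j + 1) div int CARD('p) = monna_floor CARD('p) s (j + 1) div int CARD('p)"
        using step j monna_floor_div[of "CARD('p)" t j] monna_floor_div[of "CARD('p)" s j] by simp
      ultimately show "monna_floor CARD('p) t (j + 1) = monna_floor CARD('p) s (j + 1)"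
        by (metis div_mult_mod_eq)
    qed
  qed
  thus "monna_floor CARD('p) t n = monna_floor CARD('p) s n" by blast
qed

text \<open>Only finitely many levels can be matched: digit sequences that end in p - 1 forever are
  not in the image of the map.\<close>

lemma monna_approx:
  fixes a :: "'p::finite qp"
  assumes p: "CARD('p) \<ge> 2"
  shows "\<exists>t\<ge>0. \<forall>k<n. Rep_qp (qp_monna_inv t :: 'p qp) k = Rep_qp a k"
proof (induction n rule: upward_int_induct)
  case low
  obtain N where "\<forall>k<N. Rep_qp a k = 0" using Rep_low by blast
  thus ?case using p by (intro exI[of _ N]) (auto intro!: exI[of _ 0] simp: Rep_monna)
next
  case (step n)
  then obtain t where t: "t \<ge> 0" "\<forall>k<n. Rep_qp (qp_monna_inv t :: 'p qp) k = Rep_qp a k" by blast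
  \<comment> \<open>Appends the digit of \<open>a\<close> at position \<open>n\<close> to the base p
    expansion of \<open>t\<close> cut off before it.\<close>
  define J where "J = monna_floor CARD('p) t n * int CARD('p) + int (Rep_qp a n)"
  define s where "s = real_of_int J / real CARD('p) powi (n + 1)"
  have "J \<ge> 0" using t by (simp add: J_def)
  hence s: "s \<ge> 0" by (simp add: s_def)
  have 1: "monna_floor CARD('p) s (n + 1) = J" by (simp add: s_def)
  have "monna_floor CARD('p) s n = monna_floor CARD('p) t n"
    using monna_floor_div[of "CARD('p)" s n] Rep_less[of a n] unfolding 1 by (simp add: J_def)
  hence "\<forall>k<n. Rep_qp (qp_monna_inv s :: 'p qp) k = Rep_qp a k"
    using monna_digits_eq_iff[OF p s t(1), of n] t(2) by simp
  moreover have "Rep_qp (qp_monna_inv s :: 'p qp) n = Rep_qp a n"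
    using Rep_less[of a n] unfolding Rep_monna[OF p s] 1 by (simp add: J_def)
  ultimately have "\<forall>k<n + 1. Rep_qp (qp_monna_inv s :: 'p qp) k = Rep_qp a k" by (auto simp: order_le_less)
  thus ?case using s by blast
qed

lemma monna_vimage_pball:
  fixes a :: "'p::finite qp"
  assumes p: "CARD('p) \<ge> 2"
  shows "\<exists>c\<ge>0. qp_monna_inv -` pball a n \<inter> {0..} = {c..<c + real CARD('p) powi (- n)}"
proof -
  let ?P = "real CARD('p)"
  obtain s where s: "s \<ge> 0" "\<forall>k<n. Rep_qp (qp_monna_inv s :: 'p qp) k = Rep_qp a k"
    using monna_approx[OF p] by blast
  define J where "J = monna_floor CARD('p) s n"
  define c where "c = of_int J * ?P powi (- n)"
  have J: "J \<ge> 0" using s by (simp add: J_def)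
  have P: "?P powi n > 0" by simp
  have "qp_monna_inv t \<in> pball a n \<and> 0 \<le> t \<longleftrightarrow> c \<le> t \<and> t < c + ?P powi (- n)" for t
  proof (cases "0 \<le> t")
    case True
    have "qp_monna_inv t \<in> pball a n \<longleftrightarrow> monna_floor CARD('p) t n = J"
      using monna_digits_eq_iff[OF p True s(1), of n] s(2) by (simp add: pball_digits J_def)
    also have "\<dots> \<longleftrightarrow> of_int J \<le> t * ?P powi n \<and> t * ?P powi n < of_int J + 1" by linarith
    also have "\<dots> \<longleftrightarrow> c \<le> t \<and> t < c + ?P powi (- n)"
      unfolding c_def using P by (simp add: power_int_minus field_simps)
    finally show ?thesis using True by simp
  next
    case False
    moreover have "c \<ge> 0" using J by (simp add: c_def)
    ultimately show ?thesis by simp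
  qed
  hence "qp_monna_inv -` pball a n \<inter> {0..} = {c..<c + ?P powi (- n)}"
    by (intro set_eqI) (simp only: Int_iff vimage_eq atLeast_iff atLeastLessThan_iff)
  moreover have "c \<ge> 0" using J by (simp add: c_def)
  ultimately show ?thesis by blast
qed

section \<open>The measure space and the measure of balls\<close>

lemma space_haar [simp]: "space qp_haar = UNIV"
  by (simp add: qp_haar_def qp_M_def)

lemma sets_haar: "sets (qp_haar :: 'p::finite qp measure) = sigma_sets UNIV (range (\<lambda>(a, n). pball a n))"
proof -
  have "range (\<lambda>(a, n). qp_ball a n) = range (\<lambda>(a :: 'p qp, n). pball a n)" (is "?A = ?B")
  proof
    show "?A \<subseteq> ?B" by (force simp: qp_ball_conv)
    show "?B \<subseteq> ?A"
    proof safe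
      fix a :: "'p qp" and n
      have "pball a n = (\<lambda>(a, n). qp_ball a n) (a, - n)" by (simp add: qp_ball_conv)
      thus "pball a n \<in> ?A" by blast
    qed
  qed
  thus ?thesis by (simp add: qp_haar_def qp_M_def)
qed

lemma pball_sets [simp]: "pball a n \<in> sets qp_haar"
  unfolding sets_haar by (rule sigma_sets.Basic) force

lemma monna_measurable:
  assumes p: "CARD('p) \<ge> 2"
  shows "qp_monna_inv \<in> measurable (restrict_space lborel {0..}) (qp_M :: 'p::finite qp measure)"
  unfolding qp_M_def
proof (rule measurable_measure_of)
  fix B :: "'p qp set" assume "B \<in> range (\<lambda>(a, n). qp_ball a n)"
  then obtain a n where B: "B = pball a (- n)" by (auto simp: qp_ball_conv)
  obtain c where "c \<ge> 0" "qp_monna_inv -` pball a (- n) \<inter> {0..} = {c..<c + real CARD('p) powi (- (- n))}"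
    using monna_vimage_pball[OF p] by blast
  thus "qp_monna_inv -` B \<inter> space (restrict_space lborel {0..}) \<in> sets (restrict_space lborel {0..})"
    unfolding B by (auto simp: space_restrict_space sets_restrict_space_iff)
qed auto

lemma emeasure_pball:
  fixes a :: "'p::finite qp"
  assumes p: "CARD('p) \<ge> 2"
  shows "emeasure qp_haar (pball a n) = ennreal (real CARD('p) powi (- n))"
proof -
  obtain c where c: "c \<ge> 0" "qp_monna_inv -` pball a n \<inter> {0..} = {c..<c + real CARD('p) powi (- n)}"
    using monna_vimage_pball[OF p] by blast
  have "pball a n \<in> sets qp_M" using pball_sets[of a n] by (simp add: qp_haar_def)
  hence "emeasure qp_haar (pball a n) = emeasure (restrict_space lborel {0..}) {c..<c + real CARD('p) powi (- n)}"
    unfolding qp_haar_def using monna_measurable[OF p] c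
    by (subst emeasure_distr) (auto simp: space_restrict_space)
  also have "\<dots> = emeasure lborel {c..<c + real CARD('p) powi (- n)}"
    using c(1) by (subst emeasure_restrict_space) auto
  also have "\<dots> = ennreal (real CARD('p) powi (- n))" by simp
  finally show ?thesis .
qed

lemma measure_pball:
  fixes a :: "'p::finite qp"
  assumes p: "CARD('p) \<ge> 2"
  shows "measure qp_haar (pball a n) = real CARD('p) powi (- n)"
  using emeasure_pball[OF p, of a n] by (simp add: measure_def)

lemma sigma_finite_haar:
  assumes p: "CARD('p) \<ge> 2"
  shows "sigma_finite_measure (qp_haar :: 'p::finite qp measure)"
proof
  show "\<exists>A. countable A \<and> A \<subseteq> sets (qp_haar :: 'p qp measure) \<and> \<Union> A = space qp_haar \<and>
      (\<forall>a\<in>A. emeasure qp_haar a \<noteq> \<infinity>)"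
  proof (intro exI conjI)
    let ?A = "range (\<lambda>n::int. pball (0 :: 'p qp) n)"
    show "countable ?A" by simp
    show "?A \<subseteq> sets qp_haar" by auto
    show "\<Union> ?A = space qp_haar" using pZ_exists by (auto simp: pball_def)
    show "\<forall>a\<in>?A. emeasure qp_haar a \<noteq> \<infinity>" using emeasure_pball[OF p] by auto
  qed
qed

text \<open>Balls have positive measure. So a property that is constant on balls of some level and
  holds almost everywhere holds everywhere.\<close>

lemma AE_ball_ex:
  fixes a :: "'p::finite qp"
  assumes p: "CARD('p) \<ge> 2" and "AE x in qp_haar. Q x"
  shows "\<exists>x\<in>pball a n. Q x"
proof (rule ccontr)
  assume "\<not> ?thesis"
  hence *: "pball a n \<subseteq> {x \<in> space qp_haar. \<not> Q x}" by auto
  obtain N where N: "{x \<in> space qp_haar. \<not> Q x} \<subseteq> N" "emeasure qp_haar N = 0" "N \<in> sets qp_haar"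
    using assms(2) by (rule AE_E)
  have "emeasure qp_haar (pball a n) \<le> emeasure qp_haar N" using * N by (intro emeasure_mono) auto
  thus False using N(2) emeasure_pball[OF p, of a n] by simp
qed

section \<open>Integrals of locally constant functions as finite sums\<close>

lemma periodic_eq_UN: "periodic L S \<Longrightarrow> S = (\<Union>r\<in>S \<inter> qp_short L. pball r L)"
proof (intro equalityI subsetI)
  fix x assume "periodic L S" "x \<in> S"
  thus "x \<in> (\<Union>r\<in>S \<inter> qp_short L. pball r L)" using qp_cut_mem[of L S x] qp_cut_diff[of x L] by (auto simp: pball_def)
qed (auto simp: periodic_def)

lemma periodic_sets: "periodic L S \<Longrightarrow> S \<in> sets qp_haar"
proof -
  assume "periodic L S"
  moreover have "(\<Union>r\<in>S \<inter> qp_short L. pball r L) \<in> sets qp_haar"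
    by (intro sets.countable_UN'' countable_Int2 countable_qp_short) auto
  ultimately show ?thesis using periodic_eq_UN by metis
qed

lemma locally_constant_measurable:
  fixes g :: "'p::finite qp \<Rightarrow> complex"
  assumes "\<And>x y. y - x \<in> pZ L \<Longrightarrow> g y = g x"
  shows "g \<in> borel_measurable qp_haar"
proof (rule measurableI)
  fix A :: "complex set"
  have "periodic L (g -` A)" unfolding periodic_def pball_def using assms by fastforce
  thus "g -` A \<inter> space qp_haar \<in> sets qp_haar" using periodic_sets by simp
qed simp

lemma mem_pball_qp_short_iff:
  assumes "r \<in> qp_short L"
  shows "x \<in> pball r L \<longleftrightarrow> r = qp_cut x L"
proof
  assume "x \<in> pball r L"
  hence "(x - qp_cut x L) - (x - r) \<in> pZ L" by (intro pZ_diff[OF qp_cut_diff]) (simp add: pball_def)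
  hence "r - qp_cut x L \<in> pZ L" by (simp add: algebra_simps)
  thus "r = qp_cut x L" by (rule qp_short_unique[OF assms qp_cut_qp_short])
qed (simp add: pball_def qp_cut_diff)

lemma finite_reps: "S \<subseteq> pball a M \<Longrightarrow> finite (S \<inter> qp_short L)"
  using finite_qp_short_pball[of L a M] by (rule rev_finite_subset) auto

lemma indicator_reps:
  assumes S: "periodic L S" "S \<subseteq> pball a M"
  shows "(indicator S x :: real) = (\<Sum>r\<in>S \<inter> qp_short L. indicator (pball r L) x)"
proof -
  have "(\<Sum>r\<in>S \<inter> qp_short L. indicator (pball r L) x :: real) = (\<Sum>r\<in>S \<inter> qp_short L. if r = qp_cut x L then 1 else 0)"
    by (intro sum.cong refl) (simp add: indicator_def mem_pball_qp_short_iff)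
  also have "\<dots> = (if qp_cut x L \<in> S \<inter> qp_short L then 1 else 0)" using finite_reps[OF S(2)] by simp
  also have "\<dots> = indicator S x"
    using qp_cut_mem[OF S(1), of x] periodicD[OF S(1) _ qp_cut_diff, of x] by (auto simp: indicator_def)
  finally show ?thesis by (rule sym)
qed

lemma set_integral_reps:
  fixes h :: "'p::finite qp \<Rightarrow> complex"
  assumes S: "periodic L S" "S \<subseteq> pball a M" and h: "set_integrable qp_haar S h"
  shows "(LINT x:S|qp_haar. h x) = (\<Sum>r\<in>S \<inter> qp_short L. (LINT x:pball r L|qp_haar. h x))"
proof -
  have "set_integrable qp_haar (pball r L) h" if "r \<in> S \<inter> qp_short L" for r
    using that S(1) by (intro set_integrable_subset[OF h]) (auto simp: periodic_def)
  thus ?thesis unfolding set_lebesgue_integral_def indicator_reps[OF S] scaleR_sum_left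
    by (intro Bochner_Integration.integral_sum) (auto simp: set_integrable_def)
qed

lemma set_integrable_pball_const:
  fixes h :: "'p::finite qp \<Rightarrow> 'b :: {banach, second_countable_topology}"
  assumes p: "CARD('p) \<ge> 2" and "\<And>x. x \<in> pball r L \<Longrightarrow> h x = c"
  shows "set_integrable qp_haar (pball r L) h"
    and "(LINT x:pball r L|qp_haar. h x) = (real CARD('p) powi (- L)) *\<^sub>R c"
proof -
  have eq: "indicator (pball r L) x *\<^sub>R h x = indicator (pball r L) x *\<^sub>R c" for x
    by (cases "x \<in> pball r L") (simp_all add: assms(2))
  have "emeasure qp_haar (pball r L) < \<infinity>" using emeasure_pball[OF p, of r L] by simp
  thus "set_integrable qp_haar (pball r L) h"
    unfolding set_integrable_def eq by (intro integrable_scaleR_left integrable_real_indicator) auto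
  show "(LINT x:pball r L|qp_haar. h x) = (real CARD('p) powi (- L)) *\<^sub>R c"
    unfolding set_lebesgue_integral_def eq using \<open>emeasure qp_haar (pball r L) < \<infinity>\<close>
    by (subst integral_scaleR_left) (auto simp: measure_pball[OF p])
qed

lemma set_integrable_locally_constant:
  fixes h :: "'p::finite qp \<Rightarrow> 'b :: {banach, second_countable_topology}"
  assumes p: "CARD('p) \<ge> 2" and S: "periodic L S" "S \<subseteq> pball a M"
    and h: "\<And>x y. x \<in> S \<Longrightarrow> y - x \<in> pZ L \<Longrightarrow> h y = h x"
  shows "set_integrable qp_haar S h"
proof -
  have c: "h x = h r" if "r \<in> S \<inter> qp_short L" "x \<in> pball r L" for r x using h that by (auto simp: pball_def)
  have "integrable qp_haar (\<lambda>x. \<Sum>r\<in>S \<inter> qp_short L. indicator (pball r L) x *\<^sub>R h x)"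
    using set_integrable_pball_const(1)[OF p c] by (intro Bochner_Integration.integrable_sum) (auto simp: set_integrable_def)
  thus ?thesis unfolding set_integrable_def indicator_reps[OF S] scaleR_sum_left .
qed

lemma set_integral_locally_constant:
  fixes h :: "'p::finite qp \<Rightarrow> complex"
  assumes p: "CARD('p) \<ge> 2" and S: "periodic L S" "S \<subseteq> pball a M"
    and h: "\<And>x y. x \<in> S \<Longrightarrow> y - x \<in> pZ L \<Longrightarrow> h y = h x"
  shows "(LINT x:S|qp_haar. h x) = of_real (real CARD('p) powi (- L)) * (\<Sum>r\<in>S \<inter> qp_short L. h r)"
proof -
  have c: "h x = h r" if "r \<in> S \<inter> qp_short L" "x \<in> pball r L" for r x using h that by (auto simp: pball_def)
  have "set_integrable qp_haar S h" by (rule set_integrable_locally_constant[OF p S h])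
  from set_integral_reps[OF S this] show ?thesis
    unfolding sum_distrib_left
    using set_integrable_pball_const(2)[OF p c] by (simp only: scaleR_conv_of_real cong: sum.cong)
qed

lemma measure_reps:
  fixes S :: "'p::finite qp set"
  assumes p: "CARD('p) \<ge> 2" and S: "periodic L S" "S \<subseteq> pball a M"
  shows "measure qp_haar S = real CARD('p) powi (- L) * card (S \<inter> qp_short L)"
proof -
  have "emeasure qp_haar S < \<infinity>"
    using emeasure_mono[OF S(2) pball_sets] emeasure_pball[OF p, of a M] by (simp add: order_le_less_trans)
  hence "(LINT x:S|qp_haar. (1::complex)) = of_real (measure qp_haar S)"
    unfolding set_lebesgue_integral_def using periodic_sets[OF S(1)]
    by (subst integral_scaleR_left) (auto simp: scaleR_conv_of_real)
  moreover have "(LINT x:S|qp_haar. (1::complex)) = of_real (real CARD('p) powi (- L)) * (\<Sum>r\<in>S \<inter> qp_short L. 1)"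
    by (rule set_integral_locally_constant[OF p S]) simp
  ultimately have "complex_of_real (measure qp_haar S) = of_real (real CARD('p) powi (- L) * card (S \<inter> qp_short L))"
    by simp
  thus ?thesis by (simp only: of_real_eq_iff)
qed

section \<open>Tilings\<close>

lemma qp_open_conv: "qp_open S \<longleftrightarrow> (\<forall>x\<in>S. \<exists>n. pball x n \<subseteq> S)"
  unfolding qp_open_def qp_ball_conv by (metis minus_minus)

lemma openin_qp_top: "openin qp_top S \<longleftrightarrow> qp_open S"
proof -
  have "istopology (qp_open :: 'a qp set \<Rightarrow> bool)"
    unfolding istopology_def
  proof (intro conjI allI impI)
    fix S T :: "'a qp set"
    assume ST: "qp_open S" "qp_open T"
    show "qp_open (S \<inter> T)"
      unfolding qp_open_conv
    proof
      fix x assume "x \<in> S \<inter> T"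
      then obtain n m where "pball x n \<subseteq> S" "pball x m \<subseteq> T" using ST unfolding qp_open_conv by blast
      moreover have "pball x (max n m) \<subseteq> pball x n" "pball x (max n m) \<subseteq> pball x m" by (simp_all add: pball_mono)
      ultimately show "\<exists>n. pball x n \<subseteq> S \<inter> T" by blast
    qed
  next
    fix K :: "'a qp set set"
    assume K: "\<forall>k\<in>K. qp_open k"
    show "qp_open (\<Union>K)"
      unfolding qp_open_conv
    proof
      fix x assume "x \<in> \<Union>K"
      then obtain k where k: "k \<in> K" "x \<in> k" by blast
      then obtain n where "pball x n \<subseteq> k" using K unfolding qp_open_conv by blast
      thus "\<exists>n. pball x n \<subseteq> \<Union>K" using k by blast
    qed
  qed
  thus ?thesis by (simp add: qp_top_def topology_inverse')
qed

text \<open>Openness covers \<Omega> by balls contained in it, compactness leaves finitely many of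
  them. The largest of their levels serves as \<open>N\<close>, and the largest of their enclosing
  balls around 0 serves for the bound.\<close>

lemma compact_open_periodic:
  fixes \<Omega> :: "'p::finite qp set"
  assumes op: "openin qp_top \<Omega>" and co: "compactin qp_top \<Omega>"
  shows "\<exists>N M. periodic N \<Omega> \<and> \<Omega> \<subseteq> pball 0 M"
proof -
  define U where "U = {B. \<exists>x n. B = pball x n \<and> B \<subseteq> \<Omega>}"
  have 1: "openin qp_top B" if "B \<in> U" for B
  proof -
    obtain x n where B: "B = pball x n" using \<open>B \<in> U\<close> by (auto simp: U_def)
    have "pball y n \<subseteq> pball x n" if "y \<in> pball x n" for y using pball_eq[OF that] by simp
    thus ?thesis unfolding openin_qp_top qp_open_conv B by blast
  qed
  have 2: "\<Omega> \<subseteq> \<Union>U"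
  proof
    fix x assume "x \<in> \<Omega>"
    then obtain n where "pball x n \<subseteq> \<Omega>" using op unfolding openin_qp_top qp_open_conv by blast
    hence "pball x n \<in> U" by (auto simp: U_def)
    thus "x \<in> \<Union>U" by (rule UnionI) simp
  qed
  have "\<exists>F. finite F \<and> F \<subseteq> U \<and> \<Omega> \<subseteq> \<Union>F"
    using co[unfolded compactin_def, THEN conjunct2, THEN spec[of _ U]] 1 2 by simp
  then obtain F where F: "finite F" "F \<subseteq> U" "\<Omega> \<subseteq> \<Union>F" by blast
  have "\<exists>n. periodic n B \<and> (\<exists>m. B \<subseteq> pball 0 m)" if "B \<in> F" for B
  proof -
    obtain x n where B: "B = pball x n" using \<open>B \<in> F\<close> F(2) by (auto simp: U_def)
    obtain k where k: "x \<in> pZ k" using pZ_exists by blast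
    have "B \<subseteq> pball 0 (min k n)"
    proof
      fix y assume "y \<in> B"
      hence "y - x \<in> pZ (min k n)" "x \<in> pZ (min k n)" using k by (auto simp: B pball_def intro: pZ_mono)
      from pZ_add[OF this] show "y \<in> pball 0 (min k n)" by (simp add: pball_def)
    qed
    thus ?thesis using periodic_pball[of n n x] B by blast
  qed
  then obtain n m where nm: "\<And>B. B \<in> F \<Longrightarrow> periodic (n B) B" "\<And>B. B \<in> F \<Longrightarrow> B \<subseteq> pball 0 (m B)" by metis
  \<comment> \<open>The extra 0 keeps \<open>Max\<close> and \<open>Min\<close> meaningful if
    \<open>F\<close> is empty.\<close>
  define N where "N = Max (insert 0 (n ` F))"
  define M where "M = Min (insert 0 (m ` F))"
  have N: "n B \<le> N" and M: "M \<le> m B" if "B \<in> F" for B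
    unfolding N_def M_def using F(1) that by (auto intro!: Max_ge Min_le)
  have eq: "\<Omega> = \<Union>F" using F by (auto simp: U_def)
  have "periodic N \<Omega>" unfolding periodic_def
  proof
    fix x assume "x \<in> \<Omega>"
    then obtain B where B: "B \<in> F" "x \<in> B" using eq by blast
    hence "pball x N \<subseteq> B" using periodic_mono[OF nm(1) N, of B] unfolding periodic_def by blast
    thus "pball x N \<subseteq> \<Omega>" using B eq by blast
  qed
  moreover have "\<Omega> \<subseteq> pball 0 M"
  proof
    fix x assume "x \<in> \<Omega>"
    then obtain B where B: "B \<in> F" "x \<in> B" using eq by blast
    thus "x \<in> pball 0 M" using nm(2)[OF B(1)] pball_mono[OF M[OF B(1)], of 0] by blast
  qed
  ultimately show ?thesis by blast
qed

lemma full_UNIV: "full_level UNIV i"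
  unfolding full_level_def by (metis UNIV_I pZ_zero diff_self)

lemma full_pball: "n \<le> i \<Longrightarrow> full_level (pball a n) i"
  using full_Int_pball[OF full_UNIV, of n i a] by simp

lemma adm_orders_pball_ge: "i \<in> adm_orders (pball a n) \<Longrightarrow> n \<le> i"
  using adm_orders_pball[of i UNIV a n] by simp

text \<open>The centre \<open>c\<close> is a parameter because the treatment of spectra also
  interprets the locale for a small ball inside \<Omega>.\<close>

locale homog_set =
  fixes \<Omega> :: "'p::finite qp set" and N M :: int and c :: "'p qp"
  assumes prime: "prime CARD('p)" and per: "periodic N \<Omega>" and bdd: "\<Omega> \<subseteq> pball c M"
    and ne: "\<Omega> \<noteq> {}" and fullI: "\<And>i. i \<in> adm_orders \<Omega> \<Longrightarrow> full_level \<Omega> i"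
begin

lemma card_p: "CARD('p) \<ge> 2"
  using prime prime_ge_2_nat by blast

lemma adm_ge_N: "N \<le> i \<Longrightarrow> i \<in> adm_orders \<Omega>"
proof (rule full_imp_adm[OF _ ne card_p])
  assume "N \<le> i"
  have "e + z \<in> \<Omega>" if "e \<in> \<Omega>" "z \<in> pZ i" for e z
    using periodicD[OF per that(1), of "e + z"] pZ_mono[OF that(2) \<open>N \<le> i\<close>] by simp
  thus "full_level \<Omega> i" unfolding full_level_def by (metis pZ_zero diff_self)
qed

lemma adm_imp_ge_M: "i \<in> adm_orders \<Omega> \<Longrightarrow> M \<le> i"
  using adm_orders_mono[OF bdd] adm_orders_pball_ge by blast

lemma M_le_N: "M \<le> N"
  using adm_imp_ge_M adm_ge_N by blast

lemma reps:
  assumes "N \<le> L"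
  shows "finite (\<Omega> \<inter> qp_short L)" "\<Omega> \<inter> qp_short L \<noteq> {}" "homog (\<Omega> \<inter> qp_short L)"
proof -
  have per': "periodic L \<Omega>" using periodic_mono[OF per assms] .
  show "finite (\<Omega> \<inter> qp_short L)" by (rule finite_reps[OF bdd])
  show "\<Omega> \<inter> qp_short L \<noteq> {}" using ne qp_cut_mem[OF per'] by blast
  show "homog (\<Omega> \<inter> qp_short L)" by (rule homog_reps[OF per' fullI])
qed

text \<open>The zeros of the Fourier transform of \<Omega>: by the two criteria above, vanishing
  depends only on the valuation of \<open>y\<close>. Representatives modulo p^L Z_p see only levels
  below \<open>L\<close>, whence \<open>i < L\<close>.\<close>

lemma reps_chi_sum_zero_iff:
  assumes L: "N \<le> L" "i < L" and y: "y \<in> pZ (- i - 1)" "y \<notin> pZ (- i)"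
  shows "(\<Sum>r\<in>\<Omega> \<inter> qp_short L. qp_chi (r * y)) = 0 \<longleftrightarrow> i \<in> adm_orders \<Omega>"
proof
  assume "(\<Sum>r\<in>\<Omega> \<inter> qp_short L. qp_chi (r * y)) = 0"
  hence "full_level (\<Omega> \<inter> qp_short L) i" using chi_sum_zero_imp_full[OF prime reps(1)[OF L(1)] y] by blast
  hence "i \<in> adm_orders (\<Omega> \<inter> qp_short L)" using full_imp_adm reps(2)[OF L(1)] card_p by blast
  thus "i \<in> adm_orders \<Omega>" using adm_orders_reps by blast
next
  assume "i \<in> adm_orders \<Omega>"
  hence "full_level (\<Omega> \<inter> qp_short L) i" using full_reps[OF periodic_mono[OF per L(1)] fullI L(2)] by blast
  hence "i \<in> adm_orders (\<Omega> \<inter> qp_short L)" using full_imp_adm reps(2)[OF L(1)] card_p by blast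
  thus "(\<Sum>r\<in>\<Omega> \<inter> qp_short L. qp_chi (r * y)) = 0"
    using chi_sum_zero[OF prime reps(1)[OF L(1)] reps(3)[OF L(1)] _ y] by blast
qed

text \<open>If at every level either \<open>T\<close> or \<open>\<Omega>\<close> has all its children, then an approximation of \<open>x\<close> by
  a sum can be improved digit by digit.\<close>

lemma greedy:
  assumes T: "\<And>i. i \<notin> adm_orders \<Omega> \<Longrightarrow> full_level T i"
    and "t \<in> T" "w \<in> \<Omega>" "x - (t + w) \<in> pZ m" "m \<le> n"
  shows "\<exists>t'\<in>T. \<exists>w'\<in>\<Omega>. t' - t \<in> pZ m \<and> x - (t' + w') \<in> pZ n"
  using \<open>m \<le> n\<close>
proof (induction rule: int_ge_induct)
  case base
  have "t - t \<in> pZ m" by simp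
  thus ?case using assms by blast
next
  case (step n)
  then obtain t' w' where tw: "t' \<in> T" "w' \<in> \<Omega>" "t' - t \<in> pZ m" "x - (t' + w') \<in> pZ n" by blast
  show ?case
  proof (cases "n \<in> adm_orders \<Omega>")
    case True
    then obtain w'' where w: "w'' \<in> \<Omega>" "w'' - (w' + (x - (t' + w'))) \<in> pZ (n + 1)"
      using fullI[OF True] tw unfolding full_level_def by blast
    have "x - (t' + w'') \<in> pZ (n + 1)" using pZ_minus[OF w(2)] by (simp add: algebra_simps)
    thus ?thesis using tw w by blast
  next
    case False
    then obtain t'' where t: "t'' \<in> T" "t'' - (t' + (x - (t' + w'))) \<in> pZ (n + 1)"
      using T[OF False] tw unfolding full_level_def by blast
    have 1: "x - (t'' + w') \<in> pZ (n + 1)" using pZ_minus[OF t(2)] by (simp add: algebra_simps)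
    \<comment> \<open>All corrections happen at levels from \<open>m\<close> on, so
      \<open>t''\<close> stays within p^m Z_p of the starting point \<open>t\<close>; the uniqueness
      argument for tilings relies on this.\<close>
    have "t'' - (t' + (x - (t' + w'))) \<in> pZ m" "x - (t' + w') \<in> pZ m"
      using t(2) tw(4) step.hyps by (auto intro: pZ_mono)
    from pZ_add[OF pZ_add[OF this] tw(3)] have "t'' - t \<in> pZ m" by (simp add: algebra_simps)
    thus ?thesis using 1 tw t by blast
  qed
qed

text \<open>The set of translates covering \<open>x\<close> depends only on the ball of level
  \<open>N\<close> around \<open>x\<close>, so the almost everywhere statement holds everywhere. As
  \<open>card\<close> of an infinite set is 0, the value 1 means exactly one translate.\<close>

lemma tiling_complement_iff:
  "tiling_complement \<Omega> T \<longleftrightarrow> (\<forall>x. \<exists>!t. t \<in> T \<and> x - t \<in> \<Omega>)"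
proof -
  have card1: "card {t \<in> T. x - t \<in> \<Omega>} = 1 \<longleftrightarrow> (\<exists>!t. t \<in> T \<and> x - t \<in> \<Omega>)" for x
    by (simp add: card_1_singleton_iff set_eq_iff) metis
  have "tiling_complement \<Omega> T \<longleftrightarrow> (\<forall>x. card {t \<in> T. x - t \<in> \<Omega>} = 1)"
  proof
    assume ae: "tiling_complement \<Omega> T"
    show "\<forall>x. card {t \<in> T. x - t \<in> \<Omega>} = 1"
    proof
      fix x
      obtain x' where x': "x' \<in> pball x N" "card {t \<in> T. x' - t \<in> \<Omega>} = 1"
        using AE_ball_ex[OF card_p ae[unfolded tiling_complement_def], of x N] by blast
      have "x' - x \<in> pZ N" "x - x' \<in> pZ N" using x'(1) pZ_diff_commute[of x x' N] by (auto simp: pball_def)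
      hence "x' - t \<in> \<Omega> \<longleftrightarrow> x - t \<in> \<Omega>" for t
        using periodicD[OF per, of "x - t" "x' - t"] periodicD[OF per, of "x' - t" "x - t"] by auto
      thus "card {t \<in> T. x - t \<in> \<Omega>} = 1" using x'(2) by simp
    qed
  qed (simp add: tiling_complement_def)
  thus ?thesis unfolding card1 .
qed

text \<open>Corrections up to level \<open>N\<close> suffice, for \<Omega> absorbs the remaining
  error. Two covering translates would give t' - t = (x - t) - (x - t'), a difference whose
  valuation is an order both of \<open>T\<close> and of \<Omega>.\<close>

lemma tiling_complementI:
  assumes T: "homog T" "adm_orders T = UNIV - adm_orders \<Omega>"
  shows "tiling_complement \<Omega> T"
  unfolding tiling_complement_iff
proof
  fix x
  have full: "full_level T i" if "i \<notin> adm_orders \<Omega>" for i using T that unfolding homog_def by blast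
  \<comment> \<open>All orders of \<Omega> are at least \<open>M\<close>, so some level is left to
    \<open>T\<close>, and \<open>T\<close> is not empty.\<close>
  have "M - 1 \<in> adm_orders T" using adm_imp_ge_M[of "M - 1"] T(2) by auto
  then obtain t0 where t0: "t0 \<in> T" by (auto simp: adm_orders_def)
  obtain w0 where w0: "w0 \<in> \<Omega>" using ne by blast
  obtain m where m: "x - (t0 + w0) \<in> pZ m" using pZ_exists by blast
  obtain t w where tw: "t \<in> T" "w \<in> \<Omega>" "x - (t + w) \<in> pZ (max m N)"
    using greedy[OF full t0 w0 m, of "max m N"] by auto
  have "x - (t + w) \<in> pZ N" by (rule pZ_mono[OF tw(3)]) simp
  hence "x - t \<in> \<Omega>" using periodicD[OF per tw(2), of "x - t"] by (simp add: algebra_simps)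
  moreover have "t' = t" if t': "t' \<in> T" "x - t' \<in> \<Omega>" for t'
  proof (rule ccontr)
    assume "t' \<noteq> t"
    then obtain k where k: "t' - t \<in> pZ k" "t' - t \<notin> pZ (k + 1)" using ex_valuation[of "t' - t"] by auto
    hence "k \<in> adm_orders T" using t' tw(1) unfolding adm_orders_iff by blast
    moreover have "(x - t) - (x - t') = t' - t" by simp
    hence "k \<in> adm_orders \<Omega>" using k t'(2) \<open>x - t \<in> \<Omega>\<close> unfolding adm_orders_iff by metis
    ultimately show False using T(2) by blast
  qed
  ultimately show "\<exists>!t. t \<in> T \<and> x - t \<in> \<Omega>" using tw(1) by blast
qed

text \<open>The convolution argument carried out inside the ball e + p^m Z_p, which is tiled by the
  translates of \<Omega> by the points of \<open>T\<close> in that ball.\<close>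

lemma tiling_full:
  assumes tile: "\<And>x. \<exists>!t. t \<in> T \<and> x - t \<in> \<Omega>" and i: "i \<notin> adm_orders \<Omega>"
  shows "full_level T i"
  unfolding full_level_def
proof (intro ballI)
  fix e z assume e: "e \<in> T" and z: "z \<in> (pZ i :: 'p qp set)"
  have iN: "i < N" using adm_ge_N[of i] i by linarith
  obtain k where k: "c \<in> pZ k" using pZ_exists by blast
  \<comment> \<open>At most \<open>M\<close> and \<open>k\<close>, so that \<Omega> lies in p^m Z_p;
    at most \<open>i\<close>, so that the ball is full at level \<open>i\<close>.\<close>
  define m where "m = min (min M k) i"
  define E where "E = T \<inter> pball e m"
  define R where "R = \<Omega> \<inter> qp_short N"
  define D where "D = pball e m \<inter> qp_short N"
  define y where "y = (qp_digit (- i - 1) 1 :: 'p qp)"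
  have p1: "1 < CARD('p)" using card_p by simp
  have y: "y \<in> pZ (- i - 1)" "y \<notin> pZ (- i)"
    using qp_digit_pZ[OF p1, of "- i - 1"] qp_digit_not_pZ[OF p1, of "- i - 1"] by (simp_all add: y_def)
  have m: "m \<le> i" "m \<le> N" using iN by (auto simp: m_def)
  have \<Omega>m: "w \<in> pZ m" if "w \<in> \<Omega>" for w
  proof -
    have "w - c \<in> pZ m" "c \<in> pZ m" using that bdd k by (auto simp: pball_def m_def intro: pZ_mono)
    from pZ_add[OF this] show ?thesis by simp
  qed
  have unique: "t = t'" if "t \<in> T" "x - t \<in> \<Omega>" "t' \<in> T" "x - t' \<in> \<Omega>" for x t t'
    using tile[of x] that by blast
  have inj: "t = t' \<and> w = w'"
    if "t \<in> T" "t' \<in> T" "w \<in> R" "w' \<in> R" "qp_cut (t + w) N = qp_cut (t' + w') N" for t t' w w'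
  proof -
    have "(t + w - qp_cut (t + w) N) - (t' + w' - qp_cut (t' + w') N) \<in> pZ N" by (intro pZ_diff qp_cut_diff)
    hence d: "(t + w) - (t' + w') \<in> pZ N" using that(5) by simp
    have "t + w - t' \<in> \<Omega>" using periodicD[OF per, of w' "t + w - t'"] that(4) d by (simp add: R_def algebra_simps)
    moreover have "t + w - t \<in> \<Omega>" using that(3) by (simp add: R_def)
    ultimately have "t = t'" using unique that(1,2) by blast
    moreover from this have "w - w' \<in> pZ N" using d by simp
    hence "w = w'" using qp_short_unique that(3,4) by (auto simp: R_def)
    ultimately show ?thesis by simp
  qed
  obtain w0 where w0: "w0 \<in> R" using reps(2)[of N] by (auto simp: R_def)
  have D: "finite D" "D \<noteq> {}" "homog D" "full_level D i"
  proof -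
    have perD: "periodic N (pball e m)" by (rule periodic_pball[OF m(2)])
    show "finite D" unfolding D_def by (rule finite_reps[OF order_refl])
    show "D \<noteq> {}" using qp_cut_mem[OF perD pball_self] by (auto simp: D_def)
    show "homog D" unfolding D_def by (rule homog_reps[OF perD]) (auto intro!: full_pball dest: adm_orders_pball_ge)
    show "full_level D i" unfolding D_def by (rule full_reps[OF perD full_pball[OF m(1)] iN])
  qed
  have memD: "qp_cut (t + w) N \<in> D" if "t \<in> E" "w \<in> R" for t w
  proof -
    have "t - e \<in> pZ m" "w \<in> pZ m" using that \<Omega>m by (auto simp: E_def R_def pball_def)
    from pZ_add[OF this] have "t + w \<in> pball e m" by (simp add: pball_def algebra_simps)
    thus ?thesis using qp_cut_mem[OF periodic_pball[OF m(2)]] by (simp add: D_def)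
  qed
  \<comment> \<open>Uniqueness of the tiling makes adding a fixed \<open>w0\<close> injective modulo
    p^N, with values in the finite set \<open>D\<close>.\<close>
  have finE: "finite E"
  proof (rule finite_imageD)
    show "finite ((\<lambda>t. qp_cut (t + w0) N) ` E)" by (rule finite_subset[OF _ D(1)]) (use memD w0 in auto)
    show "inj_on (\<lambda>t. qp_cut (t + w0) N) E" using inj w0 by (auto simp: inj_on_def E_def)
  qed
  have bij: "bij_betw (\<lambda>(t, w). qp_cut (t + w) N) (E \<times> R) D"
    unfolding bij_betw_def
  proof (intro conjI equalityI subsetI)
    show "inj_on (\<lambda>(t, w). qp_cut (t + w) N) (E \<times> R)" using inj by (auto simp: inj_on_def E_def)
    fix x assume "x \<in> (\<lambda>(t, w). qp_cut (t + w) N) ` (E \<times> R)"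
    thus "x \<in> D" using memD by auto
  next
    fix x assume x: "x \<in> D"
    obtain t where t: "t \<in> T" "x - t \<in> \<Omega>" using tile[of x] by blast
    have "x - e \<in> pZ m" using x by (simp add: D_def pball_def)
    hence "(x - e) - (x - t) \<in> pZ m" using \<Omega>m[OF t(2)] by (rule pZ_diff)
    hence tE: "t \<in> E" using t by (simp add: E_def pball_def)
    define w where "w = qp_cut (x - t) N"
    have w: "w \<in> R" using qp_cut_mem[OF per t(2)] by (simp add: R_def w_def)
    have "(t + w) - qp_cut (t + w) N + ((x - t) - w) \<in> pZ N" unfolding w_def by (intro pZ_add qp_cut_diff)
    hence "x - qp_cut (t + w) N \<in> pZ N" by (simp add: algebra_simps)
    hence "x = qp_cut (t + w) N" using x by (intro qp_short_unique) (auto simp: D_def)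
    thus "x \<in> (\<lambda>(t, w). qp_cut (t + w) N) ` (E \<times> R)" using tE w by force
  qed
  \<comment> \<open>As \<open>i < N\<close>, the character is constant on balls of level
    \<open>N\<close>; hence the bijection turns the product of the sums over \<open>E\<close> and
    \<open>R\<close> into the sum over \<open>D\<close>. The latter vanishes, and the factor of
    \<open>R\<close> does not, since \<open>i\<close> is no order of \<Omega>.\<close>
  have chi: "qp_chi (qp_cut x N * y) = qp_chi (x * y)" for x
    unfolding chi_mult_eq_iff[OF prime y] pZ_diff_commute[of "qp_cut x N"]
    by (rule pZ_mono[OF qp_cut_diff]) (use iN in simp)
  have "(\<Sum>t\<in>E. qp_chi (t * y)) * (\<Sum>w\<in>R. qp_chi (w * y)) = (\<Sum>(t, w)\<in>E \<times> R. qp_chi (t * y) * qp_chi (w * y))"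
    by (simp add: sum_product sum.cartesian_product)
  also have "\<dots> = (\<Sum>u\<in>E \<times> R. qp_chi ((case u of (t, w) \<Rightarrow> qp_cut (t + w) N) * y))"
    by (intro sum.cong) (auto simp: chi qp_distrib_right qp_chi_add)
  also have "\<dots> = (\<Sum>d\<in>D. qp_chi (d * y))" by (rule sum.reindex_bij_betw[OF bij])
  also have "\<dots> = 0"
    using full_imp_adm[OF D(4,2) card_p] by (rule chi_sum_zero[OF prime D(1,3) _ y])
  finally have "(\<Sum>t\<in>E. qp_chi (t * y)) = 0"
    using reps_chi_sum_zero_iff[OF _ iN y] i by (auto simp: R_def)
  hence "full_level E i" by (rule chi_sum_zero_imp_full[OF prime finE y])
  moreover have "e \<in> E" using e by (simp add: E_def)
  ultimately obtain e' where "e' \<in> E" "e' - (e + z) \<in> pZ (i + 1)" using z unfolding full_level_def by blast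
  thus "\<exists>e'\<in>T. e' - (e + z) \<in> pZ (i + 1)" by (auto simp: E_def)
qed

lemma tiling_complementD:
  assumes "tiling_complement \<Omega> T"
  shows "homog T" "adm_orders T = UNIV - adm_orders \<Omega>"
proof -
  have tile: "\<exists>!t. t \<in> T \<and> x - t \<in> \<Omega>" for x using assms tiling_complement_iff by blast
  have full: "full_level T i" if "i \<notin> adm_orders \<Omega>" for i using tiling_full[OF tile that] .
  have neT: "T \<noteq> {}" using tile by blast
  have disj: "i \<notin> adm_orders T" if i: "i \<in> adm_orders \<Omega>" for i
  proof
    assume "i \<in> adm_orders T"
    then obtain t t' where t: "t \<in> T" "t' \<in> T" "t - t' \<in> pZ i" "t - t' \<notin> pZ (i + 1)"
      unfolding adm_orders_iff by blast
    obtain w where w: "w \<in> \<Omega>" using ne by blast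
    \<comment> \<open>Fullness of \<Omega> absorbs \<open>t - t'\<close>, so \<open>t' + w'\<close>
      agrees with \<open>t + w\<close> modulo p^(i+1). Refining it gives an exact decomposition of
      \<open>t + w\<close> whose translate is congruent to \<open>t'\<close>, and not to
      \<open>t\<close>, modulo p^(i+1).\<close>
    obtain w' where w': "w' \<in> \<Omega>" "w' - (w + (t - t')) \<in> pZ (i + 1)"
      using fullI[OF i] w t(3) unfolding full_level_def by blast
    have "t + w - (t' + w') \<in> pZ (i + 1)" using pZ_minus[OF w'(2)] by (simp add: algebra_simps)
    from greedy[OF full t(2) w'(1) this, of "max (i + 1) N"]
    obtain t'' w'' where tw: "t'' \<in> T" "w'' \<in> \<Omega>" "t'' - t' \<in> pZ (i + 1)"
      "t + w - (t'' + w'') \<in> pZ (max (i + 1) N)" by auto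
    have "t + w - (t'' + w'') \<in> pZ N" by (rule pZ_mono[OF tw(4)]) simp
    hence "t + w - t'' \<in> \<Omega>" using periodicD[OF per tw(2), of "t + w - t''"] by (simp add: algebra_simps)
    moreover have "t + w - t \<in> \<Omega>" using w by simp
    ultimately have "t'' = t" using tile[of "t + w"] t(1) tw(1) by blast
    thus False using tw(3) t(4) by simp
  qed
  show eq: "adm_orders T = UNIV - adm_orders \<Omega>"
    using disj full_imp_adm[OF full neT card_p] by blast
  have "bdd_above (adm_orders T)"
    unfolding bdd_above_def eq by (intro exI[of _ N] ballI) (metis DiffD2 adm_ge_N linear)
  thus "homog T" unfolding homog_def using full eq by blast
qed

end

section \<open>Spectra\<close>

lemma qp_mult_zero [simp]: "x * 0 = 0" for x :: "'p::finite qp"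
  using qp_diff_distrib_left[of x 0 0] by simp

lemma chi_y_mult_cnj: "qp_chi_y l x * cnj (qp_chi_y l' x) = qp_chi (x * (l - l'))"
  by (simp add: qp_chi_y_def qp_chi_diff[symmetric] qp_diff_distrib_right[symmetric] qp_mult_commute)

lemma chi_mult_locally_constant:
  "l \<in> pZ (- L) \<Longrightarrow> y - x \<in> pZ L \<Longrightarrow> qp_chi (y * l) = qp_chi (x * l)" for l :: "'p::finite qp"
  using pZ_mult[of "y - x" L l "- L"] by (simp add: qp_chi_eq_iff qp_diff_distrib_right[symmetric])

lemma chi_y_measurable: "qp_chi_y l \<in> borel_measurable qp_haar"
proof -
  obtain n where n: "l \<in> pZ (- (- n))" using pZ_exists[of l] by auto
  show ?thesis
    by (rule locally_constant_measurable[of "- n"])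
       (simp add: qp_chi_y_def qp_mult_commute[of l] chi_mult_locally_constant[OF n])
qed

context homog_set
begin

lemma integral_chi:
  assumes "N \<le> L" "y \<in> pZ (- L)"
  shows "(LINT x:\<Omega>|qp_haar. qp_chi (x * y)) =
    of_real (real CARD('p) powi (- L)) * (\<Sum>r\<in>\<Omega> \<inter> qp_short L. qp_chi (r * y))"
  by (rule set_integral_locally_constant[OF card_p periodic_mono[OF per assms(1)] bdd])
     (rule chi_mult_locally_constant[OF assms(2)])

lemma integral_chi_zero_iff:
  assumes y: "y \<in> pZ (- i - 1)" "y \<notin> pZ (- i)"
  shows "(LINT x:\<Omega>|qp_haar. qp_chi (x * y)) = 0 \<longleftrightarrow> i \<in> adm_orders \<Omega>"
proof -
  define L where "L = max N (i + 1)"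
  have "y \<in> pZ (- L)" by (rule pZ_mono[OF y(1)]) (simp add: L_def)
  thus ?thesis using reps_chi_sum_zero_iff[of L i y] y integral_chi[of L y] by (simp add: L_def)
qed

lemma measure_pos: "measure qp_haar \<Omega> > 0"
  using measure_reps[OF card_p per bdd] reps(1,2)[of N] by (simp add: card_gt_0_iff)

lemma integral_chi_0: "(LINT x:\<Omega>|qp_haar. qp_chi (x * 0)) = of_real (measure qp_haar \<Omega>)"
  using integral_chi[of N 0] measure_reps[OF card_p per bdd] by simp

text \<open>The inner product of two characters on \<Omega> is its Fourier transform at the
  difference of the frequencies, whose vanishing is read off from the valuation. The diagonal
  entries are 1 anyway.\<close>

lemma spectrum_orthogonal_iff:
  "(\<forall>l\<in>\<Lambda>. \<forall>l'\<in>\<Lambda>. (LINT x:\<Omega>|qp_haar. qp_chi_y l x * cnj (qp_chi_y l' x)) / complex_of_real (measure qp_haar \<Omega>)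
      = (if l = l' then 1 else 0)) \<longleftrightarrow> adm_orders \<Lambda> \<subseteq> {- i - 1 | i. i \<in> adm_orders \<Omega>}"
proof -
  have "(LINT x:\<Omega>|qp_haar. qp_chi_y l x * cnj (qp_chi_y l' x)) / complex_of_real (measure qp_haar \<Omega>)
      = (if l = l' then 1 else 0) \<longleftrightarrow> (l \<noteq> l' \<longrightarrow> (LINT x:\<Omega>|qp_haar. qp_chi (x * (l - l'))) = 0)" for l l'
    unfolding chi_y_mult_cnj using measure_pos integral_chi_0 by (cases "l = l'") auto
  moreover have "(\<forall>l\<in>\<Lambda>. \<forall>l'\<in>\<Lambda>. l \<noteq> l' \<longrightarrow> (LINT x:\<Omega>|qp_haar. qp_chi (x * (l - l'))) = 0)
      \<longleftrightarrow> adm_orders \<Lambda> \<subseteq> {- i - 1 | i. i \<in> adm_orders \<Omega>}" (is "?A \<longleftrightarrow> ?B")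
  proof
    assume A: ?A
    show ?B
    proof
      fix k assume "k \<in> adm_orders \<Lambda>"
      then obtain l l' where l: "l \<in> \<Lambda>" "l' \<in> \<Lambda>" "l - l' \<in> pZ k" "l - l' \<notin> pZ (k + 1)"
        unfolding adm_orders_iff by blast
      hence "l \<noteq> l'" by auto
      hence "(LINT x:\<Omega>|qp_haar. qp_chi (x * (l - l'))) = 0" using A l by blast
      hence "- k - 1 \<in> adm_orders \<Omega>" using integral_chi_zero_iff[of "l - l'" "- k - 1"] l by (simp add: add.commute)
      moreover have "k = - (- k - 1) - 1" by simp
      ultimately show "k \<in> {- i - 1 | i. i \<in> adm_orders \<Omega>}" by blast
    qed
  next
    assume B: ?B
    show ?A
    proof (intro ballI impI)
      fix l l' assume l: "l \<in> \<Lambda>" "l' \<in> \<Lambda>" "l \<noteq> l'"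
      then obtain k where k: "l - l' \<in> pZ k" "l - l' \<notin> pZ (k + 1)" using ex_valuation[of "l - l'"] by auto
      hence "k \<in> adm_orders \<Lambda>" using l unfolding adm_orders_iff by blast
      then obtain i where i: "k = - i - 1" "i \<in> adm_orders \<Omega>" using B by blast
      thus "(LINT x:\<Omega>|qp_haar. qp_chi (x * (l - l'))) = 0" using integral_chi_zero_iff[of "l - l'" i] k by (simp add: add.commute)
    qed
  qed
  ultimately show ?thesis by simp
qed

text \<open>Square integrable functions on a set of finite measure are integrable, by a <= 1 + a^2,
  and the character has modulus 1.\<close>

lemma set_integrable_times_chi:
  assumes f: "f \<in> borel_measurable qp_haar" "set_integrable qp_haar \<Omega> (\<lambda>x. (cmod (f x))\<^sup>2)"
  shows "set_integrable qp_haar \<Omega> (\<lambda>x. f x * cnj (qp_chi_y l x))"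
  unfolding set_integrable_def
proof (rule Bochner_Integration.integrable_bound)
  have "set_integrable qp_haar \<Omega> (\<lambda>x. 1 :: real)"
    by (rule set_integrable_locally_constant[OF card_p per bdd]) simp
  from set_integral_add(1)[OF this f(2)]
  show "integrable qp_haar (\<lambda>x. indicator \<Omega> x *\<^sub>R (1 + (cmod (f x))\<^sup>2))" by (simp add: set_integrable_def)
  have [measurable]: "\<Omega> \<in> sets qp_haar" "f \<in> borel_measurable qp_haar" "qp_chi_y l \<in> borel_measurable qp_haar"
    using periodic_sets[OF per] f(1) chi_y_measurable by auto
  have "(\<lambda>x. cnj (qp_chi_y l x)) \<in> borel_measurable qp_haar"
    by (rule borel_measurable_continuous_on[of cnj]) (auto intro: continuous_intros)
  thus "(\<lambda>x. indicator \<Omega> x *\<^sub>R (f x * cnj (qp_chi_y l x))) \<in> borel_measurable qp_haar"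
    by (intro borel_measurable_scaleR borel_measurable_times) auto
  have "a \<le> 1 + a\<^sup>2" for a :: real using sum_power2_ge_zero[of "a - 1 / 2" "sqrt 3 / 2"] by (simp add: power2_eq_square field_simps)
  hence "norm (indicator \<Omega> x *\<^sub>R (f x * cnj (qp_chi_y l x))) \<le> norm (indicator \<Omega> x *\<^sub>R (1 + (cmod (f x))\<^sup>2))" for x
    by (simp add: norm_mult qp_chi_y_def qp_chi_norm indicator_def add_nonneg_nonneg)
  thus "AE x in qp_haar. norm (indicator \<Omega> x *\<^sub>R (f x * cnj (qp_chi_y l x))) \<le> norm (indicator \<Omega> x *\<^sub>R (1 + (cmod (f x))\<^sup>2))"
    by simp
qed

text \<open>The reproducing kernel of the characters in a ball of \<open>\<Lambda>\<close>. If
  \<open>x\<close> is in the small ball around \<open>r\<close>, all summands agree with the one at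
  \<open>a\<close>. Otherwise r - x has a valuation i < L that is an order of \<Omega>; then -i-1 is
  an order of \<open>\<Lambda>\<close> and at least -L, so it survives in the ball and the sum
  vanishes.\<close>

lemma spectrum_kernel:
  assumes \<Lambda>: "homog \<Lambda>" "adm_orders \<Lambda> = {- i - 1 | i. i \<in> adm_orders \<Omega>}" and a: "a \<in> \<Lambda>"
    and xr: "x \<in> \<Omega>" "r \<in> \<Omega>"
  shows "(\<Sum>l\<in>\<Lambda> \<inter> pball a (- L). qp_chi_y l r * cnj (qp_chi_y l x)) =
    (if x \<in> pball r L then of_nat (card (\<Lambda> \<inter> pball a (- L))) * (qp_chi_y a r * cnj (qp_chi_y a x)) else 0)"
proof -
  define E where "E = \<Lambda> \<inter> pball a (- L)"
  have E: "finite E" "homog E" "a \<in> E"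
    using homog_count(1)[OF \<Lambda>(1) a] homog_Int_pball[OF \<Lambda>(1)] a by (auto simp: E_def)
  have eq: "qp_chi_y l r * cnj (qp_chi_y l x) = qp_chi (l * (r - x))" for l
    by (simp add: qp_chi_y_def qp_chi_diff[symmetric] qp_diff_distrib_left)
  show ?thesis
  proof (cases "x \<in> pball r L")
    case True
    hence rx: "r - x \<in> pZ L" by (simp add: pball_def pZ_diff_commute[of r])
    have "qp_chi (l * (r - x)) = qp_chi (a * (r - x))" if "l \<in> E" for l
      using pZ_mult[OF _ rx, of "l - a" "- L"] that
      by (simp add: E_def pball_def qp_chi_eq_iff qp_diff_distrib_right[symmetric])
    thus ?thesis using True unfolding eq E_def[symmetric] by simp
  next
    case False
    hence "r - x \<notin> pZ L" by (simp add: pball_def pZ_diff_commute[of r])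
    hence "r - x \<noteq> 0" by auto
    then obtain i where i: "r - x \<in> pZ i" "r - x \<notin> pZ (i + 1)" using ex_valuation by blast
    hence iL: "i < L" using \<open>r - x \<notin> pZ L\<close> pZ_mono[of "r - x" i L] by force
    have "i \<in> adm_orders \<Omega>" using i xr unfolding adm_orders_iff by blast
    hence "- i - 1 \<in> adm_orders \<Lambda>" using \<Lambda>(2) by blast
    hence "full_level E (- i - 1)" using \<Lambda>(1) iL unfolding E_def homog_def by (intro full_Int_pball) auto
    hence "- i - 1 \<in> adm_orders E" using full_imp_adm E(3) card_p by blast
    hence "(\<Sum>l\<in>E. qp_chi (l * (r - x))) = 0" using i by (intro chi_sum_zero[OF prime E(1,2)]) (auto simp: add.commute)
    thus ?thesis using False unfolding eq E_def[symmetric] by simp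
  qed
qed

text \<open>Integrating \<open>f\<close> against the kernel yields, up to nonzero factors, the
  integral of \<open>h\<close> over a small ball. So these integrals vanish, first on balls, then on
  all measurable sets because balls generate the sigma-algebra, and \<open>h\<close> vanishes almost
  everywhere.\<close>

lemma spectrum_complete:
  assumes \<Lambda>: "homog \<Lambda>" "adm_orders \<Lambda> = {- i - 1 | i. i \<in> adm_orders \<Omega>}"
    and f: "f \<in> borel_measurable qp_haar" "set_integrable qp_haar \<Omega> (\<lambda>x. (cmod (f x))\<^sup>2)"
    and orth: "\<And>l. l \<in> \<Lambda> \<Longrightarrow> (LINT x:\<Omega>|qp_haar. f x * cnj (qp_chi_y l x)) = 0"
  shows "AE x in qp_haar. x \<in> \<Omega> \<longrightarrow> f x = 0"
proof -
  have "- N - 1 \<in> adm_orders \<Lambda>" using \<Lambda>(2) adm_ge_N[of N] by blast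
  then obtain a where a: "a \<in> \<Lambda>" by (auto simp: adm_orders_def)
  \<comment> \<open>The kernel is the indicator of a ball only up to the character at
    \<open>a\<close>; this unimodular factor is absorbed here.\<close>
  define h where "h = (\<lambda>x. f x * cnj (qp_chi_y a x))"
  define H where "H = (\<lambda>x. indicator \<Omega> x *\<^sub>R h x)"
  have int: "set_integrable qp_haar \<Omega> (\<lambda>x. f x * cnj (qp_chi_y l x))" for l
    by (rule set_integrable_times_chi[OF f])
  have inth: "set_integrable qp_haar \<Omega> h" and intH: "integrable qp_haar H"
    using int[of a] by (auto simp: h_def H_def set_integrable_def)
  have small: "(LINT x:pball r L|qp_haar. h x) = 0" if L: "N \<le> L" and r: "r \<in> \<Omega>" for r L
  proof -
    define E where "E = \<Lambda> \<inter> pball a (- L)"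
    have finE: "finite E" using homog_count(1)[OF \<Lambda>(1) a] by (simp add: E_def)
    have sub: "pball r L \<subseteq> \<Omega>" using periodic_mono[OF per L] r unfolding periodic_def by blast
    have point: "indicator \<Omega> x *\<^sub>R (\<Sum>l\<in>E. qp_chi_y l r * (f x * cnj (qp_chi_y l x))) =
        indicator (pball r L) x *\<^sub>R (of_nat (card E) * qp_chi_y a r * h x)" for x
    proof (cases "x \<in> \<Omega>")
      case True
      have "(\<Sum>l\<in>E. qp_chi_y l r * (f x * cnj (qp_chi_y l x))) = f x * (\<Sum>l\<in>E. qp_chi_y l r * cnj (qp_chi_y l x))"
        unfolding sum_distrib_left by (intro sum.cong) (simp_all add: mult_ac)
      also have "\<dots> = indicator (pball r L) x *\<^sub>R (of_nat (card E) * qp_chi_y a r * h x)"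
        unfolding E_def spectrum_kernel[OF \<Lambda> a True r] by (simp add: h_def indicator_def mult_ac)
      finally show ?thesis using True by simp
    next
      case False
      hence "x \<notin> pball r L" using sub by blast
      thus ?thesis using False by simp
    qed
    have "0 = (\<Sum>l\<in>E. qp_chi_y l r * (LINT x:\<Omega>|qp_haar. f x * cnj (qp_chi_y l x)))"
      using orth by (simp add: E_def)
    also have "\<dots> = (\<Sum>l\<in>E. (LINT x:\<Omega>|qp_haar. qp_chi_y l r * (f x * cnj (qp_chi_y l x))))" by simp
    also have "\<dots> = (LINT x:\<Omega>|qp_haar. (\<Sum>l\<in>E. qp_chi_y l r * (f x * cnj (qp_chi_y l x))))"
      unfolding set_lebesgue_integral_def scaleR_sum_right
      by (rule Bochner_Integration.integral_sum[symmetric])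
         (use set_integrable_mult_right[OF int] in \<open>auto simp: set_integrable_def\<close>)
    also have "\<dots> = (LINT x:pball r L|qp_haar. of_nat (card E) * qp_chi_y a r * h x)"
      unfolding set_lebesgue_integral_def point ..
    also have "\<dots> = of_nat (card E) * qp_chi_y a r * (LINT x:pball r L|qp_haar. h x)" by simp
    finally have "of_nat (card E) * qp_chi_y a r * (LINT x:pball r L|qp_haar. h x) = 0" by simp
    moreover have "card E \<noteq> 0" using finE a by (auto simp: E_def)
    ultimately show ?thesis by (simp add: qp_chi_y_def)
  qed
  \<comment> \<open>An arbitrary ball meets \<Omega> in a union of balls of level
    \<open>max n N\<close>, to which the previous fact applies.\<close>
  have balls: "(LINT x:pball b n|qp_haar. H x) = 0" for b n
  proof -
    define L where "L = max n N"
    define S where "S = \<Omega> \<inter> pball b n"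
    have pS: "periodic L S" using periodic_mono[OF per, of L] periodic_pball[of n L b]
      unfolding periodic_def S_def L_def by simp
    have intS: "set_integrable qp_haar S h"
      by (rule set_integrable_subset[OF inth periodic_sets[OF pS]]) (simp add: S_def)
    have bS: "S \<subseteq> pball b n" by (simp add: S_def)
    have "(LINT x:pball b n|qp_haar. H x) = (LINT x:S|qp_haar. h x)"
      unfolding set_lebesgue_integral_def H_def S_def
      by (intro Bochner_Integration.integral_cong) (auto simp: indicator_def)
    also have "\<dots> = 0"
      unfolding set_integral_reps[OF pS bS intS] by (intro sum.neutral ballI small) (auto simp: L_def S_def)
    finally show ?thesis .
  qed
  have all: "(LINT x|qp_haar. H x) = 0"
  proof -
    have "indicator (pball c M) x *\<^sub>R H x = H x" for x using bdd by (auto simp: H_def indicator_def)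
    thus ?thesis using balls[of c M] by (simp add: set_lebesgue_integral_def)
  qed
  \<comment> \<open>Two balls are nested or disjoint; the empty set is added to make the generator
    closed under intersection.\<close>
  define G where "G = insert {} (range (\<lambda>(b :: 'p qp, n). pball b n))"
  have "sigma_sets UNIV (range (\<lambda>(b :: 'p qp, n). pball b n)) = sigma_sets UNIV G"
    unfolding G_def
    by (rule sigma_sets_eqI) (auto intro: sigma_sets.Basic sigma_sets.Empty)
  hence sets_G: "sets (qp_haar :: 'p qp measure) = sigma_sets UNIV G" by (simp add: sets_haar)
  have G_sub: "G \<subseteq> Pow UNIV" by simp
  have "Int_stable G"
  proof (rule Int_stableI)
    have bb: "pball b n \<inter> pball b' n' \<in> G" if "n \<le> n'" for b b' :: "'p qp" and n n'
    proof (cases "pball b n \<inter> pball b' n' = {}")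
      case False
      then obtain x where "x \<in> pball b n" "x \<in> pball b' n'" by blast
      hence "pball b n = pball x n" "pball b' n' = pball x n'" using pball_eq by blast+
      hence "pball b n \<inter> pball b' n' = (\<lambda>(b, n). pball b n) (x, n')" using pball_mono[OF that, of x] by auto
      thus ?thesis unfolding G_def by blast
    qed (simp add: G_def)
    fix A B assume "A \<in> G" "B \<in> G"
    then consider "A \<inter> B = {}" | b n b' n' where "A = pball b n" "B = pball b' n'" unfolding G_def by auto
    thus "A \<inter> B \<in> G"
    proof cases
      case 2
      show ?thesis using bb[of n n' b b'] bb[of n' n b' b] unfolding 2
        by (cases "n \<le> n'") (auto simp: Int_commute)
    qed (simp add: G_def)
  qed
  have zero: "(LINT x:A|qp_haar. H x) = 0" if "A \<in> sets qp_haar" for A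
    using \<open>Int_stable G\<close> G_sub that[unfolded sets_G]
  proof (induction rule: sigma_sets_induct_disjoint)
    case (basic A)
    thus ?case using balls by (auto simp: G_def set_lebesgue_integral_def)
  next
    case empty
    show ?case by (simp add: set_lebesgue_integral_def)
  next
    case (compl A)
    hence A: "A \<in> sets qp_haar" by (simp add: sets_G)
    have iA: "set_integrable qp_haar B H" if "B \<in> sets qp_haar" for B
      unfolding set_integrable_def using that intH by (rule integrable_mult_indicator)
    have "(LINT x:A \<union> (UNIV - A)|qp_haar. H x) = (LINT x:A|qp_haar. H x) + (LINT x:UNIV - A|qp_haar. H x)"
      by (intro set_integral_Un iA) (use A sets.compl_sets[OF A] in auto)
    moreover have "(LINT x:A \<union> (UNIV - A)|qp_haar. H x) = 0" using all by (simp add: set_lebesgue_integral_def)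
    ultimately show ?case using compl by simp
  next
    case (union A)
    hence A: "A i \<in> sets qp_haar" for i unfolding sets_G by blast
    have "(LINT x:(\<Union>i. A i)|qp_haar. H x) = (\<Sum>i. (LINT x:A i|qp_haar. H x))"
    proof (rule lebesgue_integral_countable_add[OF A])
      show "A i \<inter> A j = {}" if "i \<noteq> j" for i j using union(1) that by (auto simp: disjoint_family_on_def)
      show "set_integrable qp_haar (\<Union> (range A)) H"
        unfolding set_integrable_def using intH A by (intro integrable_mult_indicator) auto
    qed
    thus ?case using union by simp
  qed
  interpret sigma_finite_measure "qp_haar :: 'p qp measure" by (rule sigma_finite_haar[OF card_p])
  have "AE x in qp_haar. H x = 0" by (rule density_zero[OF intH zero])
  thus ?thesis by eventually_elim (auto simp: H_def h_def indicator_def qp_chi_y_def split: if_splits)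
qed

lemma spectrumI:
  assumes "homog \<Lambda>" "adm_orders \<Lambda> = {- i - 1 | i. i \<in> adm_orders \<Omega>}"
  shows "qp_spectrum \<Omega> \<Lambda>"
  unfolding qp_spectrum_def spectrum_orthogonal_iff using assms(2) spectrum_complete[OF assms] by blast

text \<open>Completeness is applied to the residual of projecting \<open>\<chi>\<^sub>e\<close> restricted to a small ball around
  \<open>r\<close> onto the characters of \<open>\<Lambda>\<close> near \<open>e\<close>; characters of \<open>\<Lambda>\<close> far from \<open>e\<close> are automatically
  orthogonal to it.\<close>

lemma spectrum_full:
  assumes spec: "qp_spectrum \<Omega> \<Lambda>" and i: "i \<in> adm_orders \<Omega>"
  shows "full_level \<Lambda> (- i - 1)"
  unfolding full_level_def
proof (intro ballI)
  fix e z assume e: "e \<in> \<Lambda>" and z: "z \<in> (pZ (- i - 1) :: 'p qp set)"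
  have adm: "adm_orders \<Lambda> \<subseteq> {- i - 1 | i. i \<in> adm_orders \<Omega>}"
    using spec unfolding qp_spectrum_def spectrum_orthogonal_iff by blast
  have complete: "AE x in qp_haar. x \<in> \<Omega> \<longrightarrow> f x = 0"
    if "f \<in> borel_measurable qp_haar" "set_integrable qp_haar \<Omega> (\<lambda>x. (cmod (f x))\<^sup>2)"
      "\<And>l. l \<in> \<Lambda> \<Longrightarrow> (LINT x:\<Omega>|qp_haar. f x * cnj (qp_chi_y l x)) = 0" for f
    using spec that unfolding qp_spectrum_def by blast
  define P where "P = real CARD('p)"
  define m where "m = measure qp_haar \<Omega>"
  have m0: "m > 0" using measure_pos by (simp add: m_def)
  have ortho: "(LINT x:\<Omega>|qp_haar. qp_chi_y l x * cnj (qp_chi_y l' x)) = (if l = l' then of_real m else 0)"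
    if "l \<in> \<Lambda>" "l' \<in> \<Lambda>" for l l'
    using spec[unfolded qp_spectrum_def, THEN conjunct1, rule_format, OF that] m0
    by (auto simp: m_def split: if_splits)
  obtain x0 r where xr: "x0 \<in> \<Omega>" "r \<in> \<Omega>" "x0 - r \<in> pZ i" "x0 - r \<notin> pZ (i + 1)"
    using i unfolding adm_orders_iff by blast
  \<comment> \<open>At least \<open>N\<close> puts the ball around \<open>r\<close> inside \<Omega>;
    at least \<open>i + 1\<close> keeps \<open>x0\<close> outside of it.\<close>
  define L where "L = max N (i + 1)"
  have L: "N \<le> L" "i < L" "M \<le> L" using M_le_N by (auto simp: L_def)
  define E where "E = \<Lambda> \<inter> pball e (- L)"
  have sub: "pball r L \<subseteq> \<Omega>" using periodic_mono[OF per L(1)] xr(2) unfolding periodic_def by blast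
  \<comment> \<open>By orthogonality all orders of \<open>\<Lambda>\<close> are below -M, so its
    points are distinct modulo p^(-M) Z_p, and a ball contains only finitely many such
    classes.\<close>
  have finE: "finite E"
  proof (rule finite_imageD)
    have "qp_cut l (- M) \<in> qp_short (- M) \<inter> pball e (- L)" if "l \<in> E" for l
    proof -
      have "l - qp_cut l (- M) \<in> pZ (- L)" by (rule pZ_mono[OF qp_cut_diff]) (use L in simp)
      moreover have "l - e \<in> pZ (- L)" using that by (simp add: E_def pball_def)
      ultimately have "(l - e) - (l - qp_cut l (- M)) \<in> pZ (- L)" by (intro pZ_diff[of "l - e"])
      thus ?thesis by (simp add: pball_def)
    qed
    thus "finite ((\<lambda>l. qp_cut l (- M)) ` E)" by (intro finite_subset[OF _ finite_qp_short_pball]) blast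
    show "inj_on (\<lambda>l. qp_cut l (- M)) E"
    proof (rule inj_onI, rule ccontr)
      fix l l' assume l: "l \<in> E" "l' \<in> E" "qp_cut l (- M) = qp_cut l' (- M)" "l \<noteq> l'"
      have "(l - qp_cut l (- M)) - (l' - qp_cut l' (- M)) \<in> pZ (- M)" by (rule pZ_diff[OF qp_cut_diff qp_cut_diff])
      hence d: "l - l' \<in> pZ (- M)" using l(3) by simp
      obtain k where k: "l - l' \<in> pZ k" "l - l' \<notin> pZ (k + 1)" using ex_valuation[of "l - l'"] l(4) by auto
      hence "k \<in> adm_orders \<Lambda>" using l(1,2) unfolding adm_orders_iff E_def by blast
      hence "k + 1 \<le> - M" using adm adm_imp_ge_M by force
      thus False using pZ_mono[OF d] k(2) by blast
    qed
  qed
  \<comment> \<open>The Fourier coefficients of \<open>g\<close>: on the small ball, of measure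
    p^(-L), the character of e - l is constant with its value at \<open>r\<close>.\<close>
  define co where "co = (\<lambda>l. of_real (P powi (- L) / m) * (qp_chi_y e r * cnj (qp_chi_y l r)))"
  define g where "g = (\<lambda>x. indicator (pball r L) x *\<^sub>R qp_chi_y e x)"
  define res where "res = (\<lambda>x. g x - (\<Sum>l\<in>E. co l * qp_chi_y l x))"
  have B: "(LINT x:\<Omega>|qp_haar. g x * cnj (qp_chi_y l x)) = (if l \<in> E then co l * of_real m else 0)"
    if l: "l \<in> \<Lambda>" for l
  proof -
    have "(LINT x:\<Omega>|qp_haar. g x * cnj (qp_chi_y l x)) = (LINT x:pball r L|qp_haar. qp_chi (x * (e - l)))"
      unfolding set_lebesgue_integral_def chi_y_mult_cnj[symmetric] g_def
      by (intro Bochner_Integration.integral_cong) (use sub in \<open>auto simp: indicator_def\<close>)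
    also have "\<dots> = (if l \<in> E then co l * of_real m else 0)"
    proof (cases "l \<in> E")
      case True
      hence "e - l \<in> pZ (- L)" using pZ_diff_commute[of e] by (simp add: E_def pball_def)
      hence "qp_chi (x * (e - l)) = qp_chi (r * (e - l))" if "x \<in> pball r L" for x
        using chi_mult_locally_constant that by (auto simp: pball_def)
      from set_integrable_pball_const(2)[OF card_p this] show ?thesis
        using True m0 by (simp add: co_def chi_y_mult_cnj P_def scaleR_conv_of_real)
    next
      case False
      hence n: "e - l \<notin> pZ (- L)" using l pZ_diff_commute[of e] by (simp add: E_def pball_def)
      hence "e - l \<noteq> 0" by auto
      then obtain k where k: "e - l \<in> pZ k" "e - l \<notin> pZ (k + 1)" using ex_valuation by blast
      hence kL: "k < - L" using n pZ_mono[OF k(1), of "- L"] by force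
      \<comment> \<open>The small ball is homogeneous and every level from \<open>L\<close> on is an
        order of it. Since k < -L, the level -k-1 is among them, and the character of e - l
        integrates to 0 over the ball.\<close>
      interpret ball: homog_set "pball r L" L L r
      proof
        show "pball r L \<noteq> {}" using pball_self[of r L] by blast
      qed (use prime periodic_pball[of L L r] in \<open>auto intro!: full_pball dest: adm_orders_pball_ge\<close>)
      have "- k - 1 \<in> adm_orders (pball r L)" using kL by (intro ball.adm_ge_N) simp
      hence "(LINT x:pball r L|qp_haar. qp_chi (x * (e - l))) = 0"
        using ball.integral_chi_zero_iff[of "e - l" "- k - 1"] k by (simp add: add.commute)
      thus ?thesis using False by simp
    qed
    finally show ?thesis .
  qed
  have "\<exists>n. l \<in> pZ n" for l :: "'p qp" by (rule pZ_exists)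
  then obtain nn where nn: "\<And>l :: 'p qp. l \<in> pZ (nn l)" by metis
  \<comment> \<open>Fine enough for \<open>g\<close> and the finitely many characters involved to be
    constant on balls of level \<open>K\<close>. The residual is then locally constant, so its
    vanishing almost everywhere gives its vanishing at \<open>x0\<close>.\<close>
  define K where "K = Max (insert L ((\<lambda>l. - nn l) ` (insert e E)))"
  have finK: "finite (insert L ((\<lambda>l. - nn l) ` (insert e E)))" using finE by simp
  have KL: "L \<le> K" unfolding K_def by (rule Max_ge[OF finK]) simp
  have Kl: "- nn l \<le> K" if "l \<in> insert e E" for l
    unfolding K_def by (rule Max_ge[OF finK]) (use that in blast)
  have UK: "l \<in> pZ (- K)" if "l \<in> insert e E" for l using pZ_mono[OF nn, of "- K" l] Kl[OF that] by simp
  have chi_const: "qp_chi_y l y = qp_chi_y l x" if "l \<in> insert e E" "y - x \<in> pZ K" for l x y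
    using chi_mult_locally_constant[OF UK[OF that(1)] that(2)] by (simp add: qp_chi_y_def qp_mult_commute)
  have g_const: "g y = g x" if "y - x \<in> pZ K" for x y
  proof -
    have "y - x \<in> pZ L" using pZ_mono[OF that KL] .
    hence "y - r \<in> pZ L \<longleftrightarrow> x - r \<in> pZ L"
      using pZ_add[of "y - x" L "x - r"] pZ_diff[of "y - r" L "y - x"] by auto
    thus ?thesis using chi_const[OF _ that, of e] by (simp add: g_def pball_def indicator_def)
  qed
  have res_const: "res y = res x" if "y - x \<in> pZ K" for x y
    unfolding res_def using g_const[OF that] chi_const[OF _ that] by simp
  have perK: "periodic K \<Omega>" using periodic_mono[OF per] L KL by simp
  have int_g: "set_integrable qp_haar \<Omega> (\<lambda>x. g x * cnj (qp_chi_y l x))" for l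
  proof -
    obtain n where n: "l \<in> pZ n" using pZ_exists by blast
    define K' where "K' = max K (- n)"
    have "periodic K' \<Omega>" using periodic_mono[OF perK] by (simp add: K'_def)
    moreover have "g y * cnj (qp_chi_y l y) = g x * cnj (qp_chi_y l x)" if "y - x \<in> pZ K'" for x y
    proof -
      have "l \<in> pZ (- K')" by (rule pZ_mono[OF n]) (simp add: K'_def)
      hence "qp_chi_y l y = qp_chi_y l x"
        using chi_mult_locally_constant[OF _ that] by (simp add: qp_chi_y_def qp_mult_commute)
      moreover have "y - x \<in> pZ K" by (rule pZ_mono[OF that]) (simp add: K'_def)
      ultimately show ?thesis using g_const by metis
    qed
    ultimately show ?thesis by (intro set_integrable_locally_constant[OF card_p _ bdd]) auto
  qed
  have int_chi: "set_integrable qp_haar \<Omega> (\<lambda>x. qp_chi_y l x * cnj (qp_chi_y l' x))" for l l'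
  proof -
    obtain n where n: "l - l' \<in> pZ n" using pZ_exists by blast
    define K' where "K' = max K (- n)"
    have "periodic K' \<Omega>" using periodic_mono[OF perK] by (simp add: K'_def)
    moreover have "l - l' \<in> pZ (- K')" by (rule pZ_mono[OF n]) (simp add: K'_def)
    ultimately show ?thesis unfolding chi_y_mult_cnj
      by (intro set_integrable_locally_constant[OF card_p _ bdd]) (auto intro: chi_mult_locally_constant)
  qed
  have orth: "(LINT x:\<Omega>|qp_haar. res x * cnj (qp_chi_y l x)) = 0" if l: "l \<in> \<Lambda>" for l
  proof -
    have split: "res x * cnj (qp_chi_y l x) =
        g x * cnj (qp_chi_y l x) - (\<Sum>l'\<in>E. co l' * (qp_chi_y l' x * cnj (qp_chi_y l x)))" for x
      unfolding res_def left_diff_distrib sum_distrib_right mult.assoc ..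
    have i1: "set_integrable qp_haar \<Omega> (\<lambda>x. co l' * (qp_chi_y l' x * cnj (qp_chi_y l x)))" for l'
      by (rule set_integrable_mult_right[OF int_chi])
    have i2: "set_integrable qp_haar \<Omega> (\<lambda>x. \<Sum>l'\<in>E. co l' * (qp_chi_y l' x * cnj (qp_chi_y l x)))"
      using i1 unfolding set_integrable_def scaleR_sum_right by (intro Bochner_Integration.integrable_sum)
    have "(LINT x:\<Omega>|qp_haar. (\<Sum>l'\<in>E. co l' * (qp_chi_y l' x * cnj (qp_chi_y l x)))) =
        (\<Sum>l'\<in>E. (LINT x:\<Omega>|qp_haar. co l' * (qp_chi_y l' x * cnj (qp_chi_y l x))))"
      unfolding set_lebesgue_integral_def scaleR_sum_right
      by (rule Bochner_Integration.integral_sum) (use i1 in \<open>simp add: set_integrable_def\<close>)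
    also have "\<dots> = (\<Sum>l'\<in>E. if l' = l then co l * of_real m else 0)"
      using ortho l by (intro sum.cong) (auto simp: E_def)
    also have "\<dots> = (if l \<in> E then co l * of_real m else 0)" using finE by simp
    finally show ?thesis unfolding split set_integral_diff(2)[OF int_g i2] B[OF l] by simp
  qed
  have "AE x in qp_haar. x \<in> \<Omega> \<longrightarrow> res x = 0"
  proof (rule complete[OF _ _ orth])
    show "res \<in> borel_measurable qp_haar" by (rule locally_constant_measurable[OF res_const])
    show "set_integrable qp_haar \<Omega> (\<lambda>x. (cmod (res x))\<^sup>2)"
      by (rule set_integrable_locally_constant[OF card_p perK bdd]) (simp add: res_const)
  qed
  then obtain x where x: "x \<in> pball x0 K" "x \<in> \<Omega> \<longrightarrow> res x = 0" using AE_ball_ex[OF card_p] by blast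
  have "x \<in> \<Omega>" using periodicD[OF perK xr(1)] x(1) by (simp add: pball_def)
  hence "res x0 = 0" using x res_const[of x x0] by (simp add: pball_def)
  \<comment> \<open>There \<open>g\<close> is 0, so the projection alone vanishes at
    \<open>x0\<close>; up to a nonzero factor this is the character sum of \<open>E\<close> at x0 -
    r, of valuation \<open>i\<close>.\<close>
  moreover have "x0 \<notin> pball r L" using xr(4) pZ_mono[of "x0 - r" L "i + 1"] L by (auto simp: pball_def)
  ultimately have "(\<Sum>l\<in>E. co l * qp_chi_y l x0) = 0" by (simp add: res_def g_def)
  also have "(\<Sum>l\<in>E. co l * qp_chi_y l x0) =
      of_real (P powi (- L) / m) * qp_chi_y e r * (\<Sum>l\<in>E. qp_chi (l * (x0 - r)))"
    unfolding sum_distrib_left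
    by (intro sum.cong) (simp_all add: co_def qp_chi_y_def qp_diff_distrib_left qp_chi_diff mult_ac)
  finally have "(\<Sum>l\<in>E. qp_chi (l * (x0 - r))) = 0" using m0 by (simp add: P_def qp_chi_y_def)
  hence "full_level E (- i - 1)" using xr by (intro chi_sum_zero_imp_full[OF prime finE]) (auto simp: add.commute)
  moreover have "e \<in> E" using e by (simp add: E_def)
  ultimately obtain e' where "e' \<in> E" "e' - (e + z) \<in> pZ (- i - 1 + 1)" using z unfolding full_level_def by blast
  thus "\<exists>e'\<in>\<Lambda>. e' - (e + z) \<in> pZ (- i - 1 + 1)" by (auto simp: E_def)
qed

lemma spectrumD:
  assumes spec: "qp_spectrum \<Omega> \<Lambda>"
  shows "homog \<Lambda>" "adm_orders \<Lambda> = {- i - 1 | i. i \<in> adm_orders \<Omega>}"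
proof -
  have adm: "adm_orders \<Lambda> \<subseteq> {- i - 1 | i. i \<in> adm_orders \<Omega>}"
    using spec unfolding qp_spectrum_def spectrum_orthogonal_iff by blast
  \<comment> \<open>Otherwise the constant 1 would be orthogonal to the whole system.\<close>
  have "\<Lambda> \<noteq> {}"
  proof
    assume "\<Lambda> = {}"
    moreover have "set_integrable qp_haar \<Omega> (\<lambda>x. (cmod 1)\<^sup>2)"
      by (rule set_integrable_locally_constant[OF card_p per bdd]) simp
    ultimately have ae: "AE x in qp_haar. x \<in> \<Omega> \<longrightarrow> (1::complex) = 0"
      using spec[unfolded qp_spectrum_def, THEN conjunct2, THEN HOL.spec[of _ "\<lambda>_. 1"]] by simp
    obtain w where w: "w \<in> \<Omega>" using ne by blast
    obtain x where "x \<in> pball w N" "x \<in> \<Omega> \<longrightarrow> (1::complex) = 0" using AE_ball_ex[OF card_p ae] by blast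
    thus False using per w unfolding periodic_def by auto
  qed
  hence "- i - 1 \<in> adm_orders \<Lambda>" if "i \<in> adm_orders \<Omega>" for i
    using full_imp_adm[OF spectrum_full[OF spec that] _ card_p] by blast
  thus eq: "adm_orders \<Lambda> = {- i - 1 | i. i \<in> adm_orders \<Omega>}" using adm by blast
  have "bdd_above (adm_orders \<Lambda>)"
    unfolding bdd_above_def eq using adm_imp_ge_M by (intro exI[of _ "- M - 1"]) force
  moreover have "full_level \<Lambda> k" if "k \<in> adm_orders \<Lambda>" for k
    using that spectrum_full[OF spec] unfolding eq by auto
  ultimately show "homog \<Lambda>" unfolding homog_def by simp
qed

end

theorem theorem5p1:
  fixes \<Omega> :: "'p::finite qp set"
  assumes "prime CARD('p)"
    and "openin qp_top \<Omega>" and "compactin qp_top \<Omega>"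
    and "p_hom_compact_open \<Omega>"
    and "emeasure qp_haar \<Omega> > 0"
  shows "(\<forall>\<Lambda>. qp_spectrum \<Omega> \<Lambda> \<longleftrightarrow>
            p_hom_discrete \<Lambda> \<and> adm_orders \<Lambda> = {- i - 1 | i. i \<in> adm_orders \<Omega>}) \<and>
         (\<forall>T. tiling_complement \<Omega> T \<longleftrightarrow>
            p_hom_discrete T \<and> adm_orders T = UNIV - adm_orders \<Omega>)"
proof -
  obtain N M where NM: "periodic N \<Omega>" "\<Omega> \<subseteq> pball 0 M" using compact_open_periodic[OF assms(2,3)] by blast
  interpret homog_set \<Omega> N M 0
  proof
    show "\<Omega> \<noteq> {}" using assms(5) by auto
  qed (use NM assms p_hom_compact_open_full in auto)
  have "qp_spectrum \<Omega> \<Lambda> \<longleftrightarrow> homog \<Lambda> \<and> adm_orders \<Lambda> = {- i - 1 | i. i \<in> adm_orders \<Omega>}" for \<Lambda>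
    using spectrumI[of \<Lambda>] spectrumD[of \<Lambda>] by argo
  moreover have "tiling_complement \<Omega> T \<longleftrightarrow> homog T \<and> adm_orders T = UNIV - adm_orders \<Omega>" for T
    using tiling_complementI[of T] tiling_complementD[of T] by argo
  ultimately show ?thesis unfolding p_hom_discrete_iff_homog[OF card_p] by simp
qed

end
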